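(* (a) There exists $C>0$ such that $$|a(u,\phi)|\le C\,\|u\|_{H^2(\Omega)}\|\phi\|_{H^2(\Omega)}\qquad\text{for all }u,\phi\in H^2(\Omega)^3.$$ (b) For all $u,\phi\in H^2(\Omega)^3\cap H^1_0(\Omega)^3$ one has $a(u,\phi)=a(\phi,u)$.
   Context: $\Omega\subset\mathbb{R}^3$ is a bounded $C^2$ domain with outward unit normal $n$; parameters $\beta>0$, $|\gamma|\le 1$, $\ell>0$, and $k=\ell/\beta^2$. Convention: $(\nabla u)_{ij}=\partial_j u_i$. For a vector field $u$ put $\omega=\nabla\times u$ and $G=\nabla\omega+\gamma(\nabla\omega)^\top$. The bilinear form $a$ on $H^2(\Omega)^3$ is $$a(u,\phi)=\int_\Omega G:\nabla(\nabla\times\phi)+k\int_{\partial\Omega}(n\times\omega)\cdot\partial_n\phi .$$ *)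

theory Defs
  imports "HOL-Analysis.Analysis"
begin

section \<open>Classical differentiability\<close>

definition dirderiv :: "('a::euclidean_space \<Rightarrow> 'b::real_normed_vector) \<Rightarrow> 'a \<Rightarrow> 'a \<Rightarrow> 'b"
  where "dirderiv f b x = frechet_derivative f (at x) b"

primrec Ck :: "nat \<Rightarrow> ('a::euclidean_space \<Rightarrow> real) \<Rightarrow> bool" where
  "Ck 0 f \<longleftrightarrow> continuous_on UNIV f"
| "Ck (Suc m) f \<longleftrightarrow> f differentiable_on UNIV \<and> (\<forall>b\<in>Basis. Ck m (dirderiv f b))"

text \<open>The space \<open>C\<^sub>c\<^sup>\<infinity>(\<Omega>)\<close>, functions being extended by zero to the whole space.\<close>

definition test_function :: "(real^3) set \<Rightarrow> (real^3 \<Rightarrow> real) \<Rightarrow> bool" where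
  "test_function \<Omega> \<eta> \<longleftrightarrow> (\<forall>m. Ck m \<eta>) \<and>
     compact (closure {x. \<eta> x \<noteq> 0}) \<and> closure {x. \<eta> x \<noteq> 0} \<subseteq> \<Omega>"


section \<open>Domains with C\<open>\<^sup>2\<close> boundary, outward unit normal\<close>

text \<open>In the rotated coordinates \<open>R y\<close>, the set \<open>\<Omega>\<close> is, near \<open>x\<close>, the region strictly above
  the graph of \<open>h\<close>. No translation is needed as it can be absorbed into \<open>h\<close>.\<close>

definition boundary_chart ::
    "(real^3) set \<Rightarrow> real^3 \<Rightarrow> real \<Rightarrow> (real^3 \<Rightarrow> real^3) \<Rightarrow> (real^2 \<Rightarrow> real) \<Rightarrow> bool" where
  "boundary_chart \<Omega> x r R h \<longleftrightarrow> r > 0 \<and> orthogonal_transformation R \<and> Ck 2 h \<and>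
     \<Omega> \<inter> ball x r = {y \<in> ball x r. h (vector [R y $ 1, R y $ 2]) < R y $ 3}"

definition bounded_C2_domain :: "(real^3) set \<Rightarrow> bool" where
  "bounded_C2_domain \<Omega> \<longleftrightarrow> open \<Omega> \<and> connected \<Omega> \<and> \<Omega> \<noteq> {} \<and> bounded \<Omega> \<and>
     (\<forall>x\<in>frontier \<Omega>. \<exists>r R h. boundary_chart \<Omega> x r R h)"

text \<open>The downward unit normal \<open>(\<partial>\<^sub>1h, \<partial>\<^sub>2h, -1) / sqrt (1 + \<bar>\<nabla>h\<bar>\<^sup>2)\<close> of the graph, rotated back by
  \<open>R\<^sup>-\<^sup>1\<close>. It points out of \<open>\<Omega>\<close>, which lies above the graph, and does not depend on the chart.\<close>

definition chart_normal :: "real^3 \<Rightarrow> (real^3 \<Rightarrow> real^3) \<Rightarrow> (real^2 \<Rightarrow> real) \<Rightarrow> real^3" where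
  "chart_normal x R h =
     (let s = vector [R x $ 1, R x $ 2];
          p = dirderiv h (axis 1 1) s;
          q = dirderiv h (axis 2 1) s
      in inv R ((1 / sqrt (1 + p\<^sup>2 + q\<^sup>2)) *\<^sub>R vector [p, q, -1]))"

definition outward_normal :: "(real^3) set \<Rightarrow> real^3 \<Rightarrow> real^3" where
  "outward_normal \<Omega> x = (THE \<nu>. \<exists>r R h. boundary_chart \<Omega> x r R h \<and> \<nu> = chart_normal x R h)"


section \<open>Surface measure\<close>

text \<open>Regular injective \<open>C\<^sup>1\<close> parametrizations of pieces of \<open>S\<close>.\<close>

definition surface_patch :: "(real^3) set \<Rightarrow> (real^2) set \<Rightarrow> (real^2 \<Rightarrow> real^3) \<Rightarrow> bool" where
  "surface_patch S U X \<longleftrightarrow> open U \<and> X ` U \<subseteq> S \<and> inj_on X U \<and> X differentiable_on U \<and>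
     (\<forall>b\<in>Basis. continuous_on U (dirderiv X b)) \<and>
     (\<forall>s\<in>U. cross3 (dirderiv X (axis 1 1) s) (dirderiv X (axis 2 1) s) \<noteq> 0)"

text \<open>The surface measure of \<open>S\<close>, as a Borel measure on \<open>\<real>\<^sup>3\<close> concentrated on \<open>S\<close>: the one whose
  area element in every patch is \<open>\<bar>\<partial>\<^sub>1X \<times> \<partial>\<^sub>2X\<bar> ds\<close>. For a compact embedded \<open>C\<^sup>1\<close> surface this
  determines a unique measure (existence by the change of variables formula).\<close>

definition is_surface_measure :: "(real^3) set \<Rightarrow> (real^3) measure \<Rightarrow> bool" where
  "is_surface_measure S \<sigma> \<longleftrightarrow> sets \<sigma> = sets borel \<and> emeasure \<sigma> (- S) = 0 \<and>
     (\<forall>U X B. surface_patch S U X \<longrightarrow> B \<in> sets borel \<longrightarrow>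
        emeasure \<sigma> (B \<inter> X ` U) =
          (\<integral>\<^sup>+ s. ennreal (norm (cross3 (dirderiv X (axis 1 1) s) (dirderiv X (axis 2 1) s)))
                  * indicator B (X s) * indicator U s \<partial>lborel))"

definition surface_measure :: "(real^3) set \<Rightarrow> (real^3) measure" where
  "surface_measure S = (THE \<sigma>. is_surface_measure S \<sigma>)"


section \<open>Sobolev spaces of scalar functions\<close>

text \<open>Elements of the function spaces are represented by functions on \<open>\<real>\<^sup>3\<close>; only their values
  almost everywhere in \<open>\<Omega>\<close> matter, so the norms below are seminorms on representatives.\<close>

definition L2 :: "'a measure \<Rightarrow> ('a \<Rightarrow> real) set" where
  "L2 M = {f \<in> borel_measurable M. integrable M (\<lambda>x. (f x)\<^sup>2)}"

definition L2_norm :: "'a measure \<Rightarrow> ('a \<Rightarrow> real) \<Rightarrow> real" where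
  "L2_norm M f = sqrt (LINT x|M. (f x)\<^sup>2)"

definition has_weak_partial ::
    "(real^3) set \<Rightarrow> 3 \<Rightarrow> (real^3 \<Rightarrow> real) \<Rightarrow> (real^3 \<Rightarrow> real) \<Rightarrow> bool" where
  "has_weak_partial \<Omega> j f g \<longleftrightarrow> f \<in> L2 (lebesgue_on \<Omega>) \<and> g \<in> L2 (lebesgue_on \<Omega>) \<and>
     (\<forall>\<eta>. test_function \<Omega> \<eta> \<longrightarrow>
        (LINT x|lebesgue_on \<Omega>. f x * dirderiv \<eta> (axis j 1) x) =
        - (LINT x|lebesgue_on \<Omega>. g x * \<eta> x))"

text \<open>A representative of the almost everywhere unique weak partial derivative.\<close>

definition weak_partial :: "(real^3) set \<Rightarrow> 3 \<Rightarrow> (real^3 \<Rightarrow> real) \<Rightarrow> real^3 \<Rightarrow> real" where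
  "weak_partial \<Omega> j f = (SOME g. has_weak_partial \<Omega> j f g)"

definition H1 :: "(real^3) set \<Rightarrow> (real^3 \<Rightarrow> real) set" where
  "H1 \<Omega> = {f \<in> L2 (lebesgue_on \<Omega>). \<forall>j. \<exists>g. has_weak_partial \<Omega> j f g}"

definition H1_norm :: "(real^3) set \<Rightarrow> (real^3 \<Rightarrow> real) \<Rightarrow> real" where
  "H1_norm \<Omega> f = sqrt ((L2_norm (lebesgue_on \<Omega>) f)\<^sup>2
     + (\<Sum>j\<in>UNIV. (L2_norm (lebesgue_on \<Omega>) (weak_partial \<Omega> j f))\<^sup>2))"

definition H2 :: "(real^3) set \<Rightarrow> (real^3 \<Rightarrow> real) set" where
  "H2 \<Omega> = {f \<in> H1 \<Omega>. \<forall>j. weak_partial \<Omega> j f \<in> H1 \<Omega>}"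

text \<open>The second order part is the \<open>L\<^sup>2\<close> norm of the full Hessian, i.e. mixed derivatives are
  counted twice.\<close>

definition H2_norm :: "(real^3) set \<Rightarrow> (real^3 \<Rightarrow> real) \<Rightarrow> real" where
  "H2_norm \<Omega> f = sqrt ((L2_norm (lebesgue_on \<Omega>) f)\<^sup>2
     + (\<Sum>j\<in>UNIV. (L2_norm (lebesgue_on \<Omega>) (weak_partial \<Omega> j f))\<^sup>2)
     + (\<Sum>i\<in>UNIV. \<Sum>j\<in>UNIV.
          (L2_norm (lebesgue_on \<Omega>) (weak_partial \<Omega> i (weak_partial \<Omega> j f)))\<^sup>2))"

text \<open>\<open>H\<^sup>1\<^sub>0(\<Omega>)\<close>, the closure of the test functions in \<open>H\<^sup>1(\<Omega>)\<close>.\<close>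

definition H10 :: "(real^3) set \<Rightarrow> (real^3 \<Rightarrow> real) set" where
  "H10 \<Omega> = {f \<in> H1 \<Omega>. \<exists>\<eta>. (\<forall>m. test_function \<Omega> (\<eta> m)) \<and>
     (\<lambda>m. H1_norm \<Omega> (\<lambda>x. \<eta> m x - f x)) \<longlonglongrightarrow> 0}"

text \<open>The trace operator \<open>H\<^sup>1(\<Omega>) \<rightarrow> L\<^sup>2(\<partial>\<Omega>)\<close> is the continuous extension of the restriction map
  \<open>v \<mapsto> v|\<partial>\<Omega>\<close> from \<open>C\<^sup>1\<close> functions up to the boundary (here: restrictions of \<open>C\<^sup>1\<close> functions
  on \<open>\<real>\<^sup>3\<close>).\<close>

definition has_trace :: "(real^3) set \<Rightarrow> (real^3 \<Rightarrow> real) \<Rightarrow> (real^3 \<Rightarrow> real) \<Rightarrow> bool" where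
  "has_trace \<Omega> f g \<longleftrightarrow> f \<in> H1 \<Omega> \<and> g \<in> L2 (surface_measure (frontier \<Omega>)) \<and>
     (\<exists>v. (\<forall>m. Ck 1 (v m)) \<and>
        (\<lambda>m. H1_norm \<Omega> (\<lambda>x. v m x - f x)) \<longlonglongrightarrow> 0 \<and>
        (\<lambda>m. L2_norm (surface_measure (frontier \<Omega>)) (\<lambda>x. v m x - g x)) \<longlonglongrightarrow> 0)"

definition trace_on :: "(real^3) set \<Rightarrow> (real^3 \<Rightarrow> real) \<Rightarrow> real^3 \<Rightarrow> real" where
  "trace_on \<Omega> f = (SOME g. has_trace \<Omega> f g)"


section \<open>Vector fields and the bilinear form\<close>

definition H2_vec :: "(real^3) set \<Rightarrow> (real^3 \<Rightarrow> real^3) set" where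
  "H2_vec \<Omega> = {u. \<forall>i. (\<lambda>x. u x $ i) \<in> H2 \<Omega>}"

definition H10_vec :: "(real^3) set \<Rightarrow> (real^3 \<Rightarrow> real^3) set" where
  "H10_vec \<Omega> = {u. \<forall>i. (\<lambda>x. u x $ i) \<in> H10 \<Omega>}"

definition H2_vec_norm :: "(real^3) set \<Rightarrow> (real^3 \<Rightarrow> real^3) \<Rightarrow> real" where
  "H2_vec_norm \<Omega> u = sqrt (\<Sum>i\<in>UNIV. (H2_norm \<Omega> (\<lambda>x. u x $ i))\<^sup>2)"

text \<open>Convention \<open>(\<nabla>u)\<^sub>i\<^sub>j = \<partial>\<^sub>ju\<^sub>i\<close>; \<open>A $ i $ j\<close> is the entry in row \<open>i\<close>, column \<open>j\<close>.\<close>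

definition wgrad :: "(real^3) set \<Rightarrow> (real^3 \<Rightarrow> real^3) \<Rightarrow> real^3 \<Rightarrow> real^3^3" where
  "wgrad \<Omega> u x = (\<chi> i j. weak_partial \<Omega> j (\<lambda>y. u y $ i) x)"

definition wcurl :: "(real^3) set \<Rightarrow> (real^3 \<Rightarrow> real^3) \<Rightarrow> real^3 \<Rightarrow> real^3" where
  "wcurl \<Omega> u x = vector
     [wgrad \<Omega> u x $ 3 $ 2 - wgrad \<Omega> u x $ 2 $ 3,
      wgrad \<Omega> u x $ 1 $ 3 - wgrad \<Omega> u x $ 3 $ 1,
      wgrad \<Omega> u x $ 2 $ 1 - wgrad \<Omega> u x $ 1 $ 2]"

definition G_tensor :: "(real^3) set \<Rightarrow> real \<Rightarrow> (real^3 \<Rightarrow> real^3) \<Rightarrow> real^3 \<Rightarrow> real^3^3" where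
  "G_tensor \<Omega> \<gamma> u x =
     wgrad \<Omega> (wcurl \<Omega> u) x + \<gamma> *\<^sub>R transpose (wgrad \<Omega> (wcurl \<Omega> u) x)"

definition vec_trace :: "(real^3) set \<Rightarrow> (real^3 \<Rightarrow> real^3) \<Rightarrow> real^3 \<Rightarrow> real^3" where
  "vec_trace \<Omega> w x = (\<chi> i. trace_on \<Omega> (\<lambda>y. w y $ i) x)"

text \<open>\<open>\<partial>\<^sub>n\<phi> = (\<nabla>\<phi>) n\<close> on the boundary, with \<open>\<nabla>\<phi>\<close> taken in the sense of traces.\<close>

definition normal_deriv :: "(real^3) set \<Rightarrow> (real^3 \<Rightarrow> real^3) \<Rightarrow> real^3 \<Rightarrow> real^3" where
  "normal_deriv \<Omega> \<phi> x =
     (\<chi> i j. trace_on \<Omega> (\<lambda>y. wgrad \<Omega> \<phi> y $ i $ j) x) *v outward_normal \<Omega> x"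

text \<open>On \<open>3 \<times> 3\<close> matrices the inner product \<open>\<bullet>\<close> is the Frobenius product \<open>A : B\<close>.\<close>

definition a_form ::
    "(real^3) set \<Rightarrow> real \<Rightarrow> real \<Rightarrow> (real^3 \<Rightarrow> real^3) \<Rightarrow> (real^3 \<Rightarrow> real^3) \<Rightarrow> real" where
  "a_form \<Omega> \<gamma> k u \<phi> =
     (LINT x|lebesgue_on \<Omega>. G_tensor \<Omega> \<gamma> u x \<bullet> wgrad \<Omega> (wcurl \<Omega> \<phi>) x)
     + k * (LINT x:frontier \<Omega>|surface_measure (frontier \<Omega>).
              cross3 (outward_normal \<Omega> x) (vec_trace \<Omega> (wcurl \<Omega> u) x) \<bullet> normal_deriv \<Omega> \<phi> x)"

end

theory Submission
  imports Defs
begin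

text \<open>
  The volume terms are handled by Cauchy--Schwarz, and they are symmetric because
  \<open>A\<^sup>T : B = A : B\<^sup>T\<close>. For the boundary term, continuity is the trace theorem
  \<open>H\<^sup>1(\<Omega>) \<rightarrow> L\<^sup>2(\<partial>\<Omega>)\<close> applied to first derivatives. It rests on the divergence theorem in graph
  coordinates (trace inequality for \<open>C\<^sup>1\<close> functions) and on mollification with kernels supported
  in a cone pointing into \<open>\<Omega>\<close> (density of \<open>C\<^sup>1\<close> functions up to the boundary).

  If \<open>u\<close> vanishes on \<open>\<partial>\<Omega>\<close>, its tangential derivatives vanish there too, so that
  \<open>\<nabla>u = \<partial>\<^sub>nu \<otimes> n\<close> and \<open>\<omega> = n \<times> \<partial>\<^sub>nu\<close> on \<open>\<partial>\<Omega>\<close>. Hence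
  \<open>(n \<times> \<omega>) \<bullet> \<partial>\<^sub>n\<phi> = (n \<bullet> \<partial>\<^sub>nu)(n \<bullet> \<partial>\<^sub>n\<phi>) - \<partial>\<^sub>nu \<bullet> \<partial>\<^sub>n\<phi>\<close>, which is symmetric in \<open>u\<close> and \<open>\<phi>\<close>.
\<close>

section \<open>Functions of class \<open>C\<^sup>m\<close>\<close>

text \<open>The definitions pick their objects by description: surface measure and outward normal
  with \<open>THE\<close>, weak derivatives and traces with \<open>SOME\<close>. Existence and
  (almost everywhere) uniqueness must be settled before anything can be computed, and this shapes
  much of the proof. The surface measure is glued from the graph measures of a finite atlas; the
  normal is recognised by which rays from a boundary point enter \<open>\<Omega>\<close>. Uniqueness
  of weak derivatives, equality of mixed ones and vanishing of the tangential traces rest on one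
  principle: an integrable density whose integrals over boxes vanish is zero almost everywhere.
  Indicators of boxes are reached as limits of the products \<open>box_bump\<close>. The obstacle to
  symmetry is that the test functions approximating an element of \<open>H10\<close> converge in
  \<open>H1\<close> only, so the traces of their gradients say nothing about the trace of the
  limit's gradient. The tangential part is therefore treated weakly, with derivatives moved to a
  fixed bump, where convergence in \<open>H1\<close> suffices.\<close>

lemma dirderiv_eqI: "(f has_derivative f') (at x) \<Longrightarrow> dirderiv f b x = f' b"
  by (metis dirderiv_def frechet_derivative_at)

lemma Ck_SucD: "Ck (Suc m) f \<Longrightarrow> Ck m f"
  by (induction m arbitrary: f) (auto simp: differentiable_imp_continuous_on)

lemma Ck_antimono: "Ck n f \<Longrightarrow> m \<le> n \<Longrightarrow> Ck m f"
  proof (induction n)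
  case (Suc n)
  then show ?case using Ck_SucD by (cases "m = Suc n") (auto simp del: Ck.simps)
qed simp

lemma Ck_Suc_has_derivative:
  assumes "Ck (Suc m) f"
  shows "(f has_derivative (\<lambda>h. dirderiv f h x)) (at x)"
proof -
  have "f differentiable (at x)"
    using assms by (auto simp: differentiable_on_def)
  then show ?thesis
    unfolding dirderiv_def by (simp add: frechet_derivative_works[symmetric])
qed

text \<open>Any derivative, however found, can serve as the witness \<open>f'\<close>, so the
  closure properties of \<open>Ck\<close> below follow by induction from the usual differentiation
  rules, with no explicit computation of \<open>dirderiv\<close>.\<close>

lemma Ck_Suc_iff:
  "Ck (Suc m) f \<longleftrightarrow> (\<exists>f'. (\<forall>x. (f has_derivative f' x) (at x)) \<and> (\<forall>b\<in>Basis. Ck m (\<lambda>x. f' x b)))"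
proof
  assume "Ck (Suc m) f"
  then show "\<exists>f'. (\<forall>x. (f has_derivative f' x) (at x)) \<and> (\<forall>b\<in>Basis. Ck m (\<lambda>x. f' x b))"
    using Ck_Suc_has_derivative[of m f] by (intro exI[of _ "\<lambda>x h. dirderiv f h x"]) auto
next
  assume "\<exists>f'. (\<forall>x. (f has_derivative f' x) (at x)) \<and> (\<forall>b\<in>Basis. Ck m (\<lambda>x. f' x b))"
  then obtain f' where f': "\<And>x. (f has_derivative f' x) (at x)"
    and C: "\<And>b. b\<in>Basis \<Longrightarrow> Ck m (\<lambda>x. f' x b)" by auto
  have "f differentiable_on UNIV"
    using f' by (auto simp: differentiable_on_def differentiable_def)
  moreover have "dirderiv f b = (\<lambda>x. f' x b)" for b
    using dirderiv_eqI[OF f'] by auto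
  ultimately show "Ck (Suc m) f" using C by simp
qed

lemma Ck_const: "Ck m (\<lambda>x. c)"
proof (induction m arbitrary: c)
  case (Suc m)
  show ?case
    unfolding Ck_Suc_iff by (rule exI[of _ "\<lambda>x h. 0"]) (auto simp: Suc)
qed simp

lemma Ck_add: "Ck m f \<Longrightarrow> Ck m g \<Longrightarrow> Ck m (\<lambda>x. f x + g x)"
proof (induction m arbitrary: f g)
  case 0 then show ?case by (simp add: continuous_on_add)
next
  case (Suc m)
  show ?case
    unfolding Ck_Suc_iff
    using Suc by (intro exI[of _ "\<lambda>x h. dirderiv f h x + dirderiv g h x"])
       (auto intro!: has_derivative_add Ck_Suc_has_derivative[of m])
qed

lemma Ck_mult: "Ck m f \<Longrightarrow> Ck m g \<Longrightarrow> Ck m (\<lambda>x. f x * g x)"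
proof (induction m arbitrary: f g)
  case 0 then show ?case by (simp add: continuous_on_mult)
next
  case (Suc m)
  show ?case
    unfolding Ck_Suc_iff
  proof (intro exI[of _ "\<lambda>x h. f x * dirderiv g h x + dirderiv f h x * g x"] conjI allI ballI)
    show "((\<lambda>x. f x * g x) has_derivative (\<lambda>h. f x * dirderiv g h x + dirderiv f h x * g x)) (at x)" for x
      using Suc by (auto intro!: has_derivative_mult Ck_Suc_has_derivative[of m])
    show "Ck m (\<lambda>x. f x * dirderiv g b x + dirderiv f b x * g x)" if "b \<in> Basis" for b
      using Suc.prems that Ck_SucD[of m] by (intro Ck_add Suc.IH) auto
  qed
qed

lemma Ck_minus: "Ck m f \<Longrightarrow> Ck m (\<lambda>x. - f x)"
  using Ck_mult[OF Ck_const[of m "-1"], of f] by simp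

lemma Ck_diff: "Ck m f \<Longrightarrow> Ck m g \<Longrightarrow> Ck m (\<lambda>x. f x - g x)"
  using Ck_add[of m f "\<lambda>x. - g x"] Ck_minus[of m g] by simp

lemma Ck_sum: "finite A \<Longrightarrow> (\<And>i. i \<in> A \<Longrightarrow> Ck m (f i)) \<Longrightarrow> Ck m (\<lambda>x. \<Sum>i\<in>A. f i x)"
  by (induction A rule: finite_induct) (auto intro: Ck_const Ck_add)

lemma Ck_prod: "finite A \<Longrightarrow> (\<And>i. i \<in> A \<Longrightarrow> Ck m (f i)) \<Longrightarrow> Ck m (\<lambda>x. \<Prod>i\<in>A. f i x)"
  by (induction A rule: finite_induct) (auto intro: Ck_const Ck_mult)

lemma Ck_bounded_linear:
  assumes "bounded_linear f" shows "Ck m f"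
proof (cases m)
  case 0 then show ?thesis using assms by (simp add: linear_continuous_on)
next
  case (Suc n)
  have "Ck (Suc n) f" unfolding Ck_Suc_iff
    by (rule exI[of _ "\<lambda>x h. f h"]) (auto intro!: bounded_linear_imp_has_derivative assms Ck_const)
  then show ?thesis using Suc by simp
qed

text \<open>The whole sequence \<open>D\<close> of derivatives of the outer function is given at
  once, and \<open>n\<close> varies in the induction on \<open>m\<close>, because differentiating
  \<open>D n (f x)\<close> produces the factor \<open>D (Suc n) (f x)\<close>.\<close>

lemma Ck_compose_real:
  assumes D: "\<And>n t. (D n has_real_derivative D (Suc n) t) (at t)" and "Ck m f"
  shows "Ck m (\<lambda>x. D n (f x))"
  using assms(2)
proof (induction m arbitrary: n)
  case 0
  have "continuous_on UNIV (D n)" using D DERIV_continuous_on by blast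
  then show ?case using 0 continuous_on_compose2[of UNIV "D n" UNIV f] by auto
next
  case (Suc m)
  show ?case
    unfolding Ck_Suc_iff
  proof (intro exI[of _ "\<lambda>x h. D (Suc n) (f x) * dirderiv f h x"] conjI allI ballI)
    show "((\<lambda>x. D n (f x)) has_derivative (\<lambda>h. D (Suc n) (f x) * dirderiv f h x)) (at x)" for x
      using has_derivative_compose[OF Ck_Suc_has_derivative[OF Suc.prems, of x], of "D n"] D[of n "f x"]
      by (simp add: has_field_derivative_def)
    show "Ck m (\<lambda>x. D (Suc n) (f x) * dirderiv f b x)" if "b \<in> Basis" for b
      using Suc that Ck_SucD[of m] by (intro Ck_mult Suc.IH) auto
  qed
qed

text \<open>The reciprocal reappears in its own derivative, so the induction hypothesis of the lower
  order applies to it. The rule serves to normalise a partition of unity.\<close>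

lemma Ck_inverse:
  assumes "Ck m f" "\<And>x. f x > 0"
  shows "Ck m (\<lambda>x. inverse (f x))"
  using assms(1)
proof (induction m)
  case 0 then show ?case using assms(2) by (auto intro!: continuous_on_inverse simp: less_imp_neq[THEN not_sym])
next
  case (Suc m)
  show ?case
    unfolding Ck_Suc_iff
  proof (intro exI[of _ "\<lambda>x h. - (inverse (f x) * dirderiv f h x * inverse (f x))"] conjI allI ballI)
    show "((\<lambda>x. inverse (f x)) has_derivative (\<lambda>h. - (inverse (f x) * dirderiv f h x * inverse (f x)))) (at x)" for x
      using assms(2)[of x] by (intro Deriv.has_derivative_inverse Ck_Suc_has_derivative[OF Suc.prems]) auto
    show "Ck m (\<lambda>x. - (inverse (f x) * dirderiv f b x * inverse (f x)))" if "b \<in> Basis" for b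
      using Suc that Ck_SucD[of m] by (intro Ck_mult Suc.IH Ck_minus) auto
  qed
qed

lemma Ck_affine_compose:
  fixes f :: "'a::euclidean_space \<Rightarrow> real"
  assumes "Ck m f"
  shows "Ck m (\<lambda>x. f (c *\<^sub>R x + t))"
  using assms
proof (induction m arbitrary: f)
  case 0
  then show ?case by (auto intro!: continuous_intros continuous_on_compose2[of UNIV f])
next
  case (Suc m)
  show ?case
    unfolding Ck_Suc_iff
  proof (intro exI[of _ "\<lambda>x h. c * dirderiv f h (c *\<^sub>R x + t)"] conjI allI ballI)
    fix x
    have "((\<lambda>x. f (c *\<^sub>R x + t)) has_derivative (\<lambda>h. dirderiv f (c *\<^sub>R h) (c *\<^sub>R x + t))) (at x)"
      by (rule has_derivative_compose[of "\<lambda>x. c *\<^sub>R x + t" "\<lambda>h. c *\<^sub>R h" x UNIV f])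
         (auto intro!: derivative_eq_intros Ck_Suc_has_derivative[OF Suc.prems])
    moreover have "dirderiv f (c *\<^sub>R h) y = c * dirderiv f h y" for h y
      using linear_scale[OF has_derivative_linear[OF Ck_Suc_has_derivative[OF Suc.prems, of y]]] by auto
    ultimately show "((\<lambda>x. f (c *\<^sub>R x + t)) has_derivative (\<lambda>h. c * dirderiv f h (c *\<^sub>R x + t))) (at x)"
      by simp
    show "Ck m (\<lambda>x. c * dirderiv f b (c *\<^sub>R x + t))" if "b \<in> Basis" for b
      using Suc that by (intro Ck_mult Ck_const Suc.IH) auto
  qed
qed

lemma dirderiv_sum_Basis:
  assumes "Ck (Suc m) f"
  shows "dirderiv f w x = (\<Sum>b\<in>Basis. (w \<bullet> b) * dirderiv f b x)"
proof -
  interpret linear "\<lambda>h. dirderiv f h x"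
    using has_derivative_linear[OF Ck_Suc_has_derivative[OF assms]] .
  have "dirderiv f w x = dirderiv f (\<Sum>b\<in>Basis. (w \<bullet> b) *\<^sub>R b) x"
    by (simp add: euclidean_representation)
  then show ?thesis by (simp add: sum scale)
qed

lemma dirderiv_sum_axis:
  fixes f :: "real^'n \<Rightarrow> real"
  assumes "Ck (Suc m) f"
  shows "dirderiv f w x = (\<Sum>i\<in>UNIV. w$i * dirderiv f (axis i 1) x)"
proof -
  interpret linear "\<lambda>h. dirderiv f h x"
    using has_derivative_linear[OF Ck_Suc_has_derivative[OF assms]] .
  have "dirderiv f w x = dirderiv f (\<Sum>i\<in>UNIV. (w$i) *\<^sub>R axis i 1) x"
    using basis_expansion[of w] by (simp add: scalar_mult_eq_scaleR)
  then show ?thesis by (simp add: sum scale)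
qed

lemma Ck_Suc_continuous_dirderiv:
  assumes "Ck (Suc m) f" shows "continuous_on UNIV (dirderiv f w)"
proof -
  have c: "continuous_on UNIV (dirderiv f b)" if "b \<in> Basis" for b
  proof -
    have "Ck m (dirderiv f b)" using assms that by auto
    then have "Ck 0 (dirderiv f b)" using Ck_antimono by blast
    then show ?thesis by simp
  qed
  have "dirderiv f w = (\<lambda>x. (\<Sum>b\<in>Basis. (w \<bullet> b) * dirderiv f b x))"
    using dirderiv_sum_Basis[OF assms, of w] by auto
  then show ?thesis by (simp only:) (intro continuous_intros c)
qed

lemma Ck_continuous: "Ck m f \<Longrightarrow> continuous_on UNIV f"
  using Ck_antimono[of m f 0] by simp

lemma dirderiv_mult:
  assumes "Ck (Suc m) f" "Ck (Suc n) g"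
  shows "dirderiv (\<lambda>x. f x * g x) b x = f x * dirderiv g b x + dirderiv f b x * g x"
  by (intro dirderiv_eqI has_derivative_mult Ck_Suc_has_derivative[OF assms(1)] Ck_Suc_has_derivative[OF assms(2)])

section \<open>Smooth bump functions\<close>

text \<open>Functions of this form, continued by zero to the left, are a class closed under
  differentiation. This is how smoothness of the classical cutoff \<open>exp (-(1/t))\<close> is
  obtained.\<close>

definition exp_recip :: "real poly \<Rightarrow> real \<Rightarrow> real" where
  "exp_recip p t = (if t > 0 then poly p (1/t) * exp (-(1/t)) else 0)"

text \<open>The factor \<open>s^k\<close> strengthens the claim for the induction on
  \<open>p\<close>: splitting off the constant coefficient leaves a polynomial multiplied by
  \<open>s\<close>. The case \<open>k = 1\<close> controls the difference quotient of
  \<open>exp_recip\<close> at 0.\<close>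

lemma poly_div_exp_tendsto: "((\<lambda>s::real. s^k * poly p s / exp s) \<longlongrightarrow> 0) at_top"
proof (induction p arbitrary: k)
  case (pCons a p)
  have "((\<lambda>s::real. a * (s^k / exp s) + s^Suc k * poly p s / exp s) \<longlongrightarrow> a * 0 + 0) at_top"
    by (intro tendsto_intros pCons.IH tendsto_power_div_exp_0)
  then show ?case by (simp add: field_simps)
qed simp

text \<open>With \<open>s = 1/t\<close> one has \<open>d/dt = - s^2 d/ds\<close>, which maps
  \<open>p(s) exp(-s)\<close> to \<open>s^2 (p(s) - p'(s)) exp(-s)\<close>. At \<open>t = 0\<close>
  the difference quotient from the right is \<open>s p(s) exp(-s)\<close> with \<open>s\<close>
  tending to infinity, so the derivative there is 0.\<close>

lemma exp_recip_has_derivative: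
  "(exp_recip p has_real_derivative exp_recip (monom 1 2 * (p - pderiv p)) t) (at t)"
proof -
  consider "t > 0" | "t < 0" | "t = 0" by linarith
  then show ?thesis
  proof cases
    case 1
    have "((\<lambda>t. poly p (1/t) * exp (-(1/t))) has_real_derivative exp_recip (monom 1 2 * (p - pderiv p)) t) (at t)"
      using 1 by (auto intro!: derivative_eq_intros simp: exp_recip_def)
        (simp add: poly_monom power2_eq_square field_simps)
    then show ?thesis
      by (rule DERIV_cong_ev[THEN iffD1, rotated -1])
         (use 1 eventually_nhds_in_open[of "{0<..}" t] in \<open>auto simp: exp_recip_def elim!: eventually_mono\<close>)
  next
    case 2
    have "((\<lambda>t. 0) has_real_derivative exp_recip (monom 1 2 * (p - pderiv p)) t) (at t)"
      using 2 by (simp add: exp_recip_def)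
    then show ?thesis
      by (rule DERIV_cong_ev[THEN iffD1, rotated -1])
         (use 2 eventually_nhds_in_open[of "{..<0}" t] in \<open>auto simp: exp_recip_def elim!: eventually_mono\<close>)
  next
    case 3
    have "((\<lambda>y. exp_recip p y / y) \<longlongrightarrow> 0) (at_right 0)"
    proof -
      have "((\<lambda>s. exp_recip p (inverse s) / inverse s) \<longlongrightarrow> 0) at_top"
      proof (rule Lim_transform_eventually[OF poly_div_exp_tendsto[of 1 p]])
        show "eventually (\<lambda>s. s^1 * poly p s / exp s = exp_recip p (inverse s) / inverse s) at_top"
          using eventually_gt_at_top[of 0]
          by eventually_elim (auto simp: exp_recip_def exp_minus field_simps)
      qed
      then show ?thesis by (simp add: filterlim_at_right_to_top)
    qed
    moreover have "((\<lambda>y. exp_recip p y / y) \<longlongrightarrow> 0) (at_left 0)"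
      by (rule Lim_transform_eventually[OF tendsto_const])
         (use eventually_at_left_real[of "-1" 0] in \<open>auto simp: exp_recip_def elim!: eventually_mono\<close>)
    ultimately have "((\<lambda>y. exp_recip p y / y) \<longlongrightarrow> 0) (at 0)"
      by (rule filterlim_split_at[rotated])
    then show ?thesis using 3 by (simp add: has_field_derivative_iff exp_recip_def)
  qed
qed

definition step :: "real \<Rightarrow> real" where "step = exp_recip 1"

lemma step_eq: "step t = (if t > 0 then exp (-(1/t)) else 0)"
  by (simp add: step_def exp_recip_def)

lemma step_nonneg: "0 \<le> step t" and step_le_1: "step t \<le> 1" and step_pos_iff: "step t > 0 \<longleftrightarrow> t > 0"
  by (auto simp: step_eq)

lemma Ck_step: "Ck m f \<Longrightarrow> Ck m (\<lambda>x. step (f x))"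
proof -
  assume *: "Ck m f"
  \<comment> \<open>\<open>D n\<close> is the \<open>n\<close>-th derivative of \<open>step\<close>,
    obtained by iterating the map on polynomials from
    \<open>exp_recip_has_derivative\<close>.\<close>
  define D where "D n = exp_recip (((\<lambda>p. monom 1 2 * (p - pderiv p)) ^^ n) 1)" for n
  have "Ck m (\<lambda>x. D 0 (f x))"
    by (rule Ck_compose_real[OF _ *]) (auto simp: D_def intro: exp_recip_has_derivative)
  then show ?thesis by (simp add: D_def step_def)
qed

lemma step_scaled_tendsto: "(\<lambda>m. step (real (Suc m) * t)) \<longlonglongrightarrow> (if t > 0 then 1 else 0)"
proof (cases "t > 0")
  case True
  have "(\<lambda>m. exp (-((1/t) / real (Suc m)))) \<longlonglongrightarrow> exp (- 0)"
    by (intro tendsto_intros LIMSEQ_Suc[OF lim_const_over_n])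
  moreover have "step (real (Suc m) * t) = exp (-((1/t) / real (Suc m)))" for m
    using True by (simp add: step_eq zero_less_mult_iff del: of_nat_Suc)
  ultimately show ?thesis using True by (simp del: of_nat_Suc)
next
  case False
  then have "\<not> 0 < real (Suc m) * t" for m by (auto simp: zero_less_mult_iff)
  then show ?thesis using False by (simp add: step_eq del: of_nat_Suc)
qed

text \<open>Products of one-variable functions: they suffice to test against, and their mixed partial
  derivatives commute for trivial reasons.\<close>

definition box_bump :: "real \<Rightarrow> real^'n \<Rightarrow> real^'n \<Rightarrow> real^'n \<Rightarrow> real" where
  "box_bump m a b x = (\<Prod>i\<in>UNIV. step (m * (x$i - a$i)) * step (m * (b$i - x$i)))"

lemma Ck_box_bump: "Ck k (box_bump m a b)"
proof -
  have "Ck k (\<lambda>x::real^'n. x$i)" for i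
    by (intro Ck_bounded_linear bounded_linear_vec_nth)
  then show ?thesis
    unfolding box_bump_def[abs_def] by (intro Ck_prod Ck_mult Ck_step Ck_diff Ck_const) auto
qed

lemma box_bump_nonneg: "0 \<le> box_bump m a b x"
  unfolding box_bump_def by (intro prod_nonneg mult_nonneg_nonneg ballI step_nonneg)

lemma box_bump_le_1: "box_bump m a b x \<le> 1"
  unfolding box_bump_def by (intro prod_le_1 conjI mult_nonneg_nonneg mult_le_one step_nonneg step_le_1)

lemma box_bump_pos_iff:
  assumes "m > 0" shows "0 < box_bump m a b x \<longleftrightarrow> x \<in> box a b"
proof
  assume "0 < box_bump m a b x"
  then have nz: "step (m * (x$i - a$i)) * step (m * (b$i - x$i)) \<noteq> 0" for i

    using \<open>0 < box_bump m a b x\<close> prod_zero[of UNIV "\<lambda>i. step (m * (x$i - a$i)) * step (m * (b$i - x$i))"]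
    unfolding box_bump_def by fastforce
  have "m * (x$i - a$i) > 0 \<and> m * (b$i - x$i) > 0" for i
    using nz[of i] by (auto simp: step_eq split: if_splits)
  then show "x \<in> box a b" using assms by (auto simp: mem_box_cart zero_less_mult_iff)
next
  assume "x \<in> box a b"
  then show "0 < box_bump m a b x"
    unfolding box_bump_def using assms
    by (intro prod_pos) (auto simp: step_pos_iff mem_box_cart)
qed

lemma box_bump_eq_0: "m > 0 \<Longrightarrow> x \<notin> box a b \<Longrightarrow> box_bump m a b x = 0"
  using box_bump_pos_iff[of m a b x] box_bump_nonneg[of m a b x] by linarith

text \<open>Each factor sharpens to the indicator of an open half-line, being 0 for every
  \<open>m\<close> where its argument is not positive. Hence the limit holds at every point, those
  on the faces of the box included.\<close>

lemma box_bump_tendsto: "(\<lambda>m. box_bump (real (Suc m)) a b x) \<longlonglongrightarrow> indicator (box a b) x"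
proof -
  have "(\<lambda>m. box_bump (real (Suc m)) a b x) \<longlonglongrightarrow>
     (\<Prod>i\<in>UNIV. (if x$i - a$i > 0 then 1 else 0) * (if b$i - x$i > 0 then 1 else 0))"
    unfolding box_bump_def by (intro tendsto_intros step_scaled_tendsto)
  also have "(\<Prod>i\<in>UNIV. (if x$i - a$i > 0 then 1 else 0) * (if b$i - x$i > 0 then 1 else 0)) = (indicator (box a b) x :: real)"
    by (auto simp: indicator_def mem_box_cart intro!: prod.neutral)
  finally show ?thesis .
qed

lemma test_function_box_bump:
  assumes "m > 0" "cbox a b \<subseteq> \<Omega>"
  shows "test_function \<Omega> (box_bump m a b)"
proof -
  have "{x. box_bump m a b x \<noteq> 0} \<subseteq> cbox a b"
    using box_bump_eq_0[OF assms(1)] box_subset_cbox by blast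
  then have "closure {x. box_bump m a b x \<noteq> 0} \<subseteq> cbox a b"
    by (intro closure_minimal closed_cbox)
  moreover from this have "compact (closure {x. box_bump m a b x \<noteq> 0})"
    by (meson bounded_cbox bounded_subset closed_closure compact_eq_bounded_closed)
  ultimately show ?thesis
    using assms Ck_box_bump unfolding test_function_def by auto
qed

section \<open>Square integrable functions\<close>

lemma L2_D: "f \<in> L2 M \<Longrightarrow> f \<in> borel_measurable M" "f \<in> L2 M \<Longrightarrow> integrable M (\<lambda>x. (f x)\<^sup>2)"
  by (auto simp: L2_def)

lemma L2_mult_integrable:
  assumes "f \<in> L2 M" "g \<in> L2 M"
  shows "integrable M (\<lambda>x. f x * g x)"
proof (rule Bochner_Integration.integrable_bound)
  show "integrable M (\<lambda>x. (f x)\<^sup>2 + (g x)\<^sup>2)" using assms by (auto simp: L2_def)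
  show "(\<lambda>x. f x * g x) \<in> borel_measurable M" using assms by (auto simp: L2_def)
  have "\<bar>f x * g x\<bar> \<le> (f x)\<^sup>2 + (g x)\<^sup>2" for x
  proof -
    have "2 * \<bar>f x\<bar> * \<bar>g x\<bar> \<le> (f x)\<^sup>2 + (g x)\<^sup>2"
      using sum_squares_bound[of "\<bar>f x\<bar>" "\<bar>g x\<bar>"] by simp
    moreover have "0 \<le> \<bar>f x\<bar> * \<bar>g x\<bar>" by simp
    ultimately show ?thesis unfolding abs_mult by linarith
  qed
  then show "AE x in M. norm (f x * g x) \<le> norm ((f x)\<^sup>2 + (g x)\<^sup>2)" by simp
qed

lemma L2_add: assumes "f \<in> L2 M" "g \<in> L2 M" shows "(\<lambda>x. f x + g x) \<in> L2 M"
proof -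
  have "integrable M (\<lambda>x. (f x)\<^sup>2 + (g x)\<^sup>2 + 2 * (f x * g x))"
    using assms L2_mult_integrable[OF assms] by (auto simp: L2_def)
  then show ?thesis using assms by (auto simp: L2_def power2_sum mult.assoc)
qed

lemma L2_scale: "f \<in> L2 M \<Longrightarrow> (\<lambda>x. c * f x) \<in> L2 M"
  by (auto simp: L2_def power_mult_distrib)

lemma L2_minus: "f \<in> L2 M \<Longrightarrow> (\<lambda>x. - f x) \<in> L2 M"
  using L2_scale[of f M "-1"] by simp

lemma L2_diff: "f \<in> L2 M \<Longrightarrow> g \<in> L2 M \<Longrightarrow> (\<lambda>x. f x - g x) \<in> L2 M"
  using L2_add[of f M "\<lambda>x. - g x"] L2_minus[of g M] by simp

lemma L2_zero: "(\<lambda>x. 0) \<in> L2 M" by (simp add: L2_def)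

lemma L2_sum: "finite I \<Longrightarrow> (\<And>i. i \<in> I \<Longrightarrow> f i \<in> L2 M) \<Longrightarrow> (\<lambda>x. \<Sum>i\<in>I. f i x) \<in> L2 M"
  by (induction I rule: finite_induct) (auto intro: L2_add L2_zero)

lemma L2_bounded_mult:
  assumes "f \<in> L2 M" "h \<in> borel_measurable M" "AE x in M. \<bar>h x\<bar> \<le> B"
  shows "(\<lambda>x. h x * f x) \<in> L2 M"
proof -
  have "integrable M (\<lambda>x. (h x * f x)\<^sup>2)"
  proof (rule Bochner_Integration.integrable_bound)
    show "integrable M (\<lambda>x. B\<^sup>2 * (f x)\<^sup>2)" using assms by (auto simp: L2_def)
    show "(\<lambda>x. (h x * f x)\<^sup>2) \<in> borel_measurable M" using assms by (auto simp: L2_def)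
    show "AE x in M. norm ((h x * f x)\<^sup>2) \<le> norm (B\<^sup>2 * (f x)\<^sup>2)"
      using assms(3)
    proof eventually_elim
      case (elim x)
      then have "(h x)\<^sup>2 \<le> B\<^sup>2" by (simp add: abs_le_square_iff[symmetric])
      then show ?case by (simp add: power_mult_distrib mult_right_mono)
    qed
  qed
  then show ?thesis using assms by (auto simp: L2_def)
qed

lemma L2_bounded:
  assumes "finite_measure M" "h \<in> borel_measurable M" "AE x in M. \<bar>h x\<bar> \<le> B"
  shows "h \<in> L2 M"
proof -
  interpret finite_measure M by fact
  have "(\<lambda>x. 1::real) \<in> L2 M" by (auto simp: L2_def)
  from L2_bounded_mult[OF this assms(2,3)] show ?thesis by simp
qed

lemma L2_integrable: "finite_measure M \<Longrightarrow> f \<in> L2 M \<Longrightarrow> integrable M f"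
  using L2_mult_integrable[of f M "\<lambda>x. 1"] L2_bounded[of M "\<lambda>x. 1" 1] by auto

lemma L2_AE_cong:
  assumes "f \<in> L2 M" "g \<in> borel_measurable M" "AE x in M. f x = g x"
  shows "g \<in> L2 M"
proof -
  have "integrable M (\<lambda>x. (g x)\<^sup>2) \<longleftrightarrow> integrable M (\<lambda>x. (f x)\<^sup>2)"
    using assms by (intro integrable_cong_AE) (auto simp: L2_def)
  then show ?thesis using assms by (auto simp: L2_def)
qed

lemma L2_norm_nonneg: "0 \<le> L2_norm M f"
  by (simp add: L2_norm_def)

lemma L2_norm_sq: "(L2_norm M f)\<^sup>2 = (LINT x|M. (f x)\<^sup>2)"
  by (simp add: L2_norm_def)

lemma L2_norm_commute: "L2_norm M (\<lambda>x. f x - g x) = L2_norm M (\<lambda>x. g x - f x)"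
  by (simp add: L2_norm_def power2_commute)

lemma L2_norm_scale: "L2_norm M (\<lambda>x. c * f x) = \<bar>c\<bar> * L2_norm M f"
  by (simp add: L2_norm_def power_mult_distrib real_sqrt_mult)

lemma L2_norm_cong_AE:
  assumes "f \<in> borel_measurable M" "g \<in> borel_measurable M" "AE x in M. f x = g x"
  shows "L2_norm M f = L2_norm M g"
  unfolding L2_norm_def using assms by (intro arg_cong[of _ _ sqrt] integral_cong_AE) auto

lemma L2_Cauchy_Schwarz:
  assumes "f \<in> L2 M" "g \<in> L2 M"
  shows "\<bar>LINT x|M. f x * g x\<bar> \<le> L2_norm M f * L2_norm M g"
proof -
  define A B C where "A = (LINT x|M. (f x)\<^sup>2)" and "B = (LINT x|M. (g x)\<^sup>2)" and "C = (LINT x|M. f x * g x)"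
  have int: "integrable M (\<lambda>x. (f x)\<^sup>2)" "integrable M (\<lambda>x. (g x)\<^sup>2)" "integrable M (\<lambda>x. f x * g x)"
    using assms L2_mult_integrable[OF assms] by (auto simp: L2_def)
  have q: "0 \<le> t\<^sup>2 * A + 2 * t * C + B" for t
  proof -
    have "0 \<le> (LINT x|M. (t * f x + g x)\<^sup>2)" by simp
    also have "(\<lambda>x. (t * f x + g x)\<^sup>2) = (\<lambda>x. t\<^sup>2 * (f x)\<^sup>2 + 2 * t * (f x * g x) + (g x)\<^sup>2)"
      by (auto simp: power2_eq_square algebra_simps)
    also have "(LINT x|M. t\<^sup>2 * (f x)\<^sup>2 + 2 * t * (f x * g x) + (g x)\<^sup>2) = t\<^sup>2 * A + 2 * t * C + B"
      using int by (simp add: A_def B_def C_def)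
    finally show ?thesis .
  qed
  have AB: "0 \<le> A" "0 \<le> B" by (auto simp: A_def B_def)
  have "C\<^sup>2 \<le> A * B"
  proof (cases "A = 0")
    case True
    have "C = 0"
    proof (rule ccontr)
      assume "C \<noteq> 0"
      \<comment> \<open>With \<open>A = 0\<close> the quadratic expression is linear in
        \<open>t\<close>; at this \<open>t\<close> it takes the value
        \<open>B - (B + 1) = -1\<close>.\<close>
      then have "2 * (- (B + 1) / (2 * C)) * C = - (B + 1)" by simp
      then show False using q[of "- (B + 1) / (2 * C)"] True by simp
    qed
    then show ?thesis using AB by simp
  next
    case False
    then have "A > 0" using AB by simp
    \<comment> \<open>\<open>- C / A\<close> is the minimiser of the quadratic polynomial in
      \<open>t\<close>.\<close>
    have "0 \<le> (- C / A)\<^sup>2 * A + 2 * (- C / A) * C + B" by (rule q)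
    also have "\<dots> = B - C\<^sup>2 / A" using \<open>A > 0\<close> by (simp add: power2_eq_square field_simps)
    finally show ?thesis using \<open>A > 0\<close> by (simp add: field_simps)
  qed
  then have "sqrt (C\<^sup>2) \<le> sqrt (A * B)" by (rule real_sqrt_le_mono)
  then show ?thesis by (simp add: L2_norm_def A_def B_def C_def real_sqrt_mult)
qed

lemma L2_norm_triangle:
  assumes "f \<in> L2 M" "g \<in> L2 M"
  shows "L2_norm M (\<lambda>x. f x + g x) \<le> L2_norm M f + L2_norm M g"
proof (rule power2_le_imp_le)
  have int: "integrable M (\<lambda>x. (f x)\<^sup>2)" "integrable M (\<lambda>x. (g x)\<^sup>2)" "integrable M (\<lambda>x. f x * g x)"
    using assms L2_mult_integrable[OF assms] by (auto simp: L2_def)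
  have "(L2_norm M (\<lambda>x. f x + g x))\<^sup>2 = (LINT x|M. (f x)\<^sup>2 + 2 * (f x * g x) + (g x)\<^sup>2)"
    by (simp add: L2_norm_sq power2_sum algebra_simps)
  also have "\<dots> = (L2_norm M f)\<^sup>2 + 2 * (LINT x|M. f x * g x) + (L2_norm M g)\<^sup>2"
    using int by (simp add: L2_norm_sq)
  also have "\<dots> \<le> (L2_norm M f + L2_norm M g)\<^sup>2"
    using L2_Cauchy_Schwarz[OF assms] by (simp add: power2_sum)
  finally show "(L2_norm M (\<lambda>x. f x + g x))\<^sup>2 \<le> (L2_norm M f + L2_norm M g)\<^sup>2" .
qed (simp add: L2_norm_nonneg)

lemma L2_norm_triangle3:
  assumes "f \<in> L2 M" "g \<in> L2 M" "h \<in> L2 M"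
  shows "L2_norm M (\<lambda>x. f x - h x) \<le> L2_norm M (\<lambda>x. f x - g x) + L2_norm M (\<lambda>x. g x - h x)"
  using L2_norm_triangle[OF L2_diff[OF assms(1,2)] L2_diff[OF assms(2,3)]] by simp

lemma L2_norm_bounded_mult:
  assumes "f \<in> L2 M" "h \<in> borel_measurable M" "AE x in M. \<bar>h x\<bar> \<le> B" "0 \<le> B"
  shows "L2_norm M (\<lambda>x. h x * f x) \<le> B * L2_norm M f"
proof -
  have "L2_norm M (\<lambda>x. h x * f x) \<le> L2_norm M (\<lambda>x. B * f x)"
    unfolding L2_norm_def
  proof (intro real_sqrt_le_mono integral_mono_AE)
    show "AE x in M. (h x * f x)\<^sup>2 \<le> (B * f x)\<^sup>2"
      using assms(3)
    proof eventually_elim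
      case (elim x)
      then have "(h x)\<^sup>2 \<le> B\<^sup>2" by (simp add: abs_le_square_iff[symmetric])
      then show ?case by (simp add: power_mult_distrib mult_right_mono)
    qed
  qed (use L2_bounded_mult[OF assms(1-3)] L2_scale[OF assms(1)] in \<open>auto simp: L2_def\<close>)
  then show ?thesis using assms(4) by (simp add: L2_norm_scale)
qed

lemma L2_norm_eq_0_AE:
  assumes "f \<in> L2 M" "L2_norm M f = 0"
  shows "AE x in M. f x = 0"
proof -
  have "(LINT x|M. (f x)\<^sup>2) = 0" using assms(2) by (simp add: L2_norm_def)
  then have "AE x in M. (f x)\<^sup>2 = 0"
    using assms(1) by (subst (asm) integral_nonneg_eq_0_iff_AE) (auto simp: L2_def)
  then show ?thesis by simp
qed

lemma L2_limit_integral_mult: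
  assumes "\<And>m. v m \<in> L2 M" "f \<in> L2 M" "h \<in> L2 M"
    and "(\<lambda>m. L2_norm M (\<lambda>x. v m x - f x)) \<longlonglongrightarrow> 0"
  shows "(\<lambda>m. LINT x|M. v m x * h x) \<longlonglongrightarrow> (LINT x|M. f x * h x)"
proof -
  have "(\<lambda>m. (LINT x|M. v m x * h x) - (LINT x|M. f x * h x)) \<longlonglongrightarrow> 0"
  proof (rule Lim_null_comparison)
    have "\<bar>(LINT x|M. v m x * h x) - (LINT x|M. f x * h x)\<bar> \<le> L2_norm M (\<lambda>x. v m x - f x) * L2_norm M h" for m
      using L2_Cauchy_Schwarz[OF L2_diff[OF assms(1)[of m] assms(2)] assms(3)]
        L2_mult_integrable[OF assms(1)[of m] assms(3)] L2_mult_integrable[OF assms(2,3)]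
      by (simp add: left_diff_distrib)
    then show "eventually (\<lambda>m. norm ((LINT x|M. v m x * h x) - (LINT x|M. f x * h x)) \<le> L2_norm M (\<lambda>x. v m x - f x) * L2_norm M h) sequentially"
      by simp
    show "(\<lambda>m. L2_norm M (\<lambda>x. v m x - f x) * L2_norm M h) \<longlonglongrightarrow> 0"
      using tendsto_mult_right[OF assms(4), of "L2_norm M h"] by simp
  qed
  then show ?thesis by (simp add: LIM_zero_iff)
qed

lemma L2_limit_norm:
  assumes "\<And>m. v m \<in> L2 M" "f \<in> L2 M"
    and "(\<lambda>m. L2_norm M (\<lambda>x. v m x - f x)) \<longlonglongrightarrow> 0"
  shows "(\<lambda>m. L2_norm M (v m)) \<longlonglongrightarrow> L2_norm M f"
proof -
  have "(\<lambda>m. L2_norm M (v m) - L2_norm M f) \<longlonglongrightarrow> 0"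
  proof (rule Lim_null_comparison[OF _ assms(3)])
    have "\<bar>L2_norm M (v m) - L2_norm M f\<bar> \<le> L2_norm M (\<lambda>x. v m x - f x)" for m
      using L2_norm_triangle[OF L2_diff[OF assms(1)[of m] assms(2)] assms(2)]
        L2_norm_triangle[OF L2_diff[OF assms(2) assms(1)[of m]] assms(1)[of m]] L2_norm_commute[of M f "v m"]
      by simp
    then show "eventually (\<lambda>m. norm (L2_norm M (v m) - L2_norm M f) \<le> L2_norm M (\<lambda>x. v m x - f x)) sequentially"
      by simp
  qed
  then show ?thesis by (simp add: LIM_zero_iff)
qed

lemma L2_dominated_convergence:
  assumes "f \<in> borel_measurable M" "\<And>m. v m \<in> borel_measurable M" "h \<in> L2 M"
    and "\<And>m x. \<bar>v m x\<bar> \<le> \<bar>h x\<bar>"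
    and "AE x in M. (\<lambda>m. v m x) \<longlonglongrightarrow> f x"
  shows "f \<in> L2 M" and "\<And>m. v m \<in> L2 M" and "(\<lambda>m. L2_norm M (\<lambda>x. v m x - f x)) \<longlonglongrightarrow> 0"
proof -
  have fh: "AE x in M. \<bar>f x\<bar> \<le> \<bar>h x\<bar>"
    using assms(5)
  proof eventually_elim
    case (elim x)
    show ?case using LIMSEQ_le_const2[OF tendsto_rabs[OF elim], of "\<bar>h x\<bar>"] assms(4)[of _ x] by auto
  qed
  have L: "g \<in> L2 M" if "g \<in> borel_measurable M" "AE x in M. \<bar>g x\<bar> \<le> \<bar>h x\<bar>" for g
  proof -
    have "integrable M (\<lambda>x. (g x)\<^sup>2)"
    proof (rule Bochner_Integration.integrable_bound)
      show "integrable M (\<lambda>x. (h x)\<^sup>2)" using assms(3) by (simp add: L2_def)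
      show "AE x in M. norm ((g x)\<^sup>2) \<le> norm ((h x)\<^sup>2)"
        using that(2) by eventually_elim (simp add: abs_le_square_iff)
    qed (use that in simp)
    then show ?thesis using that by (simp add: L2_def)
  qed
  show f: "f \<in> L2 M" by (rule L[OF assms(1) fh])
  show v: "v m \<in> L2 M" for m by (rule L[OF assms(2)]) (simp add: assms(4))
  have "(\<lambda>m. LINT x|M. (v m x - f x)\<^sup>2) \<longlonglongrightarrow> (LINT x|M. 0)"
  proof (rule integral_dominated_convergence[where w="\<lambda>x. 4 * (h x)\<^sup>2"])
    show "integrable M (\<lambda>x. 4 * (h x)\<^sup>2)" using assms(3) by (simp add: L2_def)
    show "AE x in M. (\<lambda>m. (v m x - f x)\<^sup>2) \<longlonglongrightarrow> 0"
      using assms(5)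
    proof eventually_elim
      case (elim x)
      show ?case using tendsto_power[OF tendsto_diff[OF elim tendsto_const[of "f x"]], of 2] by simp
    qed
    show "AE x in M. norm ((v m x - f x)\<^sup>2) \<le> 4 * (h x)\<^sup>2" for m
      using fh
    proof eventually_elim
      case (elim x)
      then have "\<bar>v m x - f x\<bar> \<le> 2 * \<bar>h x\<bar>" using assms(4)[of m x] by linarith
      then have "(v m x - f x)\<^sup>2 \<le> (2 * \<bar>h x\<bar>)\<^sup>2" using abs_le_square_iff[of "v m x - f x" "2 * \<bar>h x\<bar>"] by simp
      then show ?case by (simp add: power_mult_distrib)
    qed
  qed (use assms in auto)
  then show "(\<lambda>m. L2_norm M (\<lambda>x. v m x - f x)) \<longlonglongrightarrow> 0"
    unfolding L2_norm_def using tendsto_real_sqrt by fastforce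
qed

section \<open>Integrals over boxes determine a density\<close>

text \<open>For a fixed box \<open>Q\<close> whose closed box lies in \<open>U\<close>, the sets
  over which \<open>g\<close> times the indicator of \<open>Q\<close> integrates to zero form a
  Dynkin system containing the boxes, which are stable under intersection and generate the Borel
  sets. Countably many such \<open>Q\<close> cover \<open>U\<close>. The measure is left general
  because the criterion is applied both to Lebesgue measure and to the surface measure.\<close>

lemma AE_eq_0_if_box_integrals_eq_0:
  fixes M :: "'a::euclidean_space measure" and g :: "'a \<Rightarrow> real"
  assumes sf: "sigma_finite_measure M" and M: "sets M = sets borel" and g: "integrable M g" and U: "open U"
    and zero: "\<And>a b. cbox a b \<subseteq> U \<Longrightarrow> (LINT x|M. indicator (box a b) x * g x) = 0"
  shows "AE x in M. x \<in> U \<longrightarrow> g x = 0"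
proof -
  have sp: "space M = UNIV" using sets_eq_imp_space_eq[OF M] by simp
  have box: "AE x in M. x \<in> box a b \<longrightarrow> g x = 0" if ab: "cbox a b \<subseteq> U" for a b
  proof -
    let ?Q = "box a b"
    let ?h = "\<lambda>x. indicator ?Q x * g x"
    have Q: "?Q \<in> sets M" using M by simp
    have h: "integrable M ?h" using integrable_mult_indicator[OF Q g] by simp
    have "set_lebesgue_integral M A ?h = 0" if "A \<in> sets M" for A
    proof -
      let ?G = "range (\<lambda>(a, b). box a b :: 'a set)"
      have "sets (borel :: 'a measure) = sigma_sets UNIV ?G"
        by (subst borel_eq_box) (simp add: sets_measure_of)
      then have sM: "sets M = sigma_sets UNIV ?G" using M by simp
      have A: "A \<in> sigma_sets UNIV ?G" using that sM by simp
      have G: "B \<in> sets M" if "B \<in> sigma_sets UNIV ?G" for B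
        using that sM by simp
      have si: "set_integrable M B ?h" if "B \<in> sets M" for B
        unfolding set_integrable_def by (rule integrable_mult_indicator[OF that h])
      have "Int_stable ?G"
      proof (rule Int_stableI)
        fix A B assume "A \<in> ?G" "B \<in> ?G"
        then obtain a b c d where "A = box a b" "B = box c d" by auto
        then obtain e f where "A \<inter> B = box e f" using box_Int_box[of a b c d] by blast
        then show "A \<inter> B \<in> ?G" by (intro image_eqI[of _ _ "(e, f)"]) auto
      qed
      moreover have "?G \<subseteq> Pow UNIV" by simp
      ultimately show ?thesis using A
      proof (induction rule: sigma_sets_induct_disjoint)
        case (basic A)
        then obtain c d where "A = box c d" by auto
        then obtain e f where ef: "A \<inter> ?Q = box e f" using box_Int_box[of c d a b] by blast
        have eq: "set_lebesgue_integral M A ?h = (LINT x|M. indicator (box e f) x * g x)"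
          unfolding set_lebesgue_integral_def ef[symmetric]
          by (intro Bochner_Integration.integral_cong) (auto simp: indicator_def)
        show ?case
        \<comment> \<open>The hypothesis \<open>zero\<close> speaks of closed boxes. That
          \<open>cbox e f\<close> lies in \<open>cbox a b\<close> can be inferred from the open box
          only when the latter is nonempty, so the empty one is treated apart.\<close>
        proof (cases "box e f = {}")
          case True then show ?thesis using eq by simp
        next
          case False
          have "box e f \<subseteq> cbox a b" using ef box_subset_cbox by blast
          then have "cbox e f \<subseteq> cbox a b" using False by (simp add: subset_box box_ne_empty)
          then show ?thesis using eq zero[of e f] ab by auto
        qed
      next
        case empty then show ?case by (simp add: set_lebesgue_integral_def)
      next
        case (compl A)
        have "set_lebesgue_integral M UNIV ?h = 0"
          using zero[OF ab] by (simp add: set_lebesgue_integral_def)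
        moreover have "set_lebesgue_integral M (A \<union> (UNIV - A)) ?h = set_lebesgue_integral M A ?h + set_lebesgue_integral M (UNIV - A) ?h"
          using G[OF compl(1)] sp by (intro set_integral_Un si) (auto simp: M)
        moreover have "A \<union> (UNIV - A) = UNIV" by auto
        ultimately show ?case using compl by simp
      next
        case (union A)
        have "set_lebesgue_integral M (\<Union>i. A i) ?h = (\<Sum>i. set_lebesgue_integral M (A i) ?h)"
        proof (rule lebesgue_integral_countable_add)
          show "A i \<in> sets M" for i using G union(2) by blast
          then show "set_integrable M (\<Union>i. A i) ?h" by (intro si) auto
          show "A i \<inter> A j = {}" if "i \<noteq> j" for i j using union(1) that by (auto simp: disjoint_family_on_def)
        qed
        then show ?case using union by simp
      qed
    qed
    from sigma_finite_measure.density_zero[OF sf h this] show ?thesis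
      by (auto elim!: eventually_mono simp: indicator_def)
  qed
  define F where "F = {box a b |a b::'a. cbox a b \<subseteq> U}"
  have "\<And>S. S \<in> F \<Longrightarrow> open S" by (auto simp: F_def)
  from Lindelof[OF this] obtain F' where F': "F' \<subseteq> F" "countable F'" "\<Union>F' = \<Union>F" by metis
  have "U \<subseteq> \<Union>F"
  proof
    fix x assume "x \<in> U"
    then obtain a b where "x \<in> box a b" "cbox a b \<subseteq> U"
      using open_contains_cbox[OF U, of x] by metis
    then show "x \<in> \<Union>F" by (auto simp: F_def)
  qed
  moreover have "AE x in M. \<forall>B\<in>F'. x \<in> B \<longrightarrow> g x = 0"
    using F' box by (subst AE_ball_countable) (auto simp: F_def)
  ultimately show ?thesis using F'(3) by (auto elim!: eventually_mono)
qed

section \<open>Integration by parts on the whole space\<close>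

lemma bounded_support_bound:
  fixes F :: "'a::euclidean_space \<Rightarrow> real"
  assumes "continuous_on UNIV F" "bounded K" "\<And>x. x \<notin> K \<Longrightarrow> F x = 0"
  obtains B where "B \<ge> 0" "\<And>x. \<bar>F x\<bar> \<le> B"
proof -
  obtain R where R: "K \<subseteq> cball 0 R" using assms(2) unfolding bounded_iff by (metis mem_cball_0 subsetI)
  have "compact (F ` cball 0 R)"
    using assms(1) by (intro compact_continuous_image) (auto intro: continuous_on_subset)
  then obtain B where B: "\<forall>y\<in>F ` cball 0 R. \<bar>y\<bar> \<le> B" using compact_imp_bounded bounded_real by metis
  have "\<bar>F x\<bar> \<le> max B 0" for x
  proof (cases "x \<in> K")
    case True then show ?thesis using R B by fastforce
  qed (use assms in auto)
  then show ?thesis using that[of "max B 0"] by auto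
qed

lemma integrable_bounded_support:
  fixes F :: "'a::euclidean_space \<Rightarrow> real"
  assumes "continuous_on UNIV F" "bounded K" "\<And>x. x \<notin> K \<Longrightarrow> F x = 0"
  shows "integrable lborel F"
proof -
  obtain R where R: "K \<subseteq> cball 0 R" using assms(2) unfolding bounded_iff by (metis mem_cball_0 subsetI)
  have "integrable lborel (\<lambda>x. indicator (cball 0 R) x *\<^sub>R F x)"
    using assms(1) by (intro borel_integrable_compact) (auto intro: continuous_on_subset)
  moreover have "(\<lambda>x. indicator (cball 0 R) x *\<^sub>R F x) = F"
  proof
    fix x show "indicator (cball 0 R) x *\<^sub>R F x = F x"
      using R assms(3)[of x] by (cases "x \<in> K") (auto simp: indicator_def)
  qed
  ultimately show ?thesis by simp
qed

lemma dirderiv_eq_0_outside: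
  assumes "closed K" "\<And>x. x \<notin> K \<Longrightarrow> F x = 0" "x \<notin> K"
  shows "dirderiv F w x = (0::real)"
proof -
  have "(F has_derivative (\<lambda>h. 0)) (at x)"
    by (rule has_derivative_transform_within_open[of "\<lambda>x. 0" _ _ _ "- K"]) (use assms in auto)
  then show ?thesis by (rule dirderiv_eqI)
qed

lemma Ck_deriv_along_line:
  assumes "Ck (Suc m) F"
  shows "((\<lambda>s. F (x + s *\<^sub>R w)) has_real_derivative dirderiv F w (x + s *\<^sub>R w)) (at s)"
proof -
  have "((\<lambda>s. F (x + s *\<^sub>R w)) has_derivative (\<lambda>h. dirderiv F (h *\<^sub>R w) (x + s *\<^sub>R w))) (at s)"
    by (rule has_derivative_compose[of "\<lambda>s. x + s *\<^sub>R w" "\<lambda>h. h *\<^sub>R w" s UNIV F])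
       (auto intro!: derivative_eq_intros Ck_Suc_has_derivative[OF assms])
  moreover have "dirderiv F (h *\<^sub>R w) y = dirderiv F w y * h" for h y
    using linear_scale[OF has_derivative_linear[OF Ck_Suc_has_derivative[OF assms, of y]]] by (simp add: mult.commute)
  ultimately show ?thesis by (simp add: has_field_derivative_def)
qed

lemma integral_lborel_translate:
  fixes F :: "'a::euclidean_space \<Rightarrow> real"
  assumes "F \<in> borel_measurable borel"
  shows "integral\<^sup>L lborel (\<lambda>x. F (x + c)) = integral\<^sup>L lborel F"
proof -
  have "integral\<^sup>L lborel F = integral\<^sup>L (distr lborel borel ((+) c)) F"
    by (simp add: lborel_distr_plus)
  also have "\<dots> = integral\<^sup>L lborel (\<lambda>x. F (c + x))"
    using assms by (intro integral_distr) auto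
  finally show ?thesis by (simp add: add.commute)
qed

text \<open>By translation invariance of Lebesgue measure every difference quotient of
  \<open>F\<close> has integral zero. The mean value theorem bounds the quotients by the supremum of
  the derivative, on a bounded set common to all of them, and dominated convergence gives the
  claim.\<close>

lemma integral_dirderiv_eq_0:
  fixes F :: "'a::euclidean_space \<Rightarrow> real"
  assumes F: "Ck 1 F" and K: "bounded K" and 0: "\<And>x. x \<notin> K \<Longrightarrow> F x = 0"
  shows "integral\<^sup>L lborel (dirderiv F w) = 0"
proof -
  obtain R where R: "K \<subseteq> cball 0 R" using K unfolding bounded_iff by (metis mem_cball_0 subsetI)
  have F': "Ck (Suc 0) F" using F by simp
  have cF: "continuous_on UNIV F" using F Ck_continuous by blast
  have cD: "continuous_on UNIV (dirderiv F w)" using Ck_Suc_continuous_dirderiv[OF F'] .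
  have Z: "F x = 0" if "x \<notin> cball 0 R" for x using 0[of x] subsetD[OF R, of x] that by blast
  have D0: "dirderiv F w x = 0" if "x \<notin> cball 0 R" for x
    by (rule dirderiv_eq_0_outside[OF closed_cball Z that])
  obtain B where B: "B \<ge> 0" "\<And>x. \<bar>dirderiv F w x\<bar> \<le> B"
    using bounded_support_bound[OF cD bounded_cball D0] by metis
  define D where "D m x = (F (x + (1 / real (Suc m)) *\<^sub>R w) - F x) / (1 / real (Suc m))" for m x
  have "(\<lambda>m. integral\<^sup>L lborel (D m)) \<longlonglongrightarrow> integral\<^sup>L lborel (dirderiv F w)"
  \<comment> \<open>The steps \<open>1 / Suc m\<close> are at most 1, so the translates move the
    support by at most \<open>norm w\<close>; this explains the radius.\<close>
  proof (rule integral_dominated_convergence[where w="\<lambda>x. B * indicator (cball 0 (R + norm w)) x"])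
    show "dirderiv F w \<in> borel_measurable lborel"
      using cD by (simp add: borel_measurable_continuous_onI)
    show "D m \<in> borel_measurable lborel" for m
      unfolding D_def using cF
      by (intro borel_measurable_divide borel_measurable_diff)
         (auto intro!: borel_measurable_continuous_onI continuous_intros continuous_on_compose2[OF cF])
    show "integrable lborel (\<lambda>x. B * indicator (cball 0 (R + norm w)) x)"
      using emeasure_lborel_cball_finite[of 0 "R + norm w"] by (intro integrable_mult_right) (auto simp: top.not_eq_extremum)
    show "AE x in lborel. (\<lambda>m. D m x) \<longlonglongrightarrow> dirderiv F w x"
    proof (rule AE_I2)
      fix x
      have "((\<lambda>s. (F (x + s *\<^sub>R w) - F x) / s) \<longlongrightarrow> dirderiv F w x) (at 0)"
        using Ck_deriv_along_line[OF F', of x w 0] by (simp add: has_field_derivative_iff)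
      moreover have "filterlim (\<lambda>m. 1 / real (Suc m)) (at 0) sequentially"
        using lim_inverse_n LIMSEQ_Suc[OF lim_inverse_n] by (auto simp: filterlim_at inverse_eq_divide)
      ultimately show "(\<lambda>m. D m x) \<longlonglongrightarrow> dirderiv F w x"
        unfolding D_def by (rule filterlim_compose)
    qed
    show "AE x in lborel. norm (D m x) \<le> B * indicator (cball 0 (R + norm w)) x" for m
    proof (rule AE_I2)
      fix x
      let ?t = "1 / real (Suc m)"
      have t: "?t > 0" "?t \<le> 1" by auto
      show "norm (D m x) \<le> B * indicator (cball 0 (R + norm w)) x"
      proof (cases "x \<in> cball 0 (R + norm w)")
        case True
        have "\<exists>z>0. z < ?t \<and> F (x + ?t *\<^sub>R w) - F (x + 0 *\<^sub>R w) = (?t - 0) * dirderiv F w (x + z *\<^sub>R w)"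
          by (rule MVT2[OF t(1)]) (rule Ck_deriv_along_line[OF F'])
        then obtain z where "F (x + ?t *\<^sub>R w) - F x = ?t * dirderiv F w (x + z *\<^sub>R w)" by auto
        then have "D m x = dirderiv F w (x + z *\<^sub>R w)" using t by (simp add: D_def)
        then show ?thesis using True B by simp
      next
        case False
        have "norm (?t *\<^sub>R w) \<le> norm w" using t by (simp add: mult_left_le_one_le field_simps)
        moreover have "norm x \<le> norm (x + ?t *\<^sub>R w) + norm (?t *\<^sub>R w)"
          by (metis add_diff_cancel_right' norm_triangle_ineq4)
        ultimately have "x + ?t *\<^sub>R w \<notin> cball 0 R" using False by auto
        moreover have "x \<notin> cball 0 R" using False norm_ge_zero[of w] unfolding mem_cball_0 by linarith
        ultimately show ?thesis using Z False by (simp add: D_def)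
      qed
    qed
  qed
  moreover have "integral\<^sup>L lborel (D m) = 0" for m
  proof -
    have i: "integrable lborel F" by (rule integrable_bounded_support[OF cF K 0])
    have i2: "integrable lborel (\<lambda>x. F (x + (1 / real (Suc m)) *\<^sub>R w))"
    proof (rule integrable_bounded_support)
      show "continuous_on UNIV (\<lambda>x. F (x + (1 / real (Suc m)) *\<^sub>R w))"
        by (intro continuous_on_compose2[OF cF] continuous_intros) auto
      show "bounded ((\<lambda>x. x - (1 / real (Suc m)) *\<^sub>R w) ` K)"
        using bounded_translation_minus[OF K] .
      show "F (x + (1 / real (Suc m)) *\<^sub>R w) = 0" if "x \<notin> (\<lambda>x. x - (1 / real (Suc m)) *\<^sub>R w) ` K" for x
        using that 0 by (metis add_diff_cancel image_eqI)
    qed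
    have "F \<in> borel_measurable borel" using cF by (simp add: borel_measurable_continuous_onI)
    from integral_lborel_translate[OF this]
    show ?thesis unfolding D_def using i i2 by simp
  qed
  ultimately have "(\<lambda>m. 0) \<longlonglongrightarrow> integral\<^sup>L lborel (dirderiv F w)" by simp
  then show ?thesis using LIMSEQ_unique tendsto_const by blast
qed

section \<open>Weak derivatives\<close>

locale bounded_open =
  fixes \<Omega> :: "(real^3) set"
  assumes open_dom: "open \<Omega>" and bounded_dom: "bounded \<Omega>"
begin

abbreviation LM :: "(real^3) measure" where "LM \<equiv> lebesgue_on \<Omega>"

lemma sets_dom: "\<Omega> \<in> sets borel" "\<Omega> \<in> sets lebesgue" "\<Omega> \<inter> space lebesgue \<in> sets lebesgue"
  using open_dom by auto

lemma finite_measure_LM: "finite_measure LM"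
  using bounded_set_imp_lmeasurable[OF bounded_dom sets_dom(2)] by (rule finite_measure_lebesgue_on)

lemma AE_LM: "(AE x in LM. P x) \<longleftrightarrow> (AE x in lborel. x \<in> \<Omega> \<longrightarrow> P x)"
  using sets_dom by (simp add: AE_restrict_space_iff AE_completion_iff)

lemma borel_imp_LM: "f \<in> borel_measurable borel \<Longrightarrow> f \<in> borel_measurable LM"
  by (simp add: borel_measurable_if_D measurable_completion measurable_restrict_space1)

lemma integral_LM:
  fixes f :: "real^3 \<Rightarrow> real"
  assumes "f \<in> borel_measurable borel"
  shows "integral\<^sup>L LM f = integral\<^sup>L lborel (\<lambda>x. indicator \<Omega> x * f x)"
    and "integrable LM f \<longleftrightarrow> integrable lborel (\<lambda>x. indicator \<Omega> x * f x)"
proof -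
  have m: "(\<lambda>x. indicator \<Omega> x * f x) \<in> borel_measurable lborel"
    using assms sets_dom by auto
  show "integral\<^sup>L LM f = integral\<^sup>L lborel (\<lambda>x. indicator \<Omega> x * f x)"
    using sets_dom integral_completion[OF m] by (simp add: integral_restrict_space)
  show "integrable LM f \<longleftrightarrow> integrable lborel (\<lambda>x. indicator \<Omega> x * f x)"
    using sets_dom integrable_completion[OF m] by (simp add: integrable_restrict_space)
qed

lemma integral_LM_support:
  fixes h :: "real^3 \<Rightarrow> real"
  assumes "continuous_on UNIV h" "\<And>x. x \<notin> \<Omega> \<Longrightarrow> h x = 0"
  shows "integral\<^sup>L LM h = integral\<^sup>L lborel h"
  unfolding integral_LM(1)[OF borel_measurable_continuous_onI[OF assms(1)]]
  by (intro Bochner_Integration.integral_cong refl) (use assms(2) in \<open>fastforce simp: indicator_def\<close>)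

text \<open>Elements of \<open>L2\<close> on \<open>\<Omega>\<close> are merely Lebesgue measurable
  there. Translations, product measures and mollification are carried out with Borel functions on
  the whole space, so each element is replaced by such a function, extended by zero.\<close>

lemma borel_representative:
  fixes f :: "real^3 \<Rightarrow> real"
  assumes "f \<in> borel_measurable LM"
  obtains f' where "f' \<in> borel_measurable borel" "\<And>x. x \<notin> \<Omega> \<Longrightarrow> f' x = 0" "AE x in LM. f x = f' x"
proof -
  have "(\<lambda>x. if x \<in> \<Omega> then f x else 0) \<in> borel_measurable lebesgue"
    using assms sets_dom by (simp add: borel_measurable_if)
  from completion_ex_borel_measurable_real[OF this] obtain h where
    h: "h \<in> borel_measurable lborel" "AE x in lborel. (if x \<in> \<Omega> then f x else 0) = h x" by auto
  show ?thesis
  proof (rule that[of "\<lambda>x. indicator \<Omega> x * h x"])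
    show "(\<lambda>x. indicator \<Omega> x * h x) \<in> borel_measurable borel"
      using h(1) sets_dom by auto
    show "AE x in LM. f x = indicator \<Omega> x * h x"
      unfolding AE_LM using h(2) by eventually_elim auto
  qed auto
qed

lemma L2_representative:
  assumes "f \<in> L2 LM"
  obtains f' where "f' \<in> borel_measurable borel" "\<And>x. x \<notin> \<Omega> \<Longrightarrow> f' x = 0" "AE x in LM. f x = f' x"
     "f' \<in> L2 LM" "f' \<in> L2 lborel" "integrable lborel f'"
proof -
  obtain f' where f': "f' \<in> borel_measurable borel" "\<And>x. x \<notin> \<Omega> \<Longrightarrow> f' x = 0" "AE x in LM. f x = f' x"
    using borel_representative[OF L2_D(1)[OF assms]] by metis
  have *: "f' \<in> L2 LM" using L2_AE_cong[OF assms borel_imp_LM[OF f'(1)] f'(3)] .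
  have "integrable lborel (\<lambda>x. indicator \<Omega> x * (f' x)\<^sup>2)"
    using L2_D(2)[OF *] integral_LM(2)[of "\<lambda>x. (f' x)\<^sup>2"] f'(1) by auto
  moreover have "(\<lambda>x. indicator \<Omega> x * (f' x)\<^sup>2) = (\<lambda>x. (f' x)\<^sup>2)"
    by (intro ext) (use f'(2) in \<open>fastforce simp: indicator_def\<close>)
  ultimately have 2: "f' \<in> L2 lborel" using f'(1) by (simp add: L2_def)
  have "integrable lborel (\<lambda>x. indicator \<Omega> x * f' x)"
    using L2_integrable[OF finite_measure_LM *] integral_LM(2)[OF f'(1)] by simp
  moreover have "(\<lambda>x. indicator \<Omega> x * f' x) = f'"
    by (intro ext) (use f'(2) in \<open>fastforce simp: indicator_def\<close>)
  ultimately show ?thesis using that[OF f' * 2] by simp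
qed

lemma continuous_bounded_on_dom:
  fixes h :: "real^3 \<Rightarrow> real"
  assumes "continuous_on UNIV h"
  obtains B where "B \<ge> 0" "\<And>x. x \<in> \<Omega> \<Longrightarrow> \<bar>h x\<bar> \<le> B" "AE x in LM. \<bar>h x\<bar> \<le> B"
proof -
  have "compact (h ` closure \<Omega>)"
    using assms bounded_dom by (intro compact_continuous_image) (auto intro: continuous_on_subset)
  then obtain B where B: "\<forall>y\<in>h ` closure \<Omega>. \<bar>y\<bar> \<le> B" using compact_imp_bounded bounded_real by metis
  have "\<bar>h x\<bar> \<le> max B 0" if "x \<in> \<Omega>" for x
    using B that closure_subset[of \<Omega>] by fastforce
  then show ?thesis by (intro that[of "max B 0"]) (auto simp: AE_LM)
qed

lemma continuous_measurable: "continuous_on UNIV h \<Longrightarrow> (h :: real^3 \<Rightarrow> real) \<in> borel_measurable LM"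
  by (intro borel_imp_LM borel_measurable_continuous_onI)

lemma continuous_L2:
  assumes "continuous_on UNIV h" shows "h \<in> L2 LM"
proof -
  obtain B where "AE x in LM. \<bar>h x\<bar> \<le> B" using continuous_bounded_on_dom[OF assms] by metis
  then show ?thesis by (rule L2_bounded[OF finite_measure_LM continuous_measurable[OF assms]])
qed

lemma continuous_mult_L2:
  assumes "continuous_on UNIV h" "f \<in> L2 LM" shows "(\<lambda>x. h x * f x) \<in> L2 LM"
proof -
  obtain B where "AE x in LM. \<bar>h x\<bar> \<le> B" using continuous_bounded_on_dom[OF assms(1)] by metis
  then show ?thesis by (rule L2_bounded_mult[OF assms(2) continuous_measurable[OF assms(1)]])
qed

text \<open>The bumps with parameters \<open>Suc m\<close> stay between 0 and 1 and converge to the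
  indicator of the box, so dominated convergence carries the hypothesis over to boxes, where
  \<open>AE_eq_0_if_box_integrals_eq_0\<close> applies.\<close>

lemma AE_eq_0_if_bump_integrals_eq_0:
  assumes g: "g \<in> L2 LM"
    and 0: "\<And>m a b. m > 0 \<Longrightarrow> cbox a b \<subseteq> \<Omega> \<Longrightarrow> (LINT x|LM. g x * box_bump m a b x) = 0"
  shows "AE x in LM. g x = 0"
proof -
  obtain g' where g': "g' \<in> borel_measurable borel" "\<And>x. x \<notin> \<Omega> \<Longrightarrow> g' x = 0" "AE x in LM. g x = g' x"
    "integrable lborel g'" using L2_representative[OF g] by metis
  have bc: "continuous_on UNIV (box_bump m a b)" for m and a b :: "real^3" by (rule Ck_continuous[OF Ck_box_bump])
  have bm: "box_bump m a b \<in> borel_measurable borel" for m and a b :: "real^3"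
    by (intro borel_measurable_continuous_onI bc)
  have "AE x in lborel. x \<in> \<Omega> \<longrightarrow> g' x = 0"
  proof (rule AE_eq_0_if_box_integrals_eq_0[OF sigma_finite_lborel _ g'(4) open_dom])
    fix a b assume ab: "cbox a b \<subseteq> \<Omega>"
    have "(\<lambda>m. LINT x|lborel. box_bump (real (Suc m)) a b x * g' x) \<longlonglongrightarrow> (LINT x|lborel. indicator (box a b) x * g' x)"
    proof (rule integral_dominated_convergence[where w="\<lambda>x. \<bar>g' x\<bar>"])
      show "integrable lborel (\<lambda>x. \<bar>g' x\<bar>)" using g'(4) by simp
      show "AE x in lborel. (\<lambda>m. box_bump (real (Suc m)) a b x * g' x) \<longlonglongrightarrow> indicator (box a b) x * g' x"
        by (intro AE_I2 tendsto_intros box_bump_tendsto)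
      show "AE x in lborel. norm (box_bump (real (Suc m)) a b x * g' x) \<le> \<bar>g' x\<bar>" for m
        using box_bump_nonneg[of "real (Suc m)" a b] box_bump_le_1[of "real (Suc m)" a b]
        by (intro AE_I2) (simp add: abs_mult mult_left_le_one_le del: of_nat_Suc)
    qed (use g'(1) bm in auto)
    moreover have "(LINT x|lborel. box_bump (real (Suc m)) a b x * g' x) = 0" for m
    proof -
      have "(LINT x|lborel. box_bump (real (Suc m)) a b x * g' x) = (LINT x|LM. g' x * box_bump (real (Suc m)) a b x)"
        using g'(1,2) bm by (subst integral_LM) (auto intro!: Bochner_Integration.integral_cong simp: indicator_def mult.commute)
      also have "\<dots> = (LINT x|LM. g x * box_bump (real (Suc m)) a b x)"
        using g'(3) L2_D(1)[OF g] borel_imp_LM[OF g'(1)] borel_imp_LM[OF bm]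
        by (intro integral_cong_AE) auto
      also have "\<dots> = 0" using 0 ab by simp
      finally show ?thesis .
    qed
    ultimately have "(\<lambda>m. 0) \<longlonglongrightarrow> (LINT x|lborel. indicator (box a b) x * g' x)" by simp
    then show "(LINT x|lborel. indicator (box a b) x * g' x) = 0" using LIMSEQ_unique tendsto_const by blast
  qed simp
  then have "AE x in LM. g' x = 0" by (simp add: AE_LM)
  then show ?thesis using g'(3) by eventually_elim simp
qed

lemma test_function_dirderiv:
  assumes "test_function \<Omega> \<eta>" "b \<in> Basis" shows "test_function \<Omega> (dirderiv \<eta> b)"
proof -
  let ?K = "closure {x. \<eta> x \<noteq> 0}"
  have C: "\<And>m. Ck m \<eta>" and K: "compact ?K" "?K \<subseteq> \<Omega>"

    using assms unfolding test_function_def by blast+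
  have "\<eta> x = 0" if "x \<notin> ?K" for x using that closure_subset[of "{x. \<eta> x \<noteq> 0}"] by auto
  then have "{x. dirderiv \<eta> b x \<noteq> 0} \<subseteq> ?K"
    using dirderiv_eq_0_outside[of ?K \<eta> _ b, OF closed_closure] by (metis (mono_tags, lifting) mem_Collect_eq subsetI)
  then have *: "closure {x. dirderiv \<eta> b x \<noteq> 0} \<subseteq> ?K" by (intro closure_minimal) auto
  have "compact (closure {x. dirderiv \<eta> b x \<noteq> 0})"
    using closed_closure compact_Int_closed[OF K(1), of "closure {x. dirderiv \<eta> b x \<noteq> 0}"] * by (simp add: Int_absorb1)
  moreover have "Ck m (dirderiv \<eta> b)" for m using C[of "Suc m"] assms(2) by simp
  ultimately show ?thesis using * K unfolding test_function_def by auto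
qed

lemma test_function_continuous: "test_function \<Omega> \<eta> \<Longrightarrow> continuous_on UNIV \<eta>"
  "test_function \<Omega> \<eta> \<Longrightarrow> continuous_on UNIV (dirderiv \<eta> w)"
  by (auto simp: test_function_def intro: Ck_continuous[of 0] Ck_Suc_continuous_dirderiv[of 0])

text \<open>The product of \<open>v\<close> and \<open>\<eta>\<close> has compact support in
  \<open>\<Omega>\<close>, so its derivative integrates to zero over the whole space by
  \<open>integral_dirderiv_eq_0\<close>, and all integrals involved may be restricted to
  \<open>\<Omega>\<close>.\<close>

lemma integration_by_parts:
  assumes v: "Ck 1 v" and \<eta>: "test_function \<Omega> \<eta>"
  shows "(LINT x|LM. v x * dirderiv \<eta> w x) = - (LINT x|LM. dirderiv v w x * \<eta> x)"
proof -
  let ?K = "closure {x. \<eta> x \<noteq> 0}"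
  have C: "\<And>m. Ck m \<eta>" and K: "compact ?K" "?K \<subseteq> \<Omega>"
    using \<eta> unfolding test_function_def by blast+
  have Z: "\<eta> x = 0" if "x \<notin> ?K" for x using that closure_subset[of "{x. \<eta> x \<noteq> 0}"] by auto
  have v': "Ck (Suc 0) v" using v by simp
  note cont = Ck_continuous[OF v] Ck_continuous[OF C[of 1]] Ck_Suc_continuous_dirderiv[OF v', of w] Ck_Suc_continuous_dirderiv[OF C[of "Suc 0"], of w]
  have c: "continuous_on UNIV (\<lambda>x. v x * dirderiv \<eta> w x)" "continuous_on UNIV (\<lambda>x. dirderiv v w x * \<eta> x)"
    using cont by (auto intro!: continuous_on_mult)
  have z: "v x * dirderiv \<eta> w x = 0" "dirderiv v w x * \<eta> x = 0" if "x \<notin> ?K" for x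
    using dirderiv_eq_0_outside[of ?K \<eta> x w, OF closed_closure Z that] Z[OF that] by simp_all
  have b: "bounded ?K" using K by (simp add: compact_imp_bounded)
  have i: "integrable lborel (\<lambda>x. v x * dirderiv \<eta> w x)" "integrable lborel (\<lambda>x. dirderiv v w x * \<eta> x)"
    using integrable_bounded_support[OF c(1) b z(1)] integrable_bounded_support[OF c(2) b z(2)] by auto
  have "Ck 1 (\<lambda>x. v x * \<eta> x)" by (intro Ck_mult v C)
  then have "0 = integral\<^sup>L lborel (dirderiv (\<lambda>x. v x * \<eta> x) w)"
    by (rule integral_dirderiv_eq_0[symmetric, OF _ b]) (metis Z mult_zero_right)
  also have "dirderiv (\<lambda>x. v x * \<eta> x) w = (\<lambda>x. v x * dirderiv \<eta> w x + dirderiv v w x * \<eta> x)"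
    using dirderiv_mult[OF v' C[of "Suc 0"]] by auto
  also have "integral\<^sup>L lborel \<dots> = (LINT x|lborel. v x * dirderiv \<eta> w x) + (LINT x|lborel. dirderiv v w x * \<eta> x)"
    using i by simp
  also have "(LINT x|lborel. v x * dirderiv \<eta> w x) = (LINT x|LM. v x * dirderiv \<eta> w x)"
    by (rule integral_LM_support[symmetric, OF c(1)]) (rule z(1), use K(2) in blast)
  also have "(LINT x|lborel. dirderiv v w x * \<eta> x) = (LINT x|LM. dirderiv v w x * \<eta> x)"
    by (rule integral_LM_support[symmetric, OF c(2)]) (rule z(2), use K(2) in blast)
  finally show ?thesis by simp
qed

section \<open>Rules for weak derivatives\<close>

abbreviation WP where "WP \<equiv> has_weak_partial \<Omega>"

lemma WP_L2: "WP j f g \<Longrightarrow> f \<in> L2 LM" "WP j f g \<Longrightarrow> g \<in> L2 LM"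
  by (auto simp: has_weak_partial_def)

lemma test_function_L2: "test_function \<Omega> \<eta> \<Longrightarrow> \<eta> \<in> L2 LM" "test_function \<Omega> \<eta> \<Longrightarrow> dirderiv \<eta> w \<in> L2 LM"
  by (auto intro: continuous_L2 test_function_continuous)

lemma WP_test: "WP j f g \<Longrightarrow> test_function \<Omega> \<eta> \<Longrightarrow>
    (LINT x|LM. f x * dirderiv \<eta> (axis j 1) x) = - (LINT x|LM. g x * \<eta> x)"
  by (auto simp: has_weak_partial_def)

lemma WP_unique:
  assumes "WP j f g" "WP j f g'"
  shows "AE x in LM. g x = g' x"
proof -
  have "AE x in LM. g x - g' x = 0"
  proof (rule AE_eq_0_if_bump_integrals_eq_0)
    show "(\<lambda>x. g x - g' x) \<in> L2 LM" using assms by (intro L2_diff WP_L2)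
    fix m :: real and a b :: "real^3" assume "m > 0" "cbox a b \<subseteq> \<Omega>"
    then have t: "test_function \<Omega> (box_bump m a b)" by (rule test_function_box_bump)
    show "(LINT x|LM. (g x - g' x) * box_bump m a b x) = 0"
      using WP_test[OF assms(1) t] WP_test[OF assms(2) t]
        L2_mult_integrable[OF WP_L2(2)[OF assms(1)] test_function_L2(1)[OF t]]
        L2_mult_integrable[OF WP_L2(2)[OF assms(2)] test_function_L2(1)[OF t]]
      by (simp add: left_diff_distrib)
  qed
  then show ?thesis by simp
qed

lemma WP_AE_cong:
  assumes "WP j f g" "f' \<in> borel_measurable LM" "g' \<in> borel_measurable LM"
    "AE x in LM. f x = f' x" "AE x in LM. g x = g' x"
  shows "WP j f' g'"
  unfolding has_weak_partial_def
proof (intro conjI allI impI)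
  show "f' \<in> L2 LM" "g' \<in> L2 LM"
    using L2_AE_cong[OF WP_L2(1)[OF assms(1)] assms(2,4)] L2_AE_cong[OF WP_L2(2)[OF assms(1)] assms(3,5)] by auto
  fix \<eta> assume t: "test_function \<Omega> \<eta>"
  note m = L2_D(1)[OF WP_L2(1)[OF assms(1)]] L2_D(1)[OF WP_L2(2)[OF assms(1)]]
    L2_D(1)[OF test_function_L2(1)[OF t]] L2_D(1)[OF test_function_L2(2)[OF t]]
  have "(LINT x|LM. f' x * dirderiv \<eta> (axis j 1) x) = (LINT x|LM. f x * dirderiv \<eta> (axis j 1) x)"
    using assms m by (intro integral_cong_AE) auto
  moreover have "(LINT x|LM. g' x * \<eta> x) = (LINT x|LM. g x * \<eta> x)"
    using assms m by (intro integral_cong_AE) auto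
  ultimately show "(LINT x|LM. f' x * dirderiv \<eta> (axis j 1) x) = - (LINT x|LM. g' x * \<eta> x)"
    using WP_test[OF assms(1) t] by simp
qed

lemma WP_add:
  assumes "WP j f g" "WP j f' g'"
  shows "WP j (\<lambda>x. f x + f' x) (\<lambda>x. g x + g' x)"
  unfolding has_weak_partial_def
proof (intro conjI allI impI L2_add)
  fix \<eta> assume t: "test_function \<Omega> \<eta>"
  show "(LINT x|LM. (f x + f' x) * dirderiv \<eta> (axis j 1) x) = - (LINT x|LM. (g x + g' x) * \<eta> x)"
    using WP_test[OF assms(1) t] WP_test[OF assms(2) t]
        L2_mult_integrable[OF WP_L2(2)[OF assms(1)] test_function_L2(1)[OF t]]
        L2_mult_integrable[OF WP_L2(2)[OF assms(2)] test_function_L2(1)[OF t]]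
        L2_mult_integrable[OF WP_L2(1)[OF assms(1)] test_function_L2(2)[OF t]]
        L2_mult_integrable[OF WP_L2(1)[OF assms(2)] test_function_L2(2)[OF t]]
    by (simp add: distrib_right)
qed (use assms in \<open>auto intro: WP_L2\<close>)

lemma WP_scale: "WP j f g \<Longrightarrow> WP j (\<lambda>x. c * f x) (\<lambda>x. c * g x)"
  unfolding has_weak_partial_def by (auto simp: L2_scale mult.assoc)

lemma WP_diff:
  assumes "WP j f g" "WP j f' g'"
  shows "WP j (\<lambda>x. f x - f' x) (\<lambda>x. g x - g' x)"
  using WP_add[OF assms(1) WP_scale[OF assms(2), of "-1"]] by simp

lemma WP_zero: "WP j (\<lambda>x. 0) (\<lambda>x. 0)"
  by (auto simp: has_weak_partial_def L2_zero)

lemma WP_sum: "finite I \<Longrightarrow> (\<And>i. i \<in> I \<Longrightarrow> WP j (f i) (g i)) \<Longrightarrow> WP j (\<lambda>x. \<Sum>i\<in>I. f i x) (\<lambda>x. \<Sum>i\<in>I. g i x)"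
  by (induction I rule: finite_induct) (auto intro: WP_zero WP_add)

lemma WP_Ck:
  assumes "Ck 1 v" shows "WP j v (dirderiv v (axis j 1))"
proof -
  have "Ck (Suc 0) v" using assms by simp
  then show ?thesis
  unfolding has_weak_partial_def
  using integration_by_parts[OF assms] continuous_L2[OF Ck_continuous[OF assms]]
    continuous_L2[OF Ck_Suc_continuous_dirderiv[of 0 v "axis j 1"]] by auto
qed

text \<open>Multiplication by \<open>\<zeta>\<close> is shifted to the test function:
  \<open>\<zeta>\<close> times \<open>\<eta>\<close> is again one, and the classical product rule
  for it supplies the extra term with the derivative of \<open>\<zeta>\<close>.\<close>

lemma WP_mult_smooth:
  assumes w: "WP j f g" and \<zeta>: "\<And>m. Ck m \<zeta>"
  shows "WP j (\<lambda>x. \<zeta> x * f x) (\<lambda>x. dirderiv \<zeta> (axis j 1) x * f x + \<zeta> x * g x)"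
  unfolding has_weak_partial_def
proof (intro conjI allI impI L2_add)
  have c: "continuous_on UNIV \<zeta>" "continuous_on UNIV (dirderiv \<zeta> (axis j 1))"
    using Ck_continuous[OF \<zeta>] Ck_Suc_continuous_dirderiv[OF \<zeta>] by auto
  show "(\<lambda>x. \<zeta> x * f x) \<in> L2 LM" "(\<lambda>x. \<zeta> x * g x) \<in> L2 LM" "(\<lambda>x. dirderiv \<zeta> (axis j 1) x * f x) \<in> L2 LM"
    by (intro continuous_mult_L2 c WP_L2(1)[OF w] WP_L2(2)[OF w])+
  fix \<eta> assume t: "test_function \<Omega> \<eta>"
  then have C\<eta>: "Ck m \<eta>" for m by (simp add: test_function_def)
  have s: "closure {x. \<zeta> x * \<eta> x \<noteq> 0} \<subseteq> closure {x. \<eta> x \<noteq> 0}" by (intro closure_mono) auto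
  have k: "compact (closure {x. \<eta> x \<noteq> 0})" "closure {x. \<eta> x \<noteq> 0} \<subseteq> \<Omega>" using t by (auto simp: test_function_def)
  have "compact (closure {x. \<zeta> x * \<eta> x \<noteq> 0})"
    using compact_Int_closed[OF k(1), of "closure {x. \<zeta> x * \<eta> x \<noteq> 0}"] s by (simp add: Int_absorb1)
  then have t2: "test_function \<Omega> (\<lambda>x. \<zeta> x * \<eta> x)"
    using s k Ck_mult[OF \<zeta> C\<eta>] by (auto simp: test_function_def)
  let ?d = "\<lambda>h. dirderiv h (axis j 1)"
  have d: "?d (\<lambda>x. \<zeta> x * \<eta> x) x = \<zeta> x * ?d \<eta> x + ?d \<zeta> x * \<eta> x" for x
    by (rule dirderiv_mult[OF \<zeta>[of "Suc 0"] C\<eta>[of "Suc 0"]])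
  have L: "(\<lambda>x. \<zeta> x * ?d \<eta> x) \<in> L2 LM" "(\<lambda>x. ?d \<zeta> x * \<eta> x) \<in> L2 LM" "(\<lambda>x. \<zeta> x * \<eta> x) \<in> L2 LM"
    by (intro continuous_mult_L2 c test_function_L2 t)+
  have i: "integrable LM (\<lambda>x. f x * (\<zeta> x * ?d \<eta> x))" "integrable LM (\<lambda>x. f x * (?d \<zeta> x * \<eta> x))"
      "integrable LM (\<lambda>x. g x * (\<zeta> x * \<eta> x))"
    by (intro L2_mult_integrable WP_L2(1)[OF w] WP_L2(2)[OF w] L)+
  have "(LINT x|LM. \<zeta> x * f x * ?d \<eta> x) = (LINT x|LM. f x * ?d (\<lambda>x. \<zeta> x * \<eta> x) x - f x * (?d \<zeta> x * \<eta> x))"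
    by (intro Bochner_Integration.integral_cong refl) (simp only: d, simp add: algebra_simps)
  also have "\<dots> = (LINT x|LM. f x * ?d (\<lambda>x. \<zeta> x * \<eta> x) x) - (LINT x|LM. f x * (?d \<zeta> x * \<eta> x))"
    by (intro Bochner_Integration.integral_diff L2_mult_integrable WP_L2(1)[OF w] test_function_L2 t2 L)
  also have "\<dots> = - (LINT x|LM. g x * (\<zeta> x * \<eta> x)) - (LINT x|LM. f x * (?d \<zeta> x * \<eta> x))"
    using WP_test[OF w t2] by simp
  also have "\<dots> = - (LINT x|LM. f x * (?d \<zeta> x * \<eta> x) + g x * (\<zeta> x * \<eta> x))"
    using i by simp
  also have "\<dots> = - (LINT x|LM. (?d \<zeta> x * f x + \<zeta> x * g x) * \<eta> x)"
    by (intro arg_cong[of _ _ uminus] Bochner_Integration.integral_cong) (auto simp: algebra_simps)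
  finally show "(LINT x|LM. \<zeta> x * f x * ?d \<eta> x) = - (LINT x|LM. (?d \<zeta> x * f x + \<zeta> x * g x) * \<eta> x)" .
qed

lemma weak_partial_WP: "f \<in> H1 \<Omega> \<Longrightarrow> WP j f (weak_partial \<Omega> j f)"
  unfolding H1_def weak_partial_def using someI_ex[of "\<lambda>g. has_weak_partial \<Omega> j f g"] by auto

lemma H1_I: "(\<And>j. WP j f (g j)) \<Longrightarrow> f \<in> H1 \<Omega>"
  unfolding H1_def using WP_L2(1) by fast

text \<open>This pins down, almost everywhere, the arbitrary choice made by
  \<open>weak_partial\<close>; Sobolev norms can then be computed from any weak derivative at
  hand.\<close>

lemma weak_partial_eq:
  assumes "WP j f g" shows "AE x in LM. weak_partial \<Omega> j f x = g x"
proof -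
  have "WP j f (weak_partial \<Omega> j f)"
    unfolding weak_partial_def by (rule someI[of "WP j f" g, OF assms])
  then show ?thesis using WP_unique assms by blast
qed

lemma weak_partial_L2: "f \<in> H1 \<Omega> \<Longrightarrow> weak_partial \<Omega> j f \<in> L2 LM"
  using weak_partial_WP WP_L2 by blast

lemma H1_norm_eq:
  assumes "\<And>j. WP j f (g j)"
  shows "H1_norm \<Omega> f = sqrt ((L2_norm LM f)\<^sup>2 + (\<Sum>j\<in>UNIV. (L2_norm LM (g j))\<^sup>2))"
proof -
  have f: "f \<in> H1 \<Omega>" using H1_I assms by blast
  have "L2_norm LM (weak_partial \<Omega> j f) = L2_norm LM (g j)" for j
    using weak_partial_eq[OF assms[of j]] L2_D(1)[OF weak_partial_L2[OF f]] L2_D(1)[OF WP_L2(2)[OF assms[of j]]]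
    by (intro L2_norm_cong_AE) auto
  then show ?thesis by (simp add: H1_norm_def)
qed

lemma L2_le_H1_norm: "L2_norm LM f \<le> H1_norm \<Omega> f" "L2_norm LM (weak_partial \<Omega> j f) \<le> H1_norm \<Omega> f"
proof -
  have s: "0 \<le> (\<Sum>j\<in>UNIV. (L2_norm LM (weak_partial \<Omega> j f))\<^sup>2)" by (intro sum_nonneg) auto
  show "L2_norm LM f \<le> H1_norm \<Omega> f"
    unfolding H1_norm_def using s by (intro real_le_rsqrt) simp
  have "(L2_norm LM (weak_partial \<Omega> j f))\<^sup>2 \<le> (\<Sum>j\<in>UNIV. (L2_norm LM (weak_partial \<Omega> j f))\<^sup>2)"
    by (intro member_le_sum) auto
  then show "L2_norm LM (weak_partial \<Omega> j f) \<le> H1_norm \<Omega> f"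
    unfolding H1_norm_def by (intro real_le_rsqrt) (simp add: add_increasing)
qed

lemma H1_norm_le:
  assumes "\<And>j. WP j f (g j)"
  shows "H1_norm \<Omega> f \<le> L2_norm LM f + (\<Sum>j\<in>UNIV. L2_norm LM (g j))"
proof -
  have "(\<Sum>j\<in>UNIV. (L2_norm LM (g j))\<^sup>2) \<le> (\<Sum>j\<in>UNIV. L2_norm LM (g j))\<^sup>2"
    unfolding UNIV_3 using L2_norm_nonneg[of LM "g 1"] L2_norm_nonneg[of LM "g 2"] L2_norm_nonneg[of LM "g 3"]
    by (simp add: power2_eq_square algebra_simps)
  moreover have "0 \<le> 2 * L2_norm LM f * (\<Sum>j\<in>UNIV. L2_norm LM (g j))"
    by (intro mult_nonneg_nonneg sum_nonneg L2_norm_nonneg) auto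
  ultimately have "(L2_norm LM f)\<^sup>2 + (\<Sum>j\<in>UNIV. (L2_norm LM (g j))\<^sup>2) \<le> (L2_norm LM f + (\<Sum>j\<in>UNIV. L2_norm LM (g j)))\<^sup>2"
    by (simp add: power2_sum)
  then show ?thesis unfolding H1_norm_eq[OF assms]
    by (intro real_le_lsqrt) (auto intro!: add_nonneg_nonneg sum_nonneg L2_norm_nonneg)
qed

lemma H1_conv_iff:
  assumes v: "\<And>m. Ck 1 (v m)" and f: "\<And>j. WP j f (g j)"
  shows "(\<lambda>m. H1_norm \<Omega> (\<lambda>x. v m x - f x)) \<longlonglongrightarrow> 0 \<longleftrightarrow>
     (\<lambda>m. L2_norm LM (\<lambda>x. v m x - f x)) \<longlonglongrightarrow> 0 \<and>
     (\<forall>j. (\<lambda>m. L2_norm LM (\<lambda>x. dirderiv (v m) (axis j 1) x - g j x)) \<longlonglongrightarrow> 0)"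
proof -
  have w: "WP j (\<lambda>x. v m x - f x) (\<lambda>x. dirderiv (v m) (axis j 1) x - g j x)" for m j
    by (intro WP_diff WP_Ck v f)
  show ?thesis
  proof (intro iffI conjI allI)
    assume *: "(\<lambda>m. H1_norm \<Omega> (\<lambda>x. v m x - f x)) \<longlonglongrightarrow> 0"
    show "(\<lambda>m. L2_norm LM (\<lambda>x. v m x - f x)) \<longlonglongrightarrow> 0"
      by (rule tendsto_sandwich[OF _ _ tendsto_const *]) (auto simp: L2_norm_nonneg L2_le_H1_norm)
    fix j
    have "L2_norm LM (weak_partial \<Omega> j (\<lambda>x. v m x - f x)) = L2_norm LM (\<lambda>x. dirderiv (v m) (axis j 1) x - g j x)" for m
      using weak_partial_eq[OF w] L2_D(1)[OF weak_partial_L2[OF H1_I[OF w]]] L2_D(1)[OF WP_L2(2)[OF w]]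
      by (intro L2_norm_cong_AE) auto
    then have "L2_norm LM (\<lambda>x. dirderiv (v m) (axis j 1) x - g j x) \<le> H1_norm \<Omega> (\<lambda>x. v m x - f x)" for m
      using L2_le_H1_norm(2)[of j] by metis
    then show "(\<lambda>m. L2_norm LM (\<lambda>x. dirderiv (v m) (axis j 1) x - g j x)) \<longlonglongrightarrow> 0"
      by (intro tendsto_sandwich[OF _ _ tendsto_const *]) (auto simp: L2_norm_nonneg)
  next
    assume *: "(\<lambda>m. L2_norm LM (\<lambda>x. v m x - f x)) \<longlonglongrightarrow> 0 \<and>
     (\<forall>j. (\<lambda>m. L2_norm LM (\<lambda>x. dirderiv (v m) (axis j 1) x - g j x)) \<longlonglongrightarrow> 0)"
    then have "(\<lambda>m. sqrt ((L2_norm LM (\<lambda>x. v m x - f x))\<^sup>2 + (\<Sum>j\<in>UNIV. (L2_norm LM (\<lambda>x. dirderiv (v m) (axis j 1) x - g j x))\<^sup>2))) \<longlonglongrightarrow> sqrt (0\<^sup>2 + (\<Sum>j\<in>(UNIV::3 set). 0\<^sup>2))"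
      by (intro tendsto_intros) auto
    then show "(\<lambda>m. H1_norm \<Omega> (\<lambda>x. v m x - f x)) \<longlonglongrightarrow> 0"
      unfolding H1_norm_eq[OF w] by simp
  qed
qed

end

text \<open>A partial derivative of a product of one-variable factors replaces a single factor by
  its derivative, and replacements at two different indices commute. What remains is to see that the
  factors are twice differentiable.\<close>

lemma box_bump_mixed_partials:
  fixes a b :: "real^'n"
  shows "dirderiv (dirderiv (box_bump m a b) (axis j 1)) (axis i 1) = dirderiv (dirderiv (box_bump m a b) (axis i 1)) (axis j 1)"
proof (cases "i = j")
  case False
  have prod: "dirderiv (\<lambda>x::real^'n. \<Prod>i\<in>UNIV. \<phi> i (x$i)) (axis j 1) = (\<lambda>x. \<Prod>i\<in>UNIV. (\<phi>(j := \<phi>')) i (x$i))"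
    if "\<And>i t. \<exists>d. (\<phi> i has_real_derivative d) (at t)" "\<And>t. (\<phi> j has_real_derivative \<phi>' t) (at t)" for \<phi> :: "'n \<Rightarrow> real \<Rightarrow> real" and \<phi>' j
  proof
    fix x :: "real^'n"
    define d where "d i t = (SOME d. (\<phi> i has_real_derivative d) (at t))" for i t
    have d: "(\<phi> i has_real_derivative d i t) (at t)" for i t unfolding d_def by (rule someI_ex) (rule that(1))
    have dj: "d j t = \<phi>' t" for t using DERIV_unique[OF d that(2)] .
    have "((\<lambda>x. \<phi> i (x$i)) has_derivative (\<lambda>h. d i (x$i) * h$i)) (at x)" for i
      using d[of i "x$i"] unfolding has_field_derivative_def
      by (rule has_derivative_compose[of "\<lambda>x. x$i" "\<lambda>h. h$i" x UNIV "\<phi> i", rotated])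
         (rule bounded_linear_imp_has_derivative[OF bounded_linear_vec_nth])
    then have "((\<lambda>x. \<Prod>i\<in>UNIV. \<phi> i (x$i)) has_derivative (\<lambda>h. \<Sum>i\<in>UNIV. d i (x$i) * h$i * (\<Prod>k\<in>UNIV - {i}. \<phi> k (x$k)))) (at x)"
      by (intro has_derivative_prod) auto
    then have "dirderiv (\<lambda>x::real^'n. \<Prod>i\<in>UNIV. \<phi> i (x$i)) (axis j 1) x = (\<Sum>i\<in>UNIV. d i (x$i) * axis j 1 $ i * (\<Prod>k\<in>UNIV - {i}. \<phi> k (x$k)))"
      by (rule dirderiv_eqI)
    also have "\<dots> = (\<Sum>i\<in>UNIV. if i = j then d j (x$j) * (\<Prod>k\<in>UNIV - {j}. \<phi> k (x$k)) else 0)"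
      by (intro sum.cong) (auto simp: axis_def)
    also have "\<dots> = d j (x$j) * (\<Prod>k\<in>UNIV - {j}. \<phi> k (x$k))" by simp
    also have "\<dots> = (\<Prod>i\<in>UNIV. (\<phi>(j := \<phi>')) i (x$i))"
      by (subst prod.remove[of UNIV j]) (auto simp: dj intro!: prod.cong)
    finally show "dirderiv (\<lambda>x::real^'n. \<Prod>i\<in>UNIV. \<phi> i (x$i)) (axis j 1) x = (\<Prod>i\<in>UNIV. (\<phi>(j := \<phi>')) i (x$i))" .
  qed
  define \<phi> where "\<phi> i t = step (m * (t - a$i)) * step (m * (b$i - t))" for i t
  have "\<exists>d. (\<phi> i has_real_derivative d) (at t)" for i t
  proof -
    obtain s' where s': "\<And>t. (step has_real_derivative s' t) (at t)"
      unfolding step_def using exp_recip_has_derivative by blast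
    show ?thesis unfolding \<phi>_def
      by (rule exI) (rule DERIV_mult DERIV_chain2[OF s'] derivative_eq_intros refl)+
  qed
  note ex = this
  define \<phi>' where "\<phi>' i t = (SOME d. (\<phi> i has_real_derivative d) (at t))" for i t
  have \<phi>': "(\<phi> i has_real_derivative \<phi>' i t) (at t)" for i t unfolding \<phi>'_def by (rule someI_ex) (rule ex)
  have bb: "box_bump m a b = (\<lambda>x. \<Prod>i\<in>UNIV. \<phi> i (x$i))" by (auto simp: box_bump_def \<phi>_def)
  have 1: "dirderiv (box_bump m a b) (axis j 1) = (\<lambda>x. \<Prod>i\<in>UNIV. (\<phi>(j := \<phi>' j)) i (x$i))" for j
    unfolding bb by (rule prod) (use \<phi>' in auto)
  have 2: "dirderiv (\<lambda>x::real^'n. \<Prod>i\<in>UNIV. (\<phi>(j := \<phi>' j)) i (x$i)) (axis i 1) = (\<lambda>x. \<Prod>k\<in>UNIV. ((\<phi>(j := \<phi>' j))(i := \<phi>' i)) k (x$k))"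
    if "i \<noteq> j" "\<And>t. \<exists>d. (\<phi>' j has_real_derivative d) (at t)" for i j
    by (rule prod) (use \<phi>' that in auto)
  \<comment> \<open>The derivative of \<open>step\<close> is again of the form
    \<open>exp_recip p'\<close>, hence differentiable, so each factor can be differentiated a second
    time.\<close>
  have dd: "\<exists>d. (\<phi>' j has_real_derivative d) (at t)" for j t
  proof -
    obtain p' where s1: "\<And>t. (step has_real_derivative exp_recip p' t) (at t)"
      unfolding step_def using exp_recip_has_derivative by blast
    obtain s'' where s2: "\<And>t. (exp_recip p' has_real_derivative s'' t) (at t)" using exp_recip_has_derivative by blast
    have "(\<phi> j has_real_derivative step (m * (t - a$j)) * (- m * exp_recip p' (m * (b$j - t))) + m * exp_recip p' (m * (t - a$j)) * step (m * (b$j - t))) (at t)" for t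
      unfolding \<phi>_def by (auto intro!: derivative_eq_intros DERIV_chain2[OF s1])
    then have "\<phi>' j = (\<lambda>t. step (m * (t - a$j)) * (- m * exp_recip p' (m * (b$j - t))) + m * exp_recip p' (m * (t - a$j)) * step (m * (b$j - t)))"
      using DERIV_unique[OF \<phi>'] by blast
    moreover have "\<exists>d. ((\<lambda>t. step (m * (t - a$j)) * (- m * exp_recip p' (m * (b$j - t))) + m * exp_recip p' (m * (t - a$j)) * step (m * (b$j - t))) has_real_derivative d) (at t)"
      by (rule exI) (rule DERIV_add DERIV_mult DERIV_cmult DERIV_chain2[OF s1] DERIV_chain2[OF s2] derivative_eq_intros refl)+
    ultimately show ?thesis by simp
  qed
  show ?thesis
    using 2[OF False dd] 2[OF False[symmetric] dd] False by (simp add: 1 fun_upd_twist)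
qed simp

context bounded_open begin

text \<open>Tested against a bump, both functions turn into the integral of \<open>f\<close> against
  a mixed second derivative of the bump, taken in the two orders.\<close>

lemma WP_mixed_partials:
  assumes "WP j f fj" "WP i f fi" "WP i fj fij" "WP j fi fji"
  shows "AE x in LM. fij x = fji x"
proof -
  have "AE x in LM. fij x - fji x = 0"
  proof (rule AE_eq_0_if_bump_integrals_eq_0)
    show "(\<lambda>x. fij x - fji x) \<in> L2 LM" using assms by (intro L2_diff WP_L2)
    fix m :: real and a b :: "real^3" assume "m > 0" "cbox a b \<subseteq> \<Omega>"
    then have t: "test_function \<Omega> (box_bump m a b)" by (rule test_function_box_bump)
    have t': "test_function \<Omega> (dirderiv (box_bump m a b) (axis k 1))" for k
      by (rule test_function_dirderiv[OF t]) (simp add: axis_in_Basis_iff)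
    have "(LINT x|LM. fij x * box_bump m a b x) = (LINT x|LM. f x * dirderiv (dirderiv (box_bump m a b) (axis i 1)) (axis j 1) x)"
      using WP_test[OF assms(3) t] WP_test[OF assms(1) t'] by simp
    also have "\<dots> = (LINT x|LM. fji x * box_bump m a b x)"
      using WP_test[OF assms(4) t] WP_test[OF assms(2) t'] by (simp add: box_bump_mixed_partials[of m a b i j])
    finally show "(LINT x|LM. (fij x - fji x) * box_bump m a b x) = 0"
      using L2_mult_integrable[OF WP_L2(2)[OF assms(3)] test_function_L2(1)[OF t]]
        L2_mult_integrable[OF WP_L2(2)[OF assms(4)] test_function_L2(1)[OF t]]
      by (simp add: left_diff_distrib)
  qed
  then show ?thesis by simp
qed

end

section \<open>Mollification\<close>

text \<open>Uniform continuity holds on the ball of radius \<open>R + 1\<close>. For points at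
  distance below 1 that are not both in this ball, both lie outside the support.\<close>

lemma uniformly_continuous_bounded_support:
  fixes F :: "'a::euclidean_space \<Rightarrow> real"
  assumes "continuous_on UNIV F" "bounded K" "\<And>x. x \<notin> K \<Longrightarrow> F x = 0" "e > 0"
  obtains d where "d > 0" "\<And>x y. dist x y < d \<Longrightarrow> \<bar>F x - F y\<bar> < e"
proof -
  obtain R where R: "K \<subseteq> cball 0 R" using assms(2) unfolding bounded_iff by (metis mem_cball_0 subsetI)
  have "uniformly_continuous_on (cball 0 (R + 1)) F"
    using assms(1) by (intro compact_uniformly_continuous) (auto intro: continuous_on_subset)
  then obtain d where d: "d > 0" "\<And>x y. x \<in> cball 0 (R+1) \<Longrightarrow> y \<in> cball 0 (R+1) \<Longrightarrow> dist x y < d \<Longrightarrow> dist (F x) (F y) < e"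
    using assms(4) unfolding uniformly_continuous_on_def by (metis dist_commute)
  have Z: "F x = 0" if "norm x > R" for x using assms(3)[of x] R that by (cases "x \<in> K") auto
  show ?thesis
  proof (rule that[of "min d 1"])
    fix x y :: 'a assume xy: "dist x y < min d 1"
    have n: "\<bar>norm x - norm y\<bar> \<le> dist x y" by (simp add: dist_norm norm_triangle_ineq3)
    show "\<bar>F x - F y\<bar> < e"
    proof (cases "norm x \<le> R + 1 \<and> norm y \<le> R + 1")
      case True
      then show ?thesis using d(2)[of x y] xy by (simp add: dist_real_def)
    next
      case False
      then have "norm x > R" "norm y > R" using n xy by auto
      then show ?thesis using Z assms(4) by simp
    qed
  qed (use d in auto)
qed

lemma integrable_mult_bounded:
  fixes f g :: "'a \<Rightarrow> real"
  assumes "integrable M f" "g \<in> borel_measurable M" "\<And>x. \<bar>g x\<bar> \<le> B"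
  shows "integrable M (\<lambda>x. f x * g x)"
proof (rule Bochner_Integration.integrable_bound)
  show "integrable M (\<lambda>x. B * \<bar>f x\<bar>)" using assms(1) by simp
  have "0 \<le> B" using assms(3) abs_ge_zero order_trans by blast
  have "\<bar>f x\<bar> * \<bar>g x\<bar> \<le> \<bar>f x\<bar> * B" for x by (intro mult_left_mono assms) auto
  then show "AE x in M. norm (f x * g x) \<le> norm (B * \<bar>f x\<bar>)"
    using \<open>0 \<le> B\<close> by (intro AE_I2) (simp add: abs_mult mult.commute)
qed (use assms in auto)

lemma integral_mult_bounded_le:
  fixes f g :: "'a \<Rightarrow> real"
  assumes "integrable M f" "g \<in> borel_measurable M" "\<And>x. \<bar>g x\<bar> \<le> B"
  shows "\<bar>LINT x|M. f x * g x\<bar> \<le> B * (LINT x|M. \<bar>f x\<bar>)"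
proof -
  have *: "\<bar>f x\<bar> * \<bar>g x\<bar> \<le> \<bar>f x\<bar> * B" for x by (intro mult_left_mono assms) auto
  have "\<bar>LINT x|M. f x * g x\<bar> \<le> (LINT x|M. B * \<bar>f x\<bar>)"
    by (rule order_trans[OF integral_abs_bound integral_mono])
       (use * assms(1) integrable_abs[OF integrable_mult_bounded[OF assms]] in \<open>auto simp: abs_mult mult.commute\<close>)
  then show ?thesis by simp
qed

text \<open>The kernel occurs as \<open>\<psi> (y - x)\<close>, so the value at \<open>x\<close> is
  an average of \<open>f\<close> over the translate \<open>x + K\<close>. With this sign the
  position of \<open>K\<close> tells in which direction from \<open>x\<close> the function is
  sampled, which matters near the boundary.\<close>

lemma mollification_continuous:
  fixes f \<psi> :: "'a::euclidean_space \<Rightarrow> real"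
  assumes f: "integrable lborel f" and \<psi>: "continuous_on UNIV \<psi>" "bounded K" "\<And>x. x \<notin> K \<Longrightarrow> \<psi> x = 0"
  shows "continuous_on UNIV (\<lambda>x. LINT y|lborel. f y * \<psi> (y - x))"
proof -
  obtain B where B: "\<And>x. \<bar>\<psi> x\<bar> \<le> B" using bounded_support_bound[OF \<psi>] by metis
  have m: "(\<lambda>y. \<psi> (y - x)) \<in> borel_measurable lborel" for x
    unfolding measurable_lborel2 by (intro borel_measurable_continuous_onI continuous_on_compose2[OF \<psi>(1)] continuous_intros) auto
  have i: "integrable lborel (\<lambda>y. f y * \<psi> (y - x))" for x
    by (rule integrable_mult_bounded[OF f m B])
  define I where "I = (LINT y|lborel. \<bar>f y\<bar>)"
  have I: "I \<ge> 0" by (simp add: I_def)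
  show ?thesis
    unfolding continuous_on_iff
  proof (intro ballI allI impI)
    fix x and e :: real assume "e > 0"
    \<comment> \<open>\<open>I + 1\<close> in place of \<open>I\<close> because the integral
      \<open>I\<close> may vanish.\<close>
    then have "e / (I + 1) > 0" using I by simp
    from uniformly_continuous_bounded_support[OF \<psi> this]
    obtain d where d: "d > 0" "\<And>x y. dist x y < d \<Longrightarrow> \<bar>\<psi> x - \<psi> y\<bar> < e / (I + 1)" by metis
    have "dist (LINT y|lborel. f y * \<psi> (y - x')) (LINT y|lborel. f y * \<psi> (y - x)) < e" if "dist x' x < d" for x'
    proof -
      have b: "\<bar>\<psi> (y - x') - \<psi> (y - x)\<bar> \<le> e / (I + 1)" for y
        using d(2)[of "y - x'" "y - x"] that by (simp add: dist_norm norm_minus_commute less_imp_le)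
      have "(LINT y|lborel. f y * \<psi> (y - x')) - (LINT y|lborel. f y * \<psi> (y - x)) = (LINT y|lborel. f y * (\<psi> (y - x') - \<psi> (y - x)))"
        using i by (simp add: right_diff_distrib)
      also have "\<bar>\<dots>\<bar> \<le> e / (I + 1) * I"
        unfolding I_def using b m by (intro integral_mult_bounded_le[OF f]) (auto simp: I_def)
      also have "\<dots> < e" using \<open>e > 0\<close> I by (simp add: field_simps)
      finally show ?thesis by (simp add: dist_real_def)
    qed
    then show "\<exists>d>0. \<forall>x'\<in>UNIV. dist x' x < d \<longrightarrow> dist (LINT y|lborel. f y * \<psi> (y - x')) (LINT y|lborel. f y * \<psi> (y - x)) < e"
      using d(1) by blast
  qed
qed

text \<open>The first order Taylor remainder of \<open>\<phi>\<close> is small relative to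
  \<open>norm h\<close> uniformly in the base point, by the mean value theorem and uniform
  continuity of the derivatives. Integrated against \<open>f\<close> it stays small, so
  differentiation passes to the kernel; the minus sign comes from
  \<open>\<phi> (y - x)\<close>.\<close>

lemma mollification_Ck:
  fixes f \<phi> :: "'a::euclidean_space \<Rightarrow> real"
  assumes f: "integrable lborel f" and \<phi>: "Ck 1 \<phi>" and K: "bounded K" "\<And>x. x \<notin> K \<Longrightarrow> \<phi> x = 0"
  defines "V \<equiv> \<lambda>x. LINT y|lborel. f y * \<phi> (y - x)"
  shows "Ck 1 V" and "dirderiv V w x = - (LINT y|lborel. f y * dirderiv \<phi> w (y - x))"
proof -
  have \<phi>': "Ck (Suc 0) \<phi>" using \<phi> by simp
  obtain R where R: "K \<subseteq> cball 0 R" using K unfolding bounded_iff by (metis mem_cball_0 subsetI)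
  have Z: "\<phi> x = 0" if "x \<notin> cball 0 R" for x using K(2)[of x] R that by blast
  have c: "continuous_on UNIV \<phi>" "continuous_on UNIV (dirderiv \<phi> w)" for w
    using Ck_continuous[OF \<phi>] Ck_Suc_continuous_dirderiv[OF \<phi>'] by auto
  have Z': "dirderiv \<phi> w x = 0" if "x \<notin> cball 0 R" for x w
    by (rule dirderiv_eq_0_outside[OF closed_cball Z that])
  have m: "(\<lambda>y. \<psi> (y - x)) \<in> borel_measurable lborel" if "continuous_on UNIV \<psi>" for \<psi> :: "'a \<Rightarrow> real" and x
    unfolding measurable_lborel2 by (intro borel_measurable_continuous_onI continuous_on_compose2[OF that] continuous_intros) auto
  have i: "integrable lborel (\<lambda>y. f y * \<psi> (y - x))" if cp: "continuous_on UNIV \<psi>" and zp: "\<And>x. x \<notin> cball 0 R \<Longrightarrow> \<psi> x = 0" for \<psi> :: "'a \<Rightarrow> real" and x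
  proof -
    obtain B where "\<And>x. \<bar>\<psi> x\<bar> \<le> B" using bounded_support_bound[OF cp bounded_cball zp] by metis
    then show ?thesis by (intro integrable_mult_bounded[OF f m[OF cp]])
  qed
  have lin: "linear (\<lambda>h. dirderiv \<phi> h x)" for x
    using has_derivative_linear[OF Ck_Suc_has_derivative[OF \<phi>']] .
  have est: "\<exists>d>0. \<forall>z h. norm h < d \<longrightarrow> \<bar>\<phi> (z - h) - \<phi> z + dirderiv \<phi> h z\<bar> \<le> e * norm h" if "e > 0" for e
  proof -
    \<comment> \<open>The derivative in direction \<open>h\<close> is a sum over the basis with
      coefficients at most \<open>norm h\<close>, so each partial derivative may vary by
      \<open>e'\<close>.\<close>
    define e' where "e' = e / real (DIM('a))"
    have "e' > 0" using that by (simp add: e'_def)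
    have "\<forall>b\<in>Basis. \<exists>d>0. \<forall>x y. dist x y < d \<longrightarrow> \<bar>dirderiv \<phi> b x - dirderiv \<phi> b y\<bar> < e'"
      using uniformly_continuous_bounded_support[OF c(2) bounded_cball Z' \<open>e' > 0\<close>] by metis
    then obtain D where D: "\<And>b. b \<in> Basis \<Longrightarrow> D b > 0"
      "\<And>b x y. b \<in> Basis \<Longrightarrow> dist x y < D b \<Longrightarrow> \<bar>dirderiv \<phi> b x - dirderiv \<phi> b y\<bar> < e'" by metis
    define d where "d = Min (D ` Basis)"
    have d: "d > 0" "\<And>b. b \<in> Basis \<Longrightarrow> d \<le> D b" unfolding d_def using D(1) by auto
    have "\<bar>\<phi> (z - h) - \<phi> z + dirderiv \<phi> h z\<bar> \<le> e * norm h" if h: "norm h < d" for z h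
    proof -
      have "\<exists>s>0. s < 1 \<and> \<phi> (z + 1 *\<^sub>R (-h)) - \<phi> (z + 0 *\<^sub>R (-h)) = (1 - 0) * dirderiv \<phi> (-h) (z + s *\<^sub>R (-h))"
        by (rule MVT2[OF zero_less_one]) (rule Ck_deriv_along_line[OF \<phi>'])
      then obtain s where s: "0 < s" "s < 1" "\<phi> (z - h) - \<phi> z = dirderiv \<phi> (-h) (z - s *\<^sub>R h)" by auto
      define z' where "z' = z - s *\<^sub>R h"
      have "dist z z' = s * norm h" using s by (simp add: z'_def dist_norm)
      also have "\<dots> < d" using s h by (smt (verit) mult_left_le_one_le norm_ge_zero)
      finally have dz: "dist z z' < d" .
      note exp = dirderiv_sum_Basis[OF \<phi>', of h]
      have "\<phi> (z - h) - \<phi> z + dirderiv \<phi> h z = dirderiv \<phi> h z - dirderiv \<phi> h z'"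
        using s(3) linear_neg[OF lin[of z'], of h] by (simp add: z'_def)
      also have "\<dots> = (\<Sum>b\<in>Basis. (h \<bullet> b) * (dirderiv \<phi> b z - dirderiv \<phi> b z'))"
        unfolding exp by (simp add: sum_subtractf right_diff_distrib)
      also have "\<bar>\<dots>\<bar> \<le> (\<Sum>b\<in>(Basis::'a set). norm h * e')"
      proof (rule order_trans[OF sum_abs], rule sum_mono)
        fix b :: 'a assume b: "b \<in> Basis"
        have "\<bar>dirderiv \<phi> b z - dirderiv \<phi> b z'\<bar> < e'" using D(2)[OF b] d(2)[OF b] dz by auto
        then show "\<bar>(h \<bullet> b) * (dirderiv \<phi> b z - dirderiv \<phi> b z')\<bar> \<le> norm h * e'"
          unfolding abs_mult using Basis_le_norm[OF b, of h] by (intro mult_mono) auto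
      qed
      also have "\<dots> = e * norm h" by (simp add: e'_def)
      finally show ?thesis .
    qed
    then show ?thesis using d(1) by blast
  qed
  define V' where "V' x h = - (LINT y|lborel. f y * dirderiv \<phi> h (y - x))" for x h
  define I where "I = (LINT y|lborel. \<bar>f y\<bar>)"
  have I: "I \<ge> 0" by (simp add: I_def)
  have D: "(V has_derivative V' x) (at x)" for x
    unfolding has_derivative_at_alt
  proof (intro conjI allI impI)
    show "bounded_linear (V' x)"
      unfolding linear_conv_bounded_linear[symmetric]
    proof (rule linearI)
      show "V' x (h + k) = V' x h + V' x k" for h k
        using i[OF c(2) Z'] by (simp add: V'_def linear_add[OF lin] distrib_left)
      show "V' x (r *\<^sub>R h) = r *\<^sub>R V' x h" for r h
        by (simp add: V'_def linear_scale[OF lin] mult.left_commute)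
    qed
    fix e :: real assume "e > 0"
    then have "e / (I + 1) > 0" using I by simp
    from est[OF this] obtain d where d: "d > 0" "\<And>z h. norm h < d \<Longrightarrow> \<bar>\<phi> (z - h) - \<phi> z + dirderiv \<phi> h z\<bar> \<le> e / (I+1) * norm h" by blast
    have "norm (V y - V x - V' x (y - x)) \<le> e * norm (y - x)" if "norm (y - x) < d" for y
    proof -
      let ?h = "y - x"
      have b: "\<bar>\<phi> (u - y) - \<phi> (u - x) + dirderiv \<phi> ?h (u - x)\<bar> \<le> e / (I+1) * norm ?h" for u
        using d(2)[OF that, of "u - x"] by simp
      have "V y - V x - V' x ?h = (LINT u|lborel. f u * (\<phi> (u - y) - \<phi> (u - x) + dirderiv \<phi> ?h (u - x)))"
        using i[OF c(1) Z] i[OF c(2) Z'] by (simp add: V_def V'_def right_diff_distrib distrib_left)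
      also have "\<bar>\<dots>\<bar> \<le> e / (I+1) * norm ?h * I"
        unfolding I_def[symmetric] using integral_mult_bounded_le[OF f _ b] m[OF c(1)] m[OF c(2)] by (simp add: I_def)
      also have "\<dots> = (e * norm ?h) * (I / (I + 1))" by simp
      also have "\<dots> \<le> (e * norm ?h) * 1" using I \<open>e > 0\<close> by (intro mult_left_mono) auto
      finally show ?thesis by simp
    qed
    then show "\<exists>d>0. \<forall>y. norm (y - x) < d \<longrightarrow> norm (V y - V x - V' x (y - x)) \<le> e * norm (y - x)"
      using d(1) by blast
  qed
  show "dirderiv V w x = - (LINT y|lborel. f y * dirderiv \<phi> w (y - x))"
    using dirderiv_eqI[OF D] by (simp add: V'_def)
  have "continuous_on UNIV (\<lambda>x. V' x b)" for b
    unfolding V'_def by (intro continuous_on_minus mollification_continuous[OF f c(2) bounded_cball Z'])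
  then show "Ck 1 V" using D by (subst One_nat_def, subst Ck_Suc_iff) auto
qed

section \<open>Continuous functions and translations in L2\<close>

lemma indicator_cball_L2:
  fixes a :: "'a::euclidean_space"
  shows "(indicator (cball a r) :: _ \<Rightarrow> real) \<in> L2 lborel"
    "L2_norm lborel (indicator (cball a r) :: _ \<Rightarrow> real) = sqrt (measure lborel (cball a r))"
proof -
  have sq: "(\<lambda>x. (indicator (cball a r) x :: real)\<^sup>2) = indicator (cball a r)"
    by (rule ext) (simp add: indicator_def)
  have i: "integrable lborel (indicator (cball a r) :: _ \<Rightarrow> real)"
    using emeasure_lborel_cball_finite[of a r] by (intro integrable_real_indicator) (auto simp: top.not_eq_extremum)
  show "(indicator (cball a r) :: _ \<Rightarrow> real) \<in> L2 lborel"
    using i borel_measurable_integrable[OF i] by (simp add: L2_def sq)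
  show "L2_norm lborel (indicator (cball a r) :: _ \<Rightarrow> real) = sqrt (measure lborel (cball a r))"
    by (simp add: L2_norm_def sq)
qed

text \<open>A measurable function is an almost everywhere limit of continuous ones. Clipping these
  to the range from \<open>- B\<close> to \<open>B\<close> and multiplying by a continuous radial
  cutoff creates the common square integrable bound for dominated convergence.\<close>

lemma L2_dense_continuous_bounded:
  fixes g :: "'a::euclidean_space \<Rightarrow> real"
  assumes g: "g \<in> borel_measurable borel" and B: "\<And>x. \<bar>g x\<bar> \<le> B" and R: "\<And>x. x \<notin> cball 0 R \<Longrightarrow> g x = 0" and "e > 0"
  obtains c where "continuous_on UNIV c" "c \<in> L2 lborel" "\<And>x. x \<notin> cball 0 (R+1) \<Longrightarrow> c x = 0" "L2_norm lborel (\<lambda>x. c x - g x) \<le> e"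
proof -
  have "g measurable_on UNIV"
    using g by (intro lebesgue_measurable_imp_measurable_on) (auto intro: measurable_completion)
  then obtain N c where N: "negligible N" and c: "\<And>n. continuous_on UNIV (c n)" and lim: "\<And>x. x \<notin> N \<Longrightarrow> (\<lambda>n. c n x) \<longlonglongrightarrow> g x"
    unfolding measurable_on_def by auto
  have B0: "0 \<le> B" using B abs_ge_zero order_trans by blast
  define cut where "cut x = max 0 (min 1 (R + 1 - norm x))" for x :: 'a
  define d where "d n x = cut x * max (- B) (min B (c n x))" for n x
  have dc: "continuous_on UNIV (d n)" for n
    unfolding d_def cut_def by (intro continuous_intros c)
  have cut: "0 \<le> cut x" "cut x \<le> 1" "norm x \<le> R \<Longrightarrow> cut x = 1" "norm x > R + 1 \<Longrightarrow> cut x = 0" for x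
    by (auto simp: cut_def)
  have bd: "\<bar>max (- B) (min B t)\<bar> \<le> B" for t using B0 by auto
  have dz: "d n x = 0" if "x \<notin> cball 0 (R+1)" for n x using that cut(4)[of x] by (simp add: d_def)
  have "(\<lambda>m. L2_norm lborel (\<lambda>x. d m x - g x)) \<longlonglongrightarrow> 0" and dL: "\<And>m. d m \<in> L2 lborel"
  proof -
    have 1: "g \<in> borel_measurable lborel" using g by simp
    have 2: "d m \<in> borel_measurable lborel" for m using borel_measurable_continuous_onI[OF dc] by simp
    have 3: "(\<lambda>x. B * indicator (cball 0 (R+1)) x) \<in> L2 lborel"
      by (intro L2_scale indicator_cball_L2)
    have 4: "\<bar>d m x\<bar> \<le> \<bar>B * indicator (cball 0 (R+1)) x\<bar>" for m x
    proof (cases "x \<in> cball 0 (R+1)")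
      case True
      have "\<bar>d m x\<bar> \<le> 1 * B" unfolding d_def abs_mult using cut(1,2)[of x] bd by (intro mult_mono) auto
      then show ?thesis using True B0 by simp
    qed (use dz in simp)
    have 5: "AE x in lborel. (\<lambda>m. d m x) \<longlonglongrightarrow> g x"
    proof -
      have "N \<in> null_sets lebesgue" using N by (simp add: negligible_iff_null_sets)
      then have "AE x in lebesgue. x \<notin> N" by (rule AE_not_in)
      then have "AE x in lborel. x \<notin> N" by (simp add: AE_completion_iff)
      then show ?thesis
      proof eventually_elim
        case (elim x)
        have "(\<lambda>m. d m x) \<longlonglongrightarrow> cut x * max (- B) (min B (g x))"
          unfolding d_def by (intro tendsto_intros lim elim)
        moreover have "max (- B) (min B (g x)) = g x" using B[of x] by auto
        moreover have "cut x * g x = g x" using cut(3)[of x] R[of x] by (cases "norm x \<le> R") auto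
        ultimately show ?case by simp
      qed
    qed
    show "(\<lambda>m. L2_norm lborel (\<lambda>x. d m x - g x)) \<longlonglongrightarrow> 0" "\<And>m. d m \<in> L2 lborel"
      using L2_dominated_convergence[OF 1 2 3 4 5] by auto
  qed
  then obtain m where "L2_norm lborel (\<lambda>x. d m x - g x) < e"
    using order_tendstoD(2)[of _ 0 sequentially e] \<open>e > 0\<close> eventually_happens'[OF sequentially_bot] by blast
  then show ?thesis using that[of "d m"] dc dL dz by auto
qed

text \<open>Truncating \<open>g\<close> both in value and in position leads to the bounded case; the
  truncations are dominated by \<open>g\<close> itself and hence converge in L2.\<close>

lemma L2_dense_continuous:
  fixes g :: "'a::euclidean_space \<Rightarrow> real"
  assumes g: "g \<in> L2 lborel" and "e > 0"
  obtains c R where "continuous_on UNIV c" "c \<in> L2 lborel" "\<And>x. x \<notin> cball 0 R \<Longrightarrow> c x = 0" "L2_norm lborel (\<lambda>x. c x - g x) \<le> e"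
proof -
  define t where "t n x = (if \<bar>g x\<bar> \<le> real n \<and> norm x \<le> real n then g x else 0)" for n x
  have gm: "g \<in> borel_measurable borel" using L2_D(1)[OF g] by simp
  have tm: "t n \<in> borel_measurable lborel" for n using gm unfolding t_def by measurable
  have "AE x in lborel. (\<lambda>n. t n x) \<longlonglongrightarrow> g x"
  proof (rule AE_I2)
    fix x
    obtain k where k: "max \<bar>g x\<bar> (norm x) \<le> real k" using real_arch_simple by blast
    have "eventually (\<lambda>n. t n x = g x) sequentially"
      using eventually_ge_at_top[of k] by eventually_elim (use k in \<open>auto simp: t_def\<close>)
    then show "(\<lambda>n. t n x) \<longlonglongrightarrow> g x" by (rule tendsto_eventually)
  qed
  note L = L2_dominated_convergence[OF L2_D(1)[OF g] tm g _ this]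
  have tb: "\<bar>t n x\<bar> \<le> \<bar>g x\<bar>" for n x by (simp add: t_def)
  obtain n where n: "L2_norm lborel (\<lambda>x. t n x - g x) < e / 2"
    using eventually_happens'[OF sequentially_bot order_tendstoD(2)[OF L(3)[OF tb], of "e/2"]] \<open>e > 0\<close> by auto
  have "\<bar>t n x\<bar> \<le> real n" "x \<notin> cball 0 (real n) \<Longrightarrow> t n x = 0" for x by (auto simp: t_def)
  note tn = this
  have e2: "e / 2 > 0" using \<open>e > 0\<close> by simp
  have tn': "t n \<in> borel_measurable borel" using tm by simp
  obtain c where c: "continuous_on UNIV c" "c \<in> L2 lborel" "\<And>x. x \<notin> cball 0 (real n + 1) \<Longrightarrow> c x = 0" "L2_norm lborel (\<lambda>x. c x - t n x) \<le> e/2"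
    using L2_dense_continuous_bounded[OF tn' tn e2] by blast
  have "L2_norm lborel (\<lambda>x. c x - g x) \<le> L2_norm lborel (\<lambda>x. c x - t n x) + L2_norm lborel (\<lambda>x. t n x - g x)"
    by (rule L2_norm_triangle3[OF c(2) L(2)[OF tb] g])
  then show ?thesis using that[OF c(1-3)] c(4) n by simp
qed

lemma L2_translate:
  fixes g :: "'a::euclidean_space \<Rightarrow> real"
  assumes "g \<in> L2 lborel"
  shows "(\<lambda>x. g (x + h)) \<in> L2 lborel" "L2_norm lborel (\<lambda>x. g (x + h)) = L2_norm lborel g"
proof -
  have gm: "g \<in> borel_measurable borel" using L2_D(1)[OF assms] by simp
  have "integrable (distr lborel borel ((+) h)) (\<lambda>x. (g x)\<^sup>2)"
    using L2_D(2)[OF assms] by (simp add: lborel_distr_plus)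
  then have "integrable lborel (\<lambda>x. (g (h + x))\<^sup>2)"
    using gm by (subst (asm) integrable_distr_eq) auto
  then show "(\<lambda>x. g (x + h)) \<in> L2 lborel" using gm by (simp add: L2_def add.commute)
  show "L2_norm lborel (\<lambda>x. g (x + h)) = L2_norm lborel g"
    unfolding L2_norm_def using integral_lborel_translate[of "\<lambda>x. (g x)\<^sup>2" h] gm by simp
qed

text \<open>Translation is an isometry of L2, so \<open>g\<close> may be exchanged for a continuous
  compactly supported \<open>c\<close>, to which uniform continuity applies; each of the three
  errors is at most \<open>e / 3\<close>.\<close>

lemma L2_translation_continuous:
  fixes g :: "'a::euclidean_space \<Rightarrow> real"
  assumes g: "g \<in> L2 lborel" and "e > 0"
  obtains d where "d > 0" "\<And>h. norm h < d \<Longrightarrow> L2_norm lborel (\<lambda>x. g (x + h) - g x) \<le> e"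
proof -
  have e3: "e / 3 > 0" using \<open>e > 0\<close> by simp
  obtain c R where c: "continuous_on UNIV c" "c \<in> L2 lborel" "\<And>x. x \<notin> cball 0 R \<Longrightarrow> c x = 0" "L2_norm lborel (\<lambda>x. c x - g x) \<le> e/3"
    using L2_dense_continuous[OF g e3] by metis
  let ?C = "cball (0::'a) (R + 1)"
  define V where "V = measure lborel ?C"
  have V: "V \<ge> 0" by (simp add: V_def)
  \<comment> \<open>For \<open>norm h < 1\<close> the difference of \<open>c\<close> and its
    translate is supported in \<open>?C\<close>. A function bounded by \<open>e'\<close> and
    supported there has norm at most \<open>e' * sqrt V\<close>, which does not exceed
    \<open>e / 3\<close>.\<close>
  define e' where "e' = e / 3 / (sqrt V + 1)"
  have e': "e' > 0" using e3 V by (auto simp: e'_def intro!: divide_pos_pos add_nonneg_pos)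
  from uniformly_continuous_bounded_support[OF c(1) bounded_cball c(3) this]
  obtain d where d: "d > 0" "\<And>x y. dist x y < d \<Longrightarrow> \<bar>c x - c y\<bar> < e'" by metis
  note C1 = indicator_cball_L2[of "0::'a" "R + 1", folded V_def]
  show ?thesis
  proof (rule that[of "min d 1"])
    fix h :: 'a assume h: "norm h < min d 1"
    note ch = L2_translate[OF c(2), of h] and gh = L2_translate[OF g, of h]
    have cd: "\<bar>c (x + h) - c x\<bar> \<le> e' * indicator ?C x" for x
    proof (cases "x \<in> ?C")
      case True then show ?thesis using d(2)[of "x+h" x] h by (simp add: dist_norm less_imp_le)
    next
      case False
      have "norm x \<le> norm (x + h) + norm h" using norm_triangle_ineq4[of "x + h" h] by simp
      then have "x + h \<notin> cball 0 R" "x \<notin> cball 0 R" using False h by auto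
      then show ?thesis using False c(3) by simp
    qed
    have "L2_norm lborel (\<lambda>x. c (x + h) - c x) \<le> L2_norm lborel (\<lambda>x. e' * indicator ?C x)"
      unfolding L2_norm_def
    proof (intro real_sqrt_le_mono integral_mono)
      show "(c (x + h) - c x)\<^sup>2 \<le> (e' * indicator ?C x)\<^sup>2" for x
        using power_mono[OF cd[of x], of 2] by simp
    qed (use L2_diff[OF ch(1) c(2)] L2_scale[OF C1(1), of e'] in \<open>auto simp: L2_def\<close>)
    also have "\<dots> = e' * sqrt V" using e' C1(2) by (simp add: L2_norm_scale)
    also have "\<dots> \<le> e / 3" using V e3 by (simp add: e'_def field_simps add_pos_nonneg)
    finally have 1: "L2_norm lborel (\<lambda>x. c (x + h) - c x) \<le> e / 3" .
    have 2: "L2_norm lborel (\<lambda>x. g (x + h) - c (x + h)) \<le> e / 3"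
      using L2_translate(2)[OF L2_diff[OF c(2) g], of h] c(4) L2_norm_commute[of lborel "\<lambda>x. g (x + h)" "\<lambda>x. c (x + h)"] by simp
    have "L2_norm lborel (\<lambda>x. g (x + h) - g x) \<le> L2_norm lborel (\<lambda>x. g (x + h) - c (x + h)) + L2_norm lborel (\<lambda>x. c (x + h) - g x)"
      by (rule L2_norm_triangle3[OF gh(1) ch(1) g])
    also have "L2_norm lborel (\<lambda>x. c (x + h) - g x) \<le> L2_norm lborel (\<lambda>x. c (x + h) - c x) + L2_norm lborel (\<lambda>x. c x - g x)"
      by (rule L2_norm_triangle3[OF ch(1) c(2) g])
    finally show "L2_norm lborel (\<lambda>x. g (x + h) - g x) \<le> e" using 1 2 c(4) by simp
  qed (use d in auto)
qed

text \<open>\<open>V - g\<close> averages the differences \<open>g (x + z) - g x\<close> with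
  respect to the probability density \<open>\<phi>\<close>. Cauchy-Schwarz, with
  \<open>\<phi>\<close> split into two square roots, bounds its square by the average of the
  squares, and exchanging the integrals leaves the translation errors for \<open>z\<close> in
  \<open>K\<close>.\<close>

lemma mollification_L2:
  fixes g \<phi> :: "'a::euclidean_space \<Rightarrow> real"
  assumes g: "g \<in> L2 lborel" "integrable lborel g"
    and \<phi>: "continuous_on UNIV \<phi>" "\<And>z. 0 \<le> \<phi> z" "integral\<^sup>L lborel \<phi> = 1" "bounded K" "\<And>z. z \<notin> K \<Longrightarrow> \<phi> z = 0"
    and T: "\<And>z. z \<in> K \<Longrightarrow> L2_norm lborel (\<lambda>x. g (x + z) - g x) \<le> e" and e: "e \<ge> 0"
  defines "V \<equiv> \<lambda>x. LINT y|lborel. g y * \<phi> (y - x)"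
  shows "(\<lambda>x. V x - g x) \<in> L2 lborel" "L2_norm lborel (\<lambda>x. V x - g x) \<le> e"
proof -
  have gm[measurable]: "g \<in> borel_measurable borel" using L2_D(1)[OF g(1)] by simp
  have \<phi>m[measurable]: "\<phi> \<in> borel_measurable borel" using \<phi>(1) by (rule borel_measurable_continuous_onI)
  have \<phi>i: "integrable lborel \<phi>" by (rule integrable_bounded_support[OF \<phi>(1,4,5)])
  obtain B where B: "\<And>x. \<bar>\<phi> x\<bar> \<le> B" using bounded_support_bound[OF \<phi>(1,4,5)] by metis
  have Vm[measurable]: "V \<in> borel_measurable borel" unfolding V_def
    by (intro borel_measurable_continuous_onI mollification_continuous[OF g(2) \<phi>(1,4,5)])
  have V: "V x = (LINT z|lborel. g (x + z) * \<phi> z)" for x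
    using integral_lborel_translate[of "\<lambda>y. g y * \<phi> (y - x)" x] by (simp add: V_def add.commute)
  have gi: "integrable lborel (\<lambda>z. g (x + z))" for x
  proof -
    have "integrable (distr lborel borel ((+) x)) g" using g(2) by (simp add: lborel_distr_plus)
    then show ?thesis by (subst (asm) integrable_distr_eq) auto
  qed
  have i1: "integrable lborel (\<lambda>z. g (x + z) * \<phi> z)" for x
    by (rule integrable_mult_bounded[OF gi _ B]) simp
  have J: "ennreal ((V x - g x)\<^sup>2) \<le> (\<integral>\<^sup>+z. ennreal (\<phi> z * (g (x + z) - g x)\<^sup>2) \<partial>lborel)" (is "_ \<le> ?R x") for x
  proof (cases "?R x < \<infinity>")
    case True
    have i: "integrable lborel (\<lambda>z. \<phi> z * (g (x + z) - g x)\<^sup>2)"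
      using True \<phi>(2) by (intro integrableI_nonneg) auto
    let ?s = "\<lambda>z. sqrt (\<phi> z)"
    have s: "?s \<in> L2 lborel" "(\<lambda>z. ?s z * (g (x + z) - g x)) \<in> L2 lborel"
      using \<phi>i i \<phi>(2) by (auto simp: L2_def power_mult_distrib)
    have "V x - g x = (LINT z|lborel. g (x + z) * \<phi> z - g x * \<phi> z)"
      using i1 \<phi>i \<phi>(3) by (simp add: V)
    also have "\<dots> = (LINT z|lborel. ?s z * (?s z * (g (x + z) - g x)))"
      using \<phi>(2) by (intro Bochner_Integration.integral_cong) (auto simp: algebra_simps simp flip: mult.assoc)
    finally have "\<bar>V x - g x\<bar> \<le> L2_norm lborel ?s * L2_norm lborel (\<lambda>z. ?s z * (g (x + z) - g x))"
      using L2_Cauchy_Schwarz[OF s] by simp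
    also have "L2_norm lborel ?s = 1" using \<phi>(2,3) by (simp add: L2_norm_def)
    finally have "\<bar>V x - g x\<bar>\<^sup>2 \<le> (L2_norm lborel (\<lambda>z. ?s z * (g (x + z) - g x)))\<^sup>2"
      by (intro power_mono) auto
    then have "(V x - g x)\<^sup>2 \<le> (LINT z|lborel. \<phi> z * (g (x + z) - g x)\<^sup>2)"
      using \<phi>(2) by (simp add: L2_norm_sq power_mult_distrib)
    also have "ennreal \<dots> = ?R x"
      using i \<phi>(2) by (intro nn_integral_eq_integral[symmetric]) auto
    finally show ?thesis by (simp add: ennreal_leI)
  next
    case False then show ?thesis by (simp add: top.not_eq_extremum[symmetric])
  qed
  have "(\<integral>\<^sup>+x. ennreal ((V x - g x)\<^sup>2) \<partial>lborel) \<le> (\<integral>\<^sup>+x. (\<integral>\<^sup>+z. ennreal (\<phi> z * (g (x + z) - g x)\<^sup>2) \<partial>lborel) \<partial>lborel)"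
    by (intro nn_integral_mono J)
  also have "\<dots> = (\<integral>\<^sup>+z. (\<integral>\<^sup>+x. ennreal (\<phi> z * (g (x + z) - g x)\<^sup>2) \<partial>lborel) \<partial>lborel)"
    by (rule lborel_pair.Fubini'[symmetric]) measurable
  also have "\<dots> \<le> (\<integral>\<^sup>+z. ennreal (\<phi> z) * ennreal (e\<^sup>2) \<partial>lborel)"
  proof (rule nn_integral_mono)
    fix z :: 'a
    show "(\<integral>\<^sup>+x. ennreal (\<phi> z * (g (x + z) - g x)\<^sup>2) \<partial>lborel) \<le> ennreal (\<phi> z) * ennreal (e\<^sup>2)"
    proof (cases "z \<in> K")
      case True
      have "(\<integral>\<^sup>+x. ennreal (\<phi> z * (g (x + z) - g x)\<^sup>2) \<partial>lborel) = ennreal (\<phi> z) * (\<integral>\<^sup>+x. ennreal ((g (x + z) - g x)\<^sup>2) \<partial>lborel)"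
        using \<phi>(2) by (subst nn_integral_cmult[symmetric]) (auto simp: ennreal_mult)
      also have "(\<integral>\<^sup>+x. ennreal ((g (x + z) - g x)\<^sup>2) \<partial>lborel) = ennreal ((L2_norm lborel (\<lambda>x. g (x + z) - g x))\<^sup>2)"
        using L2_D(2)[OF L2_diff[OF L2_translate(1)[OF g(1)] g(1)], of z] unfolding L2_norm_sq
        by (intro nn_integral_eq_integral) auto
      also have "\<dots> \<le> ennreal (e\<^sup>2)" using T[OF True] by (intro ennreal_leI power_mono L2_norm_nonneg)
      finally show ?thesis by (simp add: mult_left_mono)
    qed (use \<phi>(5) in simp)
  qed
  also have "\<dots> = (\<integral>\<^sup>+z. ennreal (\<phi> z) \<partial>lborel) * ennreal (e\<^sup>2)"
    by (rule nn_integral_multc) simp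
  also have "(\<integral>\<^sup>+z. ennreal (\<phi> z) \<partial>lborel) = 1"
    using nn_integral_eq_integral[OF \<phi>i] \<phi>(2,3) by simp
  finally have le: "(\<integral>\<^sup>+x. ennreal ((V x - g x)\<^sup>2) \<partial>lborel) \<le> ennreal (e\<^sup>2)" by simp
  then have i: "integrable lborel (\<lambda>x. (V x - g x)\<^sup>2)"
    by (intro integrableI_nonneg) (auto intro: le_less_trans)
  then show "(\<lambda>x. V x - g x) \<in> L2 lborel" by (simp add: L2_def)
  have "ennreal (LINT x|lborel. (V x - g x)\<^sup>2) \<le> ennreal (e\<^sup>2)"
    using le nn_integral_eq_integral[OF i] by simp
  then have "(LINT x|lborel. (V x - g x)\<^sup>2) \<le> e\<^sup>2" by simp
  then show "L2_norm lborel (\<lambda>x. V x - g x) \<le> e"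
    unfolding L2_norm_def using e by (intro real_le_lsqrt) auto
qed

lemma dirderiv_translate:
  fixes \<phi> :: "'a::euclidean_space \<Rightarrow> real"
  assumes "Ck (Suc m) \<phi>" shows "dirderiv (\<lambda>x. \<phi> (x - y)) w x = dirderiv \<phi> w (x - y)"
proof (rule dirderiv_eqI)
  show "((\<lambda>x. \<phi> (x - y)) has_derivative (\<lambda>h. dirderiv \<phi> h (x - y))) (at x)"
    by (rule has_derivative_compose[of "\<lambda>x. x - y" "\<lambda>h. h" x UNIV \<phi>])
       (auto intro!: derivative_eq_intros Ck_Suc_has_derivative[OF assms])
qed

context bounded_open begin

lemma L2_norm_LM_le:
  assumes "h \<in> L2 lborel"
  shows "h \<in> L2 LM" "L2_norm LM h \<le> L2_norm lborel h"
proof -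
  have m: "h \<in> borel_measurable borel" using L2_D(1)[OF assms] by simp
  have i: "integrable lborel (\<lambda>x. indicator \<Omega> x * (h x)\<^sup>2)"
    using integrable_mult_indicator[of \<Omega> lborel "\<lambda>x. (h x)\<^sup>2"] L2_D(2)[OF assms] sets_dom by simp
  show "h \<in> L2 LM" using i integral_LM(2)[of "\<lambda>x. (h x)\<^sup>2"] m borel_imp_LM[OF m] by (simp add: L2_def)
  have "(LINT x|LM. (h x)\<^sup>2) \<le> (LINT x|lborel. (h x)\<^sup>2)"
    using m i L2_D(2)[OF assms] by (subst integral_LM) (auto intro!: integral_mono simp: indicator_def)
  then show "L2_norm LM h \<le> L2_norm lborel h" by (simp add: L2_norm_def)
qed

text \<open>The geometric hypothesis \<open>cone\<close> lets the mollification kernel, supported in the box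
  \<open>\<epsilon>[a, b]\<close>, look only at points of \<open>\<Omega>\<close>; so it acts as a test function up to the boundary.\<close>

lemma mollification_approximates_locally:
  assumes WP: "\<And>j. WP j f (g j)"
    and N: "closed N" "\<And>x. x \<notin> N \<Longrightarrow> f x = 0" "\<And>j x. x \<notin> N \<Longrightarrow> g j x = 0"
    and ab: "box a b \<noteq> {}" and e0: "e0 > 0"
    and cone: "\<And>e y. 0 < e \<Longrightarrow> e < e0 \<Longrightarrow> y \<in> \<Omega> \<Longrightarrow> \<exists>z\<in>cbox a b. y + e *\<^sub>R z \<in> N \<Longrightarrow> \<forall>z\<in>cbox a b. y + e *\<^sub>R z \<in> \<Omega>"
    and \<eta>: "\<eta> > 0"
  obtains v where "Ck 1 v" "L2_norm LM (\<lambda>x. v x - f x) \<le> \<eta>" "\<And>j. L2_norm LM (\<lambda>x. dirderiv v (axis j 1) x - g j x) \<le> \<eta>"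
proof -
  \<comment> \<open>Borel representatives that vanish outside \<open>\<Omega>\<close> and outside
    \<open>N\<close>. Setting values off \<open>N\<close> to zero changes nothing almost everywhere,
    since the original function vanishes there.\<close>
  have rep: "\<exists>h'. h' \<in> borel_measurable borel \<and> (\<forall>x. x \<notin> \<Omega> \<or> x \<notin> N \<longrightarrow> h' x = 0) \<and> (AE x in LM. h x = h' x) \<and> h' \<in> L2 lborel \<and> integrable lborel h'"
    if h: "h \<in> L2 LM" "\<And>x. x \<notin> N \<Longrightarrow> h x = 0" for h
  proof -
    obtain h' where h': "h' \<in> borel_measurable borel" "\<And>x. x \<notin> \<Omega> \<Longrightarrow> h' x = 0" "AE x in LM. h x = h' x"
     "h' \<in> L2 LM" "h' \<in> L2 lborel" "integrable lborel h'" by (rule L2_representative[OF h(1)]) (rule that; assumption)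
    have Nb: "N \<in> sets borel" using N(1) by auto
    let ?h = "\<lambda>x. indicator N x * h' x"
    have "?h \<in> borel_measurable borel" using h'(1) Nb by measurable
    moreover have "?h \<in> L2 lborel"
      by (rule L2_bounded_mult[OF h'(5), of _ 1]) (use Nb in \<open>auto simp: indicator_def\<close>)
    moreover have "integrable lborel ?h" using integrable_mult_indicator[OF _ h'(6), of N] Nb by simp
    moreover have "AE x in LM. h x = ?h x" using h'(3) by eventually_elim (use h(2) in \<open>auto simp: indicator_def\<close>)
    ultimately show ?thesis using h'(2) by (intro exI[of _ ?h]) auto
  qed
  obtain f' where f': "f' \<in> borel_measurable borel" "\<And>x. x \<notin> \<Omega> \<or> x \<notin> N \<Longrightarrow> f' x = 0" "AE x in LM. f x = f' x" "f' \<in> L2 lborel" "integrable lborel f'"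
    using rep[OF WP_L2(1)[OF WP[of 1]] N(2)] by blast
  have "\<forall>j. \<exists>h'. h' \<in> borel_measurable borel \<and> (\<forall>x. x \<notin> \<Omega> \<or> x \<notin> N \<longrightarrow> h' x = 0) \<and> (AE x in LM. g j x = h' x) \<and> h' \<in> L2 lborel \<and> integrable lborel h'"
    using rep[OF WP_L2(2)[OF WP] N(3)] by blast
  then obtain g' where "\<forall>j. g' j \<in> borel_measurable borel \<and> (\<forall>x. x \<notin> \<Omega> \<or> x \<notin> N \<longrightarrow> g' j x = 0) \<and> (AE x in LM. g j x = g' j x) \<and> g' j \<in> L2 lborel \<and> integrable lborel (g' j)"
    using choice[of "\<lambda>j h'. h' \<in> borel_measurable borel \<and> (\<forall>x. x \<notin> \<Omega> \<or> x \<notin> N \<longrightarrow> h' x = 0) \<and> (AE x in LM. g j x = h' x) \<and> h' \<in> L2 lborel \<and> integrable lborel h'"] by blast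
  then have g': "\<And>j. g' j \<in> borel_measurable borel" "\<And>j x. x \<notin> \<Omega> \<or> x \<notin> N \<Longrightarrow> g' j x = 0" "\<And>j. AE x in LM. g j x = g' j x" "\<And>j. g' j \<in> L2 lborel" "\<And>j. integrable lborel (g' j)"
    by blast+
  have WP': "WP j f' (g' j)" for j
    by (rule WP_AE_cong[OF WP borel_imp_LM[OF f'(1)] borel_imp_LM[OF g'(1)] f'(3) g'(3)])
  obtain d0 where d0: "d0 > 0" "\<And>h. norm h < d0 \<Longrightarrow> L2_norm lborel (\<lambda>x. f' (x + h) - f' x) \<le> \<eta>"
    using L2_translation_continuous[OF f'(4) \<eta>] by blast
  have "\<forall>j. \<exists>d>0. \<forall>h. norm h < d \<longrightarrow> L2_norm lborel (\<lambda>x. g' j (x + h) - g' j x) \<le> \<eta>"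
    using L2_translation_continuous[OF g'(4) \<eta>] by metis
  then obtain D where D: "\<And>j. D j > 0" "\<And>j h. norm h < D j \<Longrightarrow> L2_norm lborel (\<lambda>x. g' j (x + h) - g' j x) \<le> \<eta>" by metis
  define d where "d = min d0 (Min (range D))"
  have d: "d > 0" "d \<le> d0" "\<And>j. d \<le> D j" using d0(1) D(1) by (auto simp: d_def min.coboundedI2)
  obtain B where B: "B > 0" "\<And>z. z \<in> cbox a b \<Longrightarrow> norm z \<le> B"
    using bounded_cbox[of a b] unfolding bounded_pos by metis
  \<comment> \<open>Small enough for the cone hypothesis, and such that every vector of the scaled
    box is shorter than the modulus \<open>d\<close> of translation continuity.\<close>
  define e where "e = min (e0 / 2) (d / (2 * B))"
  have e: "e > 0" "e < e0" using e0 d B by (auto simp: e_def min_less_iff_disj)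
  have eB: "e * B < d"
  proof -
    have "e * B \<le> d / (2 * B) * B" using B(1) by (intro mult_right_mono) (auto simp: e_def)
    also have "\<dots> = d / 2" using B(1) by simp
    finally show ?thesis using d(1) by simp
  qed
  let ?K = "cbox (e *\<^sub>R a) (e *\<^sub>R b)"
  have K: "\<exists>z\<in>cbox a b. k = e *\<^sub>R z" if "k \<in> ?K" for k
    using that e(1) by (intro bexI[of _ "(1/e) *\<^sub>R k"]) (auto simp: mem_box_cart field_simps)
  have Kn: "norm k < d" if k: "k \<in> ?K" for k
  proof -
    obtain z where "z \<in> cbox a b" "k = e *\<^sub>R z" using K[OF k] by blast
    then have "norm k \<le> e * B" using B(2)[of z] e by simp
    then show ?thesis using eB by simp
  qed
  define b0 where "b0 = box_bump 1 (e *\<^sub>R a) (e *\<^sub>R b)"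
  have b0C: "Ck m b0" for m unfolding b0_def by (rule Ck_box_bump)
  have b0z: "b0 x = 0" if "x \<notin> ?K" for x
    unfolding b0_def using that box_subset_cbox by (intro box_bump_eq_0) auto
  have b0i: "integrable lborel b0" by (rule integrable_bounded_support[OF Ck_continuous[OF b0C] bounded_cbox b0z])
  define c where "c = integral\<^sup>L lborel b0"
  have c: "c > 0"
  proof -
    have "c \<ge> 0" unfolding c_def b0_def by (intro Bochner_Integration.integral_nonneg box_bump_nonneg)
    moreover have "c \<noteq> 0"
    proof
      assume "c = 0"
      then have "AE x in lborel. b0 x = 0"
        using integral_nonneg_eq_0_iff_AE[OF b0i] by (simp add: c_def b0_def box_bump_nonneg)
      then have "AE x in lborel. x \<notin> box (e *\<^sub>R a) (e *\<^sub>R b)"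
      proof eventually_elim
        case (elim x)
        then show ?case using box_bump_pos_iff[of 1 "e *\<^sub>R a" "e *\<^sub>R b" x] by (simp add: b0_def)
      qed
      then have em0: "emeasure lborel (box (e *\<^sub>R a) (e *\<^sub>R b)) = 0"
        by (subst (asm) AE_iff_measurable[OF _ refl]) auto
      have "\<And>i. a$i < b$i" using ab unfolding ex_in_conv[symmetric] mem_box_cart by (meson less_trans)
      then have eab: "e *\<^sub>R a \<bullet> i < e *\<^sub>R b \<bullet> i" if "i \<in> Basis" for i
        using that e(1) by (auto simp: Basis_vec_def inner_axis)
      have "(\<Prod>i\<in>Basis. (e *\<^sub>R b - e *\<^sub>R a) \<bullet> i) > 0"
        by (rule prod_pos) (use eab in \<open>auto simp: inner_diff_left\<close>)
      moreover have "emeasure lborel (box (e *\<^sub>R a) (e *\<^sub>R b)) = ennreal (\<Prod>i\<in>Basis. (e *\<^sub>R b - e *\<^sub>R a) \<bullet> i)"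
        by (rule emeasure_lborel_box) (rule less_imp_le[OF eab])
      ultimately have "emeasure lborel (box (e *\<^sub>R a) (e *\<^sub>R b)) \<noteq> 0"
        by (simp only: ennreal_eq_0_iff not_le)
      then show False using em0 by simp
    qed
    ultimately show ?thesis by simp
  qed
  define \<phi> where "\<phi> = (\<lambda>x. 1 / c * b0 x)"
  have \<phi>C: "Ck m \<phi>" for m unfolding \<phi>_def by (intro Ck_mult Ck_const b0C)
  have \<phi>0: "0 \<le> \<phi> x" for x unfolding \<phi>_def b0_def using c by (intro mult_nonneg_nonneg box_bump_nonneg) auto
  have \<phi>1: "integral\<^sup>L lborel \<phi> = 1" using c by (simp add: \<phi>_def c_def)
  have \<phi>z: "\<phi> x = 0" if "x \<notin> ?K" for x using b0z[OF that] by (simp add: \<phi>_def)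
  define V where "V h x = (LINT y|lborel. h y * \<phi> (y - x))" for h x
  have conv: "(\<lambda>x. V h x - h x) \<in> L2 lborel \<and> L2_norm LM (\<lambda>x. V h x - h x) \<le> \<eta>"
    if "h \<in> L2 lborel" "integrable lborel h" "\<And>k. norm k < d \<Longrightarrow> L2_norm lborel (\<lambda>x. h (x + k) - h x) \<le> \<eta>" for h
  proof -
    note m = mollification_L2[OF that(1,2) Ck_continuous[OF \<phi>C[of 1]] \<phi>0 \<phi>1 bounded_cbox \<phi>z that(3)[OF Kn] less_imp_le[OF \<eta>], folded V_def]
    show ?thesis using m(1) order_trans[OF L2_norm_LM_le(2)[OF m(1)] m(2)] by blast
  qed
  have \<phi>1C: "Ck 1 \<phi>" by (rule \<phi>C)
  have VF: "V f' = (\<lambda>x. LINT y|lborel. f' y * \<phi> (y - x))" by (simp add: V_def[abs_def])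
  have mol1: "Ck 1 (V f')"
    unfolding VF by (rule mollification_Ck(1)[OF f'(5) \<phi>1C bounded_cbox \<phi>z])
  have mol2: "dirderiv (V f') w x = - (LINT y|lborel. f' y * dirderiv \<phi> w (y - x))" for w x
    unfolding VF by (rule mollification_Ck(2)[OF f'(5) \<phi>1C bounded_cbox \<phi>z])
  have Dz: "dirderiv \<phi> w x = 0" if "x \<notin> ?K" for x w
    by (rule dirderiv_eq_0_outside[OF closed_cbox \<phi>z that])
  \<comment> \<open>If the translated kernel box meets \<open>N\<close>, the cone hypothesis puts it
    inside \<open>\<Omega>\<close>, so the kernel is an admissible test function and the defining
    identity of the weak derivative applies. If it misses \<open>N\<close>, both sides vanish
    because \<open>f'\<close> and \<open>g' j\<close> live on \<open>N\<close>.\<close>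
  have key: "dirderiv (V f') (axis j 1) y = V (g' j) y" if y: "y \<in> \<Omega>" for j y
  proof (cases "\<exists>z\<in>cbox a b. y + e *\<^sub>R z \<in> N")
    case True
    from cone[OF e y True] have sub: "\<forall>z\<in>cbox a b. y + e *\<^sub>R z \<in> \<Omega>" .
    let ?t = "\<lambda>x. \<phi> (x - y)"
    have t: "test_function \<Omega> ?t"
    proof -
      have "Ck m ?t" for m using Ck_affine_compose[OF \<phi>C, of m 1 "- y"] by simp
      moreover have s: "closure {x. ?t x \<noteq> 0} \<subseteq> (+) y ` ?K"
      proof (rule closure_minimal)
        show "closed ((+) y ` ?K)" by (intro closed_translation closed_cbox)
        show "{x. ?t x \<noteq> 0} \<subseteq> (+) y ` ?K"
        proof
          fix x assume "x \<in> {x. ?t x \<noteq> 0}"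
          then have "x - y \<in> ?K" using \<phi>z by blast
          then show "x \<in> (+) y ` ?K" by (intro image_eqI[of _ _ "x - y"]) auto
        qed
      qed
      moreover have "compact (closure {x. ?t x \<noteq> 0})"
        using compact_Int_closed[OF compact_translation[OF compact_cbox], of "closure {x. ?t x \<noteq> 0}" y "e *\<^sub>R a" "e *\<^sub>R b"] s
        by (simp add: Int_absorb1)
      moreover have "(+) y ` ?K \<subseteq> \<Omega>" using K sub by force
      ultimately show ?thesis unfolding test_function_def by blast
    qed
    have Dt: "dirderiv ?t w x = dirderiv \<phi> w (x - y)" for w x
      by (rule dirderiv_translate[of 0]) (use \<phi>C in blast)
    have LL: "(LINT x|LM. h x * k x) = (LINT x|lborel. h x * k x)" if "h \<in> borel_measurable borel" "\<And>x. x \<notin> \<Omega> \<or> x \<notin> N \<Longrightarrow> h x = 0" "continuous_on UNIV k" for h k :: "_ \<Rightarrow> real"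
    proof -
      have "k \<in> borel_measurable borel" using that(3) by (rule borel_measurable_continuous_onI)
      then show ?thesis using that(1,2)
        by (subst integral_LM) (auto simp: indicator_def intro!: Bochner_Integration.integral_cong)
    qed
    have "(LINT x|lborel. f' x * dirderiv \<phi> (axis j 1) (x - y)) = - (LINT x|lborel. g' j x * \<phi> (x - y))"
      using WP_test[OF WP' t, of j] LL[OF f'(1,2) test_function_continuous(2)[OF t, of "axis j 1"]]
        LL[OF g'(1)[of j] g'(2)[of _ j] test_function_continuous(1)[OF t]] by (simp add: Dt)
    then show ?thesis by (simp add: mol2 V_def)
  next
    case False
    have out: "x - y \<notin> ?K" if "x \<in> N" for x
    proof
      assume "x - y \<in> ?K"
      then obtain z where "z \<in> cbox a b" "x - y = e *\<^sub>R z" using K by blast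
      then have "y + e *\<^sub>R z \<in> N" using that by (metis add_diff_cancel_left' diff_add_cancel add.commute)
      then show False using False \<open>z \<in> cbox a b\<close> by blast
    qed
    have "f' x * dirderiv \<phi> (axis j 1) (x - y) = 0" for x
      using out[of x] Dz[of "x - y" "axis j 1"] f'(2)[of x] by (cases "x \<in> N") auto
    then have "(LINT x|lborel. f' x * dirderiv \<phi> (axis j 1) (x - y)) = 0"
      by (intro integral_eq_zero_AE AE_I2)
    moreover have "g' j x * \<phi> (x - y) = 0" for x
      using out[of x] \<phi>z[of "x - y"] g'(2)[of x j] by (cases "x \<in> N") auto
    then have "(LINT x|lborel. g' j x * \<phi> (x - y)) = 0"
      by (intro integral_eq_zero_AE AE_I2)
    ultimately show ?thesis unfolding mol2 V_def by linarith
  qed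
  show ?thesis
  proof (rule that[of "V f'"])
    show V1: "Ck 1 (V f')" by (rule mol1)
    have c1: "(\<lambda>x. V f' x - f' x) \<in> L2 lborel" "L2_norm LM (\<lambda>x. V f' x - f' x) \<le> \<eta>"
      using conv[OF f'(4,5)] d0 d by auto
    have VL: "V f' \<in> borel_measurable LM" by (rule continuous_measurable[OF Ck_continuous[OF V1]])
    have "L2_norm LM (\<lambda>x. V f' x - f x) = L2_norm LM (\<lambda>x. V f' x - f' x)"
      using f'(3) L2_D(1)[OF WP_L2(1)[OF WP[of 1]]] borel_imp_LM[OF f'(1)] VL
      by (intro L2_norm_cong_AE) auto
    then show "L2_norm LM (\<lambda>x. V f' x - f x) \<le> \<eta>" using c1 by simp
    fix j
    have c2: "(\<lambda>x. V (g' j) x - g' j x) \<in> L2 lborel" "L2_norm LM (\<lambda>x. V (g' j) x - g' j x) \<le> \<eta>"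
      using conv[OF g'(4)[of j] g'(5)[of j]] D(2)[of _ j] d(3)[of j] by auto
    have DL: "dirderiv (V f') (axis j 1) \<in> borel_measurable LM"
      using continuous_measurable[OF Ck_Suc_continuous_dirderiv[of 0 "V f'"]] V1 by simp
    have "L2_norm LM (\<lambda>x. dirderiv (V f') (axis j 1) x - g j x) = L2_norm LM (\<lambda>x. V (g' j) x - g' j x)"
    proof (rule L2_norm_cong_AE)
      show "(\<lambda>x. V (g' j) x - g' j x) \<in> borel_measurable LM" using L2_norm_LM_le(1)[OF c2(1)] by (rule L2_D)
      show "(\<lambda>x. dirderiv (V f') (axis j 1) x - g j x) \<in> borel_measurable LM"
        using DL L2_D(1)[OF WP_L2(2)[OF WP[of j]]] by simp
      have "AE x in LM. x \<in> \<Omega>" by (simp add: AE_LM)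
      then show "AE x in LM. dirderiv (V f') (axis j 1) x - g j x = V (g' j) x - g' j x"
        using g'(3)[of j] by eventually_elim (simp add: key)
    qed
    then show "L2_norm LM (\<lambda>x. dirderiv (V f') (axis j 1) x - g j x) \<le> \<eta>" using c2 by simp
  qed
qed

end

section \<open>Boundary charts\<close>

definition chart_base :: "(real^3 \<Rightarrow> real^3) \<Rightarrow> real^3 \<Rightarrow> real^2" where
  "chart_base R y = vector [R y $ 1, R y $ 2]"

definition lift :: "real^2 \<Rightarrow> real \<Rightarrow> real^3" where
  "lift s t = vector [s$1, s$2, t]"

lemma lift_nth [simp]: "lift s t $ 1 = s$1" "lift s t $ 2 = s$2" "lift s t $ 3 = t"
  by (simp_all add: lift_def vector_3)

lemma chart_base_nth [simp]: "chart_base R y $ 1 = R y $ 1" "chart_base R y $ 2 = R y $ 2"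
  by (simp_all add: chart_base_def vector_2)

lemma lift_linear: "lift (s + s') (t + t') = lift s t + lift s' t'" "lift (c *\<^sub>R s) (c * t) = c *\<^sub>R lift s t"
  "lift (s - s') (t - t') = lift s t - lift s' t'"
  by (auto simp: vec_eq_iff forall_3)

lemma bounded_linear_lift: "bounded_linear (\<lambda>(s, t). lift s t)"
  unfolding linear_conv_bounded_linear[symmetric] by (rule linearI) (auto simp: lift_linear)

text \<open>A defining function: within the ball of the chart, \<open>\<Omega>\<close> is the set
  where it is positive and the boundary is its zero set.\<close>

definition chart_height :: "(real^3 \<Rightarrow> real^3) \<Rightarrow> (real^2 \<Rightarrow> real) \<Rightarrow> real^3 \<Rightarrow> real" where
  "chart_height R h y = R y $ 3 - h (chart_base R y)"

definition chart_point :: "(real^3 \<Rightarrow> real^3) \<Rightarrow> (real^2 \<Rightarrow> real) \<Rightarrow> real^2 \<Rightarrow> real^3" where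
  "chart_point R h s = inv R (lift s (h s))"

definition area_density :: "(real^2 \<Rightarrow> real) \<Rightarrow> real^2 \<Rightarrow> real" where
  "area_density h s = sqrt (1 + (dirderiv h (axis 1 1) s)\<^sup>2 + (dirderiv h (axis 2 1) s)\<^sup>2)"

lemma area_density_ge_1: "area_density h s \<ge> 1"
  by (simp add: area_density_def)

locale boundary_chart_at = bounded_open +
  fixes x0 :: "real^3" and r :: real and R :: "real^3 \<Rightarrow> real^3" and h :: "real^2 \<Rightarrow> real"
  assumes chart: "boundary_chart \<Omega> x0 r R h"
begin

abbreviation P where "P \<equiv> chart_base R"
abbreviation Y where "Y \<equiv> chart_point R h"
abbreviation H where "H \<equiv> chart_height R h"
abbreviation p where "p \<equiv> dirderiv h (axis 1 1)"
abbreviation q where "q \<equiv> dirderiv h (axis 2 1)"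
abbreviation J where "J \<equiv> area_density h"
abbreviation D where "D \<equiv> ball x0 r"
definition V where "V = {s. Y s \<in> D}"
definition up where "up = inv R (axis 3 1)"

lemma r_pos: "r > 0" and orth: "orthogonal_transformation R" and C2: "Ck 2 h"
  using chart unfolding boundary_chart_def by blast+

lemma dom:
  assumes "y \<in> D" shows "y \<in> \<Omega> \<longleftrightarrow> H y > 0"
proof -
  have "\<Omega> \<inter> D = {y \<in> D. h (vector [R y $ 1, R y $ 2]) < R y $ 3}"
    using chart unfolding boundary_chart_def by blast
  then have "y \<in> \<Omega> \<inter> D \<longleftrightarrow> h (P y) < R y $ 3"
    using assms by (simp only: chart_base_def mem_Collect_eq) simp
  then show ?thesis using assms by (simp add: chart_height_def)
qed

lemma C2': "Ck (Suc (Suc 0)) h" using C2 by (simp only: numeral_2_eq_2)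

lemma R_lin: "bounded_linear R" "linear R"
  using orth orthogonal_transformation_linear linear_conv_bounded_linear by auto

lemma R_inv [simp]: "R (inv R v) = v" "inv R (R v) = v"
  using orthogonal_transformation_bij[OF orth] by (simp_all add: bij_is_surj surj_f_inv_f bij_is_inj)

lemma inv_orth: "orthogonal_transformation (inv R)"
  by (rule orthogonal_transformation_inv[OF orth])

lemma inv_lin: "bounded_linear (inv R)" "linear (inv R)"
  using inv_orth orthogonal_transformation_linear linear_conv_bounded_linear by auto

lemma inv_inner: "inv R v \<bullet> w = v \<bullet> R w"
  using orth unfolding orthogonal_transformation_def by (metis R_inv(1))

lemma norm_inv [simp]: "norm (inv R v) = norm v"
  using inv_orth orthogonal_transformation_norm by blast

lemma lift_P: "lift (P y) (R y $ 3) = R y"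
  by (auto simp: vec_eq_iff forall_3)

lemma P_lin: "bounded_linear P"
  unfolding linear_conv_bounded_linear[symmetric]
  by (rule linearI) (auto simp: vec_eq_iff forall_2 linear_add[OF R_lin(2)] linear_scale[OF R_lin(2)])

lemma P_inv [simp]: "P (inv R (lift s t)) = s"
  by (auto simp: vec_eq_iff forall_2)

lemma P_Y [simp]: "P (Y s) = s" and H_Y [simp]: "H (Y s) = 0" and R_Y3 [simp]: "R (Y s) $ 3 = h s"
  by (simp_all add: chart_point_def chart_height_def)

lemma Y_P: "H y = 0 \<Longrightarrow> Y (P y) = y"
  by (simp add: chart_point_def chart_height_def) (metis R_inv(2) lift_P)

lemma h_cont: "continuous_on UNIV h" and pq_cont: "continuous_on UNIV (dirderiv h w)"
  using Ck_continuous[OF C2] Ck_Suc_continuous_dirderiv[OF C2'] by auto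

lemma h_deriv: "(h has_derivative (\<lambda>k. dirderiv h k s)) (at s)"
  by (rule Ck_Suc_has_derivative[OF C2'])

lemma dirderiv_h: "dirderiv h k s = k$1 * p s + k$2 * q s"
  using dirderiv_sum_axis[OF C2', of k s] by (simp add: sum_2)

lemma H_cont: "continuous_on UNIV H"
  unfolding chart_height_def
  by (intro continuous_intros continuous_on_compose2[OF h_cont] linear_continuous_on[OF R_lin(1)] linear_continuous_on[OF P_lin]) auto

lemma H_deriv: "(H has_derivative (\<lambda>w. R w $ 3 - (R w $ 1 * p (P y) + R w $ 2 * q (P y)))) (at y)"
proof -
  have "((\<lambda>y. h (P y)) has_derivative (\<lambda>w. dirderiv h (P w) (P y))) (at y)"
    by (rule has_derivative_compose[OF bounded_linear_imp_has_derivative[OF P_lin] h_deriv])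
  moreover have "((\<lambda>y. R y $ 3) has_derivative (\<lambda>w. R w $ 3)) (at y)"
    by (intro bounded_linear_imp_has_derivative bounded_linear_compose[OF bounded_linear_vec_nth R_lin(1)])
  ultimately have "(H has_derivative (\<lambda>w. R w $ 3 - dirderiv h (P w) (P y))) (at y)"
    unfolding chart_height_def[abs_def] by (rule has_derivative_diff[rotated])
  moreover have "dirderiv h (P w) (P y) = R w $ 1 * p (P y) + R w $ 2 * q (P y)" for w
    using dirderiv_h[of "P w" "P y"] by simp
  ultimately show ?thesis by simp
qed

lemma R_up [simp]: "R up = axis 3 1" by (simp add: up_def)

lemma P_up [simp]: "P up = 0" by (auto simp: vec_eq_iff forall_2 axis_def)

lemma norm_up [simp]: "norm up = 1"
proof -
  have "norm (axis 3 1 :: real^3) = 1" by (simp add: norm_eq_sqrt_inner inner_axis)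
  then show ?thesis by (simp add: up_def)
qed

lemma H_up: "H (y + t *\<^sub>R up) = H y + t"
  using linear_add[OF R_lin(2)] linear_scale[OF R_lin(2)]
    linear_add[OF bounded_linear.linear[OF P_lin]] linear_scale[OF bounded_linear.linear[OF P_lin]]
  by (simp add: chart_height_def axis_def)

text \<open>Where \<open>H\<close> is negative there is an open set disjoint from
  \<open>\<Omega>\<close>, so such points are not in the closure. A zero of \<open>H\<close> is
  approached from \<open>\<Omega>\<close> along \<open>up\<close>, which raises \<open>H\<close> by
  exactly the distance moved.\<close>

lemma frontier_iff:
  assumes "y \<in> D" shows "y \<in> frontier \<Omega> \<longleftrightarrow> H y = 0"
proof
  assume y: "y \<in> frontier \<Omega>"
  then have "y \<notin> \<Omega>" "y \<in> closure \<Omega>" using open_dom by (auto simp: frontier_def interior_open)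
  then have le: "H y \<le> 0" using dom[OF assms] by simp
  have "\<not> H y < 0"
  proof
    assume "H y < 0"
    let ?U = "D \<inter> {y. H y < 0}"
    have "open ?U" by (intro open_Int open_ball open_Collect_less H_cont continuous_on_const)
    moreover have "?U \<inter> \<Omega> = {}" using dom by force
    ultimately have "?U \<inter> closure \<Omega> = {}" by (simp add: open_Int_closure_eq_empty)
    then show False using \<open>H y < 0\<close> assms \<open>y \<in> closure \<Omega>\<close> by auto
  qed
  then show "H y = 0" using le by simp
next
  assume Hy: "H y = 0"
  then have "y \<notin> \<Omega>" using dom[OF assms] by simp
  moreover have "y \<in> closure \<Omega>"
    unfolding closure_approachable
  proof (intro allI impI)
    fix e :: real assume "e > 0"
    define t where "t = min (e / 2) ((r - dist x0 y) / 2)"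
    have t: "t > 0" "t < e" "t < r - dist x0 y" using \<open>e > 0\<close> assms by (auto simp: t_def min_less_iff_disj)
    have d: "dist (y + t *\<^sub>R up) y = t" using t by (simp add: dist_norm)
    have "y + t *\<^sub>R up \<in> D" using d t(3) dist_triangle[of x0 "y + t *\<^sub>R up" y] by (simp add: dist_commute)
    then have "y + t *\<^sub>R up \<in> \<Omega>" using dom H_up[of y t] Hy t by simp
    then show "\<exists>z\<in>\<Omega>. dist z y < e" using d t(2) by metis
  qed
  ultimately show "y \<in> frontier \<Omega>" using open_dom by (simp add: frontier_def interior_open)
qed

lemma Y_deriv: "(Y has_derivative (\<lambda>k. inv R (lift k (dirderiv h k s)))) (at s)"
proof -
  have "((\<lambda>s. (s, h s)) has_derivative (\<lambda>k. (k, dirderiv h k s))) (at s)"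
    by (intro has_derivative_Pair has_derivative_ident h_deriv)
  from has_derivative_compose[OF this bounded_linear_imp_has_derivative[OF bounded_linear_compose[OF inv_lin(1) bounded_linear_lift]]]
  show ?thesis by (simp add: chart_point_def[abs_def])
qed

lemma dirderiv_Y: "dirderiv Y k s = inv R (lift k (dirderiv h k s))"
  by (rule dirderiv_eqI[OF Y_deriv])

lemma Y_cont: "continuous_on UNIV Y"
  using Y_deriv by (meson continuous_at_imp_continuous_on has_derivative_continuous)

lemma V_open: "open V"
proof -
  have "V = Y -` D" by (auto simp: V_def)
  then show ?thesis using Y_cont by (simp add: open_vimage continuous_on_eq_continuous_at)
qed

lemma V_bounded: "bounded V"
proof -
  have "V \<subseteq> P ` D"
  proof
    fix s assume "s \<in> V"
    then show "s \<in> P ` D" by (intro image_eqI[of _ _ "Y s"]) (auto simp: V_def)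
  qed
  then show ?thesis using bounded_linear_image[OF bounded_ball P_lin] bounded_subset by blast
qed

lemma Y_image: "Y ` V = frontier \<Omega> \<inter> D"
proof
  show "Y ` V \<subseteq> frontier \<Omega> \<inter> D" using frontier_iff by (auto simp: V_def)
  show "frontier \<Omega> \<inter> D \<subseteq> Y ` V"
  proof
    fix y assume y: "y \<in> frontier \<Omega> \<inter> D"
    then have "Y (P y) = y" using frontier_iff Y_P by auto
    then show "y \<in> Y ` V" using y by (intro image_eqI[of _ _ "P y"]) (auto simp: V_def)
  qed
qed

text \<open>Lagrange's identity on the lifted tangent vectors:
  \<open>(1 + p^2) (1 + q^2) - (p q)^2 = 1 + p^2 + q^2\<close>. Thus \<open>J\<close> is the area
  element that \<open>is_surface_measure\<close> prescribes for the graph patch.\<close>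

lemma norm_cross_Y: "norm (cross3 (dirderiv Y (axis 1 1) s) (dirderiv Y (axis 2 1) s)) = J s"
proof -
  let ?a = "lift (axis 1 1) (p s)" and ?b = "lift (axis 2 1) (q s)"
  have n: "(norm (cross3 a b))\<^sup>2 = (norm a)\<^sup>2 * (norm b)\<^sup>2 - (a \<bullet> b)\<^sup>2" for a b
    using norm_cross_dot[of a b] by (simp add: power_mult_distrib)
  have i: "inv R a \<bullet> inv R b = a \<bullet> b" for a b by (simp add: inv_inner)
  have "(norm (cross3 (inv R ?a) (inv R ?b)))\<^sup>2 = (norm ?a)\<^sup>2 * (norm ?b)\<^sup>2 - (?a \<bullet> ?b)\<^sup>2"
    unfolding n i by simp
  also have "\<dots> = 1 + (p s)\<^sup>2 + (q s)\<^sup>2"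
    unfolding power2_norm_eq_inner by (simp add: inner_vec_def sum_3 axis_def power2_eq_square algebra_simps)
  finally have "norm (cross3 (inv R ?a) (inv R ?b)) = sqrt (1 + (p s)\<^sup>2 + (q s)\<^sup>2)"
    by (metis norm_ge_zero real_sqrt_unique)
  then show ?thesis by (simp add: dirderiv_Y area_density_def)
qed

lemma patch_Y: "surface_patch (frontier \<Omega>) V Y"
  unfolding surface_patch_def
proof (intro conjI ballI)
  show "open V" by (rule V_open)
  show "Y ` V \<subseteq> frontier \<Omega>" using Y_image by auto
  show "inj_on Y V" by (rule inj_onI) (metis P_Y)
  show "Y differentiable_on V" using Y_deriv
    by (meson differentiableI differentiable_at_imp_differentiable_on)
  show "continuous_on V (dirderiv Y b)" for b
  proof -
    have "continuous_on UNIV (\<lambda>s. (b, dirderiv h b s))" by (intro continuous_intros pq_cont)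
    from continuous_on_compose2[OF linear_continuous_on[OF bounded_linear_compose[OF inv_lin(1) bounded_linear_lift], of UNIV] this]
    have "continuous_on UNIV (dirderiv Y b)" by (simp add: dirderiv_Y[abs_def])
    then show ?thesis by (rule continuous_on_subset) simp
  qed
  show "cross3 (dirderiv Y (axis 1 1) s) (dirderiv Y (axis 2 1) s) \<noteq> 0" for s
    using norm_cross_Y[of s] area_density_ge_1[of h s] by auto
qed

lemma J_cont: "continuous_on UNIV J"
  unfolding area_density_def by (intro continuous_intros pq_cont)

abbreviation normal where "normal y \<equiv> chart_normal y R h"

lemma normal_eq: "normal y = inv R ((1 / J (P y)) *\<^sub>R lift (vector [p (P y), q (P y)]) (- 1))"
proof -
  have "(vector [p (P y), q (P y), - 1] :: real^3) = lift (vector [p (P y), q (P y)]) (- 1)"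
    by (auto simp: vec_eq_iff forall_3 vector_2 vector_3)
  then show ?thesis by (simp add: chart_normal_def Let_def chart_base_def area_density_def)
qed

lemma normal_inner: "normal y \<bullet> w = (p (P y) * R w $ 1 + q (P y) * R w $ 2 - R w $ 3) / J (P y)"
  unfolding normal_eq inv_inner by (simp add: inner_vec_def sum_3 vector_2 field_simps add_divide_distrib diff_divide_distrib)

lemma J_normal_inner: "J (P y) * (normal y \<bullet> w) = p (P y) * R w $ 1 + q (P y) * R w $ 2 - R w $ 3"
  unfolding normal_inner using area_density_ge_1[of h "P y"] by simp

lemma norm_normal: "norm (normal y) = 1"
proof -
  have "norm (lift (vector [p (P y), q (P y)]) (- 1)) = J (P y)"
    unfolding area_density_def norm_eq_sqrt_inner by (simp add: inner_vec_def sum_3 vector_2 power2_eq_square add.commute add.left_commute)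
  then show ?thesis unfolding normal_eq norm_inv norm_scaleR using area_density_ge_1[of h "P y"] by simp
qed

lemma normal_cont: "continuous_on UNIV normal"
proof -
  have c: "continuous_on UNIV (\<lambda>y. f (P y))" if "continuous_on UNIV f" for f :: "_ \<Rightarrow> real"
    by (rule continuous_on_compose2[OF that linear_continuous_on[OF P_lin]]) auto
  have v: "(vector [p (P y), q (P y)] :: real^2) = p (P y) *\<^sub>R axis 1 1 + q (P y) *\<^sub>R axis 2 1" for y
    by (auto simp: vec_eq_iff forall_2 vector_2 axis_def)
  have "continuous_on UNIV (\<lambda>y. (p (P y) *\<^sub>R axis 1 1 + q (P y) *\<^sub>R axis 2 1 :: real^2, - 1 :: real))"
    by (intro continuous_intros c pq_cont)
  from continuous_on_compose2[OF linear_continuous_on[OF bounded_linear_lift, of UNIV] this]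
  have "continuous_on UNIV (\<lambda>y. lift (vector [p (P y), q (P y)]) (- 1))" unfolding v by simp
  then have "continuous_on UNIV (\<lambda>y. (1 / J (P y)) *\<^sub>R lift (vector [p (P y), q (P y)]) (- 1))"
    using area_density_ge_1[of h] by (intro continuous_intros c J_cont) (auto, metis not_one_le_zero)
  from continuous_on_compose2[OF linear_continuous_on[OF inv_lin(1), of UNIV] this]
  show ?thesis unfolding normal_eq[abs_def] by simp
qed

text \<open>Along the ray the height \<open>H\<close> has derivative
  \<open>- J (P y) * (normal y \<bullet> w)\<close> at 0, whose sign decides on which side of the
  graph the ray starts. The conclusion ties the normal to \<open>\<Omega>\<close> rather than to the
  chart, which makes normals of different charts comparable.\<close>

lemma normal_side:
  assumes y: "y \<in> frontier \<Omega>" "y \<in> D" and w: "normal y \<bullet> w \<noteq> 0"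
  shows "eventually (\<lambda>t. y + t *\<^sub>R w \<in> \<Omega> \<longleftrightarrow> normal y \<bullet> w < 0) (at_right 0)"
proof -
  have Hy: "H y = 0" using frontier_iff y by simp
  define c where "c = - (J (P y) * (normal y \<bullet> w))"
  have J: "J (P y) > 0" using area_density_ge_1[of h "P y"] by linarith
  have "((\<lambda>t. H (y + t *\<^sub>R w)) has_derivative (\<lambda>k. R (k *\<^sub>R w) $ 3 - (R (k *\<^sub>R w) $ 1 * p (P y) + R (k *\<^sub>R w) $ 2 * q (P y)))) (at 0)"
  proof (rule has_derivative_compose[of "\<lambda>t. y + t *\<^sub>R w" "\<lambda>k. k *\<^sub>R w" 0 UNIV H])
    show "((\<lambda>t. y + t *\<^sub>R w) has_derivative (\<lambda>k. k *\<^sub>R w)) (at 0)" by (auto intro!: derivative_eq_intros)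
  qed (use H_deriv[of y] in simp)
  moreover have "R (k *\<^sub>R w) $ 3 - (R (k *\<^sub>R w) $ 1 * p (P y) + R (k *\<^sub>R w) $ 2 * q (P y)) = c * k" for k
  proof -
    have "c = R w $ 3 - (R w $ 1 * p (P y) + R w $ 2 * q (P y))"
      unfolding c_def J_normal_inner by (simp add: algebra_simps)
    from arg_cong[OF this, of "\<lambda>x. x * k"]
    show ?thesis unfolding linear_scale[OF R_lin(2)] by (simp add: algebra_simps)
  qed
  ultimately have "((\<lambda>t. H (y + t *\<^sub>R w)) has_real_derivative c) (at 0)"
    by (simp add: has_field_derivative_def)
  then have "((\<lambda>t. H (y + t *\<^sub>R w) / t) \<longlongrightarrow> c) (at 0)"
    by (simp add: has_field_derivative_iff Hy)
  then have lim: "((\<lambda>t. H (y + t *\<^sub>R w) / t) \<longlongrightarrow> c) (at_right 0)"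
    by (rule tendsto_mono[rotated]) (simp add: at_within_le_at)
  have "((\<lambda>t. y + t *\<^sub>R w) \<longlongrightarrow> y + 0 *\<^sub>R w) (at_right 0)" by (intro tendsto_intros)
  then have inD: "eventually (\<lambda>t. y + t *\<^sub>R w \<in> D) (at_right 0)"
    using y(2) by (intro topological_tendstoD[of _ y]) auto
  have pos: "eventually (\<lambda>t::real. t > 0) (at_right 0)" by (simp add: eventually_at_right_less)
  show ?thesis
  proof (cases "normal y \<bullet> w < 0")
    case True
    then have "c > 0" using J by (simp add: c_def mult_pos_neg)
    from order_tendstoD(1)[OF lim this] inD pos
    show ?thesis by eventually_elim (use True dom in \<open>auto simp: zero_less_divide_iff\<close>)
  next
    case False
    then have "c < 0" using J w by (simp add: c_def)
    from order_tendstoD(2)[OF lim this] inD pos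
    show ?thesis by eventually_elim (use False dom in \<open>auto simp: divide_less_0_iff\<close>)
  qed
qed

text \<open>\<open>outward_normal\<close> refers to charts centred at the point in question, so a
  chart of a neighbouring point has to be recentred by shrinking its ball.\<close>

lemma smaller_chart:
  assumes "y \<in> D" shows "boundary_chart \<Omega> y (r - dist x0 y) R h"
proof -
  have sub: "z \<in> D" if "z \<in> ball y (r - dist x0 y)" for z
    using that dist_triangle[of x0 z y] by (simp add: dist_commute)
  have "z \<in> \<Omega> \<longleftrightarrow> h (vector [R z $ 1, R z $ 2]) < R z $ 3" if "z \<in> ball y (r - dist x0 y)" for z
    using dom[OF sub[OF that]] by (simp add: chart_height_def chart_base_def)
  then show ?thesis using assms orth C2 unfolding boundary_chart_def by auto
qed

end

text \<open>If another chart gave a unit normal \<open>\<nu>\<close> different from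
  \<open>normal y\<close>, the direction \<open>\<nu> - normal y\<close> would have a positive
  product with the first and a negative one with the second, and by \<open>normal_side\<close> the
  ray along it would initially lie both outside and inside \<open>\<Omega>\<close>.\<close>

lemma (in boundary_chart_at) outward_normal_eq:
  assumes y: "y \<in> frontier \<Omega>" "y \<in> D"
  shows "outward_normal \<Omega> y = normal y"
  unfolding outward_normal_def
proof (rule the_equality)
  show "\<exists>r R' h'. boundary_chart \<Omega> y r R' h' \<and> normal y = chart_normal y R' h'"
    using smaller_chart[OF y(2)] by blast
  fix \<nu> assume "\<exists>r R h. boundary_chart \<Omega> y r R h \<and> \<nu> = chart_normal y R h"
  then obtain r' R' h' where c: "boundary_chart \<Omega> y r' R' h'" and \<nu>: "\<nu> = chart_normal y R' h'" by blast
  interpret c: boundary_chart_at \<Omega> y r' R' h' using c by unfold_locales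
  show "\<nu> = normal y"
  proof (rule ccontr)
    assume "\<nu> \<noteq> normal y"
    have n: "norm \<nu> = 1" "norm (normal y) = 1" using c.norm_normal norm_normal \<nu> by auto
    have "0 < (norm (\<nu> - normal y))\<^sup>2" using \<open>\<nu> \<noteq> normal y\<close> by simp
    also have "\<dots> = 2 * (1 - \<nu> \<bullet> normal y)"
      using n by (simp add: power2_norm_eq_inner inner_diff_left inner_diff_right inner_commute norm_eq_1)
    finally have lt: "\<nu> \<bullet> normal y < 1" by simp
    let ?w = "\<nu> - normal y"
    have 1: "\<nu> \<bullet> ?w > 0" "normal y \<bullet> ?w < 0"
      using n lt by (auto simp: inner_diff_right inner_commute norm_eq_1)
    have "eventually (\<lambda>t. y + t *\<^sub>R ?w \<in> \<Omega> \<longleftrightarrow> normal y \<bullet> ?w < 0) (at_right 0)"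
      using 1 by (intro normal_side y) auto
    moreover have "eventually (\<lambda>t. y + t *\<^sub>R ?w \<in> \<Omega> \<longleftrightarrow> \<nu> \<bullet> ?w < 0) (at_right 0)"
      using 1(1) c.r_pos unfolding \<nu> by (intro c.normal_side y(1)) auto
    ultimately have "eventually (\<lambda>t::real. False) (at_right 0)"
      by eventually_elim (use 1 in auto)
    then show False by simp
  qed
qed

section \<open>Charts, unit normal and compactness for a domain with C2 boundary\<close>

locale C2_domain =
  fixes \<Omega> :: "(real^3) set"
  assumes C2_dom: "bounded_C2_domain \<Omega>"

sublocale C2_domain \<subseteq> bounded_open
  using C2_dom by unfold_locales (auto simp: bounded_C2_domain_def)

context C2_domain begin

lemma ex_chart:
  assumes "x \<in> frontier \<Omega>"
  obtains r R h where "boundary_chart_at \<Omega> x r R h"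
proof -
  obtain r R h where c: "boundary_chart \<Omega> x r R h"
    using C2_dom assms unfolding bounded_C2_domain_def by blast
  have "boundary_chart_at \<Omega> x r R h" by unfold_locales (rule c)
  then show ?thesis by (rule that)
qed

lemma norm_outward_normal: "x \<in> frontier \<Omega> \<Longrightarrow> norm (outward_normal \<Omega> x) = 1"
  using ex_chart boundary_chart_at.outward_normal_eq boundary_chart_at.norm_normal boundary_chart_at.r_pos
  by (metis centre_in_ball)

lemma outward_normal_continuous: "continuous_on (frontier \<Omega>) (outward_normal \<Omega>)"
  unfolding continuous_on_eq_continuous_within
proof
  fix x assume x: "x \<in> frontier \<Omega>"
  obtain r R h where "boundary_chart_at \<Omega> x r R h" using ex_chart[OF x] .
  then interpret boundary_chart_at \<Omega> x r R h .
  have "continuous (at x within frontier \<Omega>) normal"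
    using normal_cont by (simp add: continuous_on_eq_continuous_at continuous_at_imp_continuous_at_within)
  then show "continuous (at x within frontier \<Omega>) (outward_normal \<Omega>)"
    by (rule continuous_transform_within[OF _ r_pos x]) (simp add: outward_normal_eq dist_commute)
qed

lemma compact_frontier: "compact (frontier \<Omega>)"
  using bounded_dom by (simp add: compact_frontier_bounded)

end

section \<open>Surface measure\<close>

text \<open>Finiteness of the integral makes the nonnegative function absolutely integrable on the
  image, so that the change of variables formula for absolutely integrable functions applies. The
  image is open by invariance of domain, hence Borel.\<close>

lemma nn_integral_change_of_variables:
  fixes f :: "(real, 'n::{finite,wellorder}) vec \<Rightarrow> real" and g :: "(real, 'n) vec \<Rightarrow> (real, 'n) vec"
  assumes S: "open S" and g: "\<And>x. x \<in> S \<Longrightarrow> (g has_derivative g' x) (at x)" and inj: "inj_on g S"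
    and f: "f \<in> borel_measurable borel" "\<And>x. 0 \<le> f x" and fin: "(\<integral>\<^sup>+x. ennreal (f x) * indicator (g ` S) x \<partial>lborel) < \<infinity>"
  shows "(\<integral>\<^sup>+x. ennreal (f x) * indicator (g ` S) x \<partial>lborel) = (\<integral>\<^sup>+x. ennreal (\<bar>det (matrix (g' x))\<bar> * f (g x)) * indicator S x \<partial>lborel)"
proof -
  have "continuous_on S g" using g by (meson continuous_at_imp_continuous_on has_derivative_continuous)
  then have o: "open (g ` S)" by (rule invariance_of_domain[OF _ S inj])
  then have gS: "g ` S \<in> sets borel" by simp
  have trans: "(\<integral>\<^sup>+x. ennreal (k x) * indicator A x \<partial>lborel) = ennreal (integral A k)"
    if k: "\<And>x. 0 \<le> k x" "set_integrable lebesgue A k" for k :: "(real, 'n) vec \<Rightarrow> real" and A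
  proof -
    have "(\<integral>\<^sup>+x. ennreal (k x) * indicator A x \<partial>lborel) = (\<integral>\<^sup>+x. ennreal (indicator A x *\<^sub>R k x) \<partial>lebesgue)"
      unfolding nn_integral_completion by (intro nn_integral_cong) (simp add: indicator_def)
    also have "\<dots> = ennreal (LINT x:A|lebesgue. k x)"
      using k unfolding set_integrable_def set_lebesgue_integral_def
      by (intro nn_integral_eq_integral) (auto simp: indicator_def)
    finally show ?thesis using set_lebesgue_integral_eq_integral(2)[OF k(2)] by simp
  qed
  have "integrable lborel (\<lambda>x. indicator (g ` S) x *\<^sub>R f x)"
  proof (rule integrableI_nonneg)
    show "(\<integral>\<^sup>+x. ennreal (indicator (g ` S) x *\<^sub>R f x) \<partial>lborel) < \<infinity>"
      using fin by (rule le_less_trans[rotated]) (intro nn_integral_mono, simp add: indicator_def)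
  qed (use f gS in auto)
  then have fi: "set_integrable lebesgue (g ` S) f"
    unfolding set_integrable_def using f gS by (subst integrable_completion) auto
  have "(\<lambda>x. \<bar>det (matrix (g' x))\<bar> *\<^sub>R f (g x)) absolutely_integrable_on S \<and>
     integral S (\<lambda>x. \<bar>det (matrix (g' x))\<bar> *\<^sub>R f (g x)) = integral (g ` S) f"
  proof -
    have "(\<lambda>x. \<bar>det (matrix (g' x))\<bar> *\<^sub>R (vec (f (g x)) :: real^1)) absolutely_integrable_on S \<and>
       integral S (\<lambda>x. \<bar>det (matrix (g' x))\<bar> *\<^sub>R (vec (f (g x)) :: real^1)) = vec (integral (g ` S) f)"
      using S inj fi g
      by (intro has_absolute_integral_change_of_variables[of S g g' "\<lambda>x. vec (f x) :: real^1", THEN iffD2])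
         (auto intro: has_derivative_at_withinI simp: absolutely_integrable_on_1_iff integral_on_1_eq)
    then show ?thesis by (simp add: absolutely_integrable_on_1_iff integral_on_1_eq vec_eq_iff)
  qed
  then show ?thesis
    using trans[OF _ fi] trans[of "\<lambda>x. \<bar>det (matrix (g' x))\<bar> * f (g x)" S] f(2) by simp
qed

text \<open>An open set is a countable union of compact sets, and continuous images of compact sets
  are compact, hence closed.\<close>

lemma open_image_sets_borel:
  fixes X :: "'a::euclidean_space \<Rightarrow> 'b::euclidean_space"
  assumes "open U" "continuous_on U X"
  shows "X ` U \<in> sets borel"
proof -
  obtain K where K: "\<And>n::nat. compact (K n)" "(\<Union>n. K n) = U"
    using open_Union_compact_subsets[OF assms(1)] by metis
  have "compact (X ` K n)" for n
    using K assms(2) by (intro compact_continuous_image) (auto intro: continuous_on_subset)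
  then have "X ` K n \<in> sets borel" for n using compact_imp_closed by (auto intro: borel_closed)
  then have "(\<Union>n. X ` K n) \<in> sets borel" by auto
  then show ?thesis using K(2) by (metis image_UN)
qed

lemma patch_continuous: "surface_patch S U X \<Longrightarrow> continuous_on U X"
  unfolding surface_patch_def using differentiable_imp_continuous_on by blast

lemma patch_measurable:
  assumes X: "surface_patch S U X" and B: "B \<in> sets borel"
  shows "(\<lambda>s. ennreal (norm (cross3 (dirderiv X (axis 1 1) s) (dirderiv X (axis 2 1) s))) * indicator B (X s) * indicator U s) \<in> borel_measurable borel"
proof -
  have U: "open U" and cX: "continuous_on U X" and cD: "\<And>b. b \<in> Basis \<Longrightarrow> continuous_on U (dirderiv X b)"
    using X patch_continuous[OF X] unfolding surface_patch_def by blast+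
  have cn: "continuous_on U (\<lambda>s. norm (cross3 (dirderiv X (axis 1 1) s) (dirderiv X (axis 2 1) s)))"
    by (intro continuous_on_norm continuous_on_cross cD) (auto simp: axis_in_Basis_iff)
  \<comment> \<open>Continuity is known only on \<open>U\<close>, so outside \<open>U\<close> the
    functions are replaced by 0 before measurability is checked; the product with the indicator of
    \<open>U\<close> does not see the change.\<close>
  have m1: "(\<lambda>s. if s \<in> U then norm (cross3 (dirderiv X (axis 1 1) s) (dirderiv X (axis 2 1) s)) else 0) \<in> borel_measurable borel"
    using U cn by (intro borel_measurable_continuous_on_if continuous_on_const) auto
  have m2: "(\<lambda>s. if s \<in> U then X s else 0) \<in> borel_measurable borel"
    using U cX by (intro borel_measurable_continuous_on_if continuous_on_const) auto
  have "(\<lambda>s. ennreal (if s \<in> U then norm (cross3 (dirderiv X (axis 1 1) s) (dirderiv X (axis 2 1) s)) else 0) * indicator B (if s \<in> U then X s else 0)) \<in> borel_measurable borel"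
    using m1 m2 B by measurable
  moreover have "(\<lambda>s. ennreal (if s \<in> U then norm (cross3 (dirderiv X (axis 1 1) s) (dirderiv X (axis 2 1) s)) else 0) * indicator B (if s \<in> U then X s else 0)) =
    (\<lambda>s. ennreal (norm (cross3 (dirderiv X (axis 1 1) s) (dirderiv X (axis 2 1) s))) * indicator B (X s) * indicator U s)"
    by (auto simp: indicator_def)
  ultimately show ?thesis by simp
qed

lemma cross3_linear_combination:
  "cross3 (a *\<^sub>R v + b *\<^sub>R w) (c *\<^sub>R v + d *\<^sub>R w) = (a * d - b * c) *\<^sub>R cross3 v w"
  by (simp add: cross3_simps)

context boundary_chart_at begin

text \<open>The candidate for the restriction of the surface measure to the ball \<open>D\<close>;
  \<open>density_\<sigma>_eq\<close> later identifies the two.\<close>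

definition chart_measure :: "(real^3) measure" where
  "chart_measure = distr (density lborel (\<lambda>s. ennreal (J s) * indicator V s)) borel Y"

lemma sets_chart_measure [simp]: "sets chart_measure = sets borel"
  by (simp add: chart_measure_def)

lemma Y_measurable [measurable]: "Y \<in> borel_measurable borel"
  using Y_cont by (rule borel_measurable_continuous_onI)

lemma J_measurable [measurable]: "J \<in> borel_measurable borel"
  using J_cont by (rule borel_measurable_continuous_onI)

lemma V_measurable [measurable]: "V \<in> sets borel"
  using V_open by simp

lemma emeasure_chart_measure:
  assumes [measurable]: "B \<in> sets borel"
  shows "emeasure chart_measure B = (\<integral>\<^sup>+s. ennreal (J s) * indicator V s * indicator B (Y s) \<partial>lborel)"
proof -
  have "emeasure chart_measure B = emeasure (density lborel (\<lambda>s. ennreal (J s) * indicator V s)) (Y -` B)"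
    unfolding chart_measure_def by (subst emeasure_distr) auto
  also have "\<dots> = (\<integral>\<^sup>+s. ennreal (J s) * indicator V s * indicator (Y -` B) s \<partial>lborel)"
    by (rule emeasure_density) (use measurable_sets_borel[OF Y_measurable assms] in auto)
  finally show ?thesis by (simp add: indicator_vimage)
qed

lemma chart_measure_finite: "emeasure chart_measure UNIV < \<infinity>"
proof -
  have "compact (J ` closure V)"
    using V_bounded J_cont by (intro compact_continuous_image) (auto intro: continuous_on_subset)
  then obtain b where b: "\<And>s. s \<in> closure V \<Longrightarrow> J s \<le> b"
    using compact_imp_bounded bounded_real by (metis abs_le_D1 image_eqI)
  have "emeasure chart_measure UNIV \<le> (\<integral>\<^sup>+s. ennreal b * indicator V s \<partial>lborel)"
    by (subst emeasure_chart_measure, simp, intro nn_integral_mono)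
       (use b closure_subset[of V] in \<open>auto simp: indicator_def intro!: ennreal_leI\<close>)
  also have "\<dots> = ennreal b * emeasure lborel V" by (simp add: nn_integral_cmult_indicator)
  also have "\<dots> < \<infinity>" using emeasure_bounded_finite[OF V_bounded] by (simp add: ennreal_mult_less_top)
  finally show ?thesis .
qed

text \<open>The chart being a graph, the transition map \<open>\<tau> = P \<circ> X\<close> is a projection of the patch, hence
  visibly differentiable; no inverse function theorem is needed.\<close>

lemma chart_measure_patch:
  assumes X: "surface_patch (frontier \<Omega>) U X" and B: "B \<in> sets borel"
  shows "emeasure chart_measure (B \<inter> X ` U) =
    (\<integral>\<^sup>+ s. ennreal (norm (cross3 (dirderiv X (axis 1 1) s) (dirderiv X (axis 2 1) s))) * indicator (B \<inter> D) (X s) * indicator U s \<partial>lborel)"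
proof -
  have U: "open U" and cX: "continuous_on U X" and XS: "X ` U \<subseteq> frontier \<Omega>" and inj: "inj_on X U" and dX: "X differentiable_on U"
    using X patch_continuous[OF X] unfolding surface_patch_def by blast+
  define U' where "U' = U \<inter> X -` D"
  have U': "open U'" unfolding U'_def by (rule continuous_open_preimage[OF cX U open_ball])
  define \<tau> where "\<tau> s = P (X s)" for s
  have Y\<tau>: "Y (\<tau> s) = X s" if "s \<in> U'" for s
  proof -
    have "X s \<in> frontier \<Omega>" "X s \<in> D" using that XS by (auto simp: U'_def)
    then show ?thesis unfolding \<tau>_def using frontier_iff Y_P by blast
  qed
  have X': "(X has_derivative (\<lambda>k. dirderiv X k s)) (at s)" if "s \<in> U" for s
  proof -
    have "X differentiable (at s)" using dX that U by (simp add: differentiable_on_eq_differentiable_at)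
    then show ?thesis unfolding dirderiv_def by (simp add: frechet_derivative_works[symmetric])
  qed
  define \<tau>' where "\<tau>' s k = P (dirderiv X k s)" for s k
  have \<tau>': "(\<tau> has_derivative \<tau>' s) (at s)" if "s \<in> U" for s
    unfolding \<tau>_def[abs_def] \<tau>'_def
    by (rule has_derivative_compose[OF X'[OF that] bounded_linear_imp_has_derivative[OF P_lin]])
  have inj\<tau>: "inj_on \<tau> U'"
  proof (rule inj_onI)
    fix s t assume "s \<in> U'" "t \<in> U'" "\<tau> s = \<tau> t"
    then have "X s = X t" using Y\<tau> by metis
    then show "s = t" using inj \<open>s \<in> U'\<close> \<open>t \<in> U'\<close> by (auto simp: U'_def inj_on_def)
  qed
  have img: "\<tau> ` U' = {t \<in> V. Y t \<in> X ` U}"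
  proof (intro subset_antisym subsetI)
    fix t assume "t \<in> \<tau> ` U'"
    then obtain s where s: "s \<in> U'" "t = \<tau> s" by blast
    then show "t \<in> {t \<in> V. Y t \<in> X ` U}" using Y\<tau>[OF s(1)] by (auto simp: V_def U'_def)
  next
    fix t assume t: "t \<in> {t \<in> V. Y t \<in> X ` U}"
    then obtain s where s: "s \<in> U" "Y t = X s" by auto
    moreover have "X s \<in> D" using t s by (auto simp: V_def)
    moreover have "\<tau> s = t" using s by (metis P_Y \<tau>_def)
    ultimately show "t \<in> \<tau> ` U'" by (auto simp: U'_def)
  qed
  \<comment> \<open>On \<open>U'\<close> the patch factors as \<open>Y\<close> after
    \<open>\<tau>\<close>. By the chain rule its tangent vectors are linear combinations of those of
    \<open>Y\<close>, and the cross product turns the coefficient matrix into its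
    determinant.\<close>
  have jac: "\<bar>det (matrix (\<tau>' s))\<bar> * J (\<tau> s) = norm (cross3 (dirderiv X (axis 1 1) s) (dirderiv X (axis 2 1) s))" if s: "s \<in> U'" for s
  proof -
    have sU: "s \<in> U" using s by (simp add: U'_def)
    have "((\<lambda>s. Y (\<tau> s)) has_derivative (\<lambda>k. dirderiv Y (\<tau>' s k) (\<tau> s))) (at s)"
      using has_derivative_compose[OF \<tau>'[OF sU] Y_deriv] by (simp add: dirderiv_Y)
    then have "(X has_derivative (\<lambda>k. dirderiv Y (\<tau>' s k) (\<tau> s))) (at s)"
      by (rule has_derivative_transform_within_open[OF _ U' s]) (simp add: Y\<tau>)
    then have DX: "dirderiv X k s = dirderiv Y (\<tau>' s k) (\<tau> s)" for k by (rule dirderiv_eqI)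
    have lY: "dirderiv Y k t = k$1 *\<^sub>R dirderiv Y (axis 1 1) t + k$2 *\<^sub>R dirderiv Y (axis 2 1) t" for k t
    proof -
      interpret linear "\<lambda>k. dirderiv Y k t"
        unfolding dirderiv_Y using has_derivative_linear[OF Y_deriv] .
      have "k = k$1 *\<^sub>R axis 1 1 + k$2 *\<^sub>R axis 2 1" by (auto simp: vec_eq_iff forall_2 axis_def)
      then have "dirderiv Y k t = dirderiv Y (k$1 *\<^sub>R axis 1 1 + k$2 *\<^sub>R axis 2 1) t" by (rule arg_cong)
      then show ?thesis by (simp only: add scale)
    qed
    let ?a = "\<tau>' s (axis 1 1)" and ?b = "\<tau>' s (axis 2 1)"
    have "cross3 (dirderiv X (axis 1 1) s) (dirderiv X (axis 2 1) s) = (?a$1 * ?b$2 - ?a$2 * ?b$1) *\<^sub>R cross3 (dirderiv Y (axis 1 1) (\<tau> s)) (dirderiv Y (axis 2 1) (\<tau> s))"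
      unfolding DX by (subst lY, subst (2) lY, subst cross3_linear_combination) simp
    moreover have "det (matrix (\<tau>' s)) = ?a$1 * ?b$2 - ?a$2 * ?b$1"
      by (simp add: det_2 matrix_def mult.commute)
    ultimately show ?thesis by (simp add: norm_cross_Y)
  qed
  have XU: "X ` U \<in> sets borel" by (rule open_image_sets_borel[OF U cX])
  then have BXU: "B \<inter> X ` U \<in> sets borel" using B by simp
  define f where "f t = J t * indicator B (Y t) * indicator V t" for t
  have J0: "0 \<le> J t" for t using area_density_ge_1[of h t] by linarith
  have f: "f \<in> borel_measurable borel" "\<And>t. 0 \<le> f t"
    unfolding f_def using B J0 by (measurable, auto)
  have e1: "emeasure chart_measure (B \<inter> X ` U) = (\<integral>\<^sup>+t. ennreal (f t) * indicator (\<tau> ` U') t \<partial>lborel)"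
    unfolding emeasure_chart_measure[OF BXU] img by (intro nn_integral_cong) (auto simp: f_def indicator_def)
  have "emeasure chart_measure (B \<inter> X ` U) \<le> emeasure chart_measure UNIV"
    by (intro emeasure_mono) (auto simp: chart_measure_def)
  \<comment> \<open>Finiteness of the chart measure supplies the integrability hypothesis of the
    change of variables.\<close>
  then have fin: "(\<integral>\<^sup>+t. ennreal (f t) * indicator (\<tau> ` U') t \<partial>lborel) < \<infinity>"
    using chart_measure_finite unfolding e1 by (rule le_less_trans)
  have "\<And>s. s \<in> U' \<Longrightarrow> (\<tau> has_derivative \<tau>' s) (at s)" using \<tau>' by (simp add: U'_def)
  from nn_integral_change_of_variables[OF U' this inj\<tau> f fin]
  have "emeasure chart_measure (B \<inter> X ` U) = (\<integral>\<^sup>+s. ennreal (\<bar>det (matrix (\<tau>' s))\<bar> * f (\<tau> s)) * indicator U' s \<partial>lborel)"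
    using e1 by simp
  also have "\<dots> = (\<integral>\<^sup>+ s. ennreal (norm (cross3 (dirderiv X (axis 1 1) s) (dirderiv X (axis 2 1) s))) * indicator (B \<inter> D) (X s) * indicator U s \<partial>lborel)"
  proof (intro nn_integral_cong)
    fix s
    show "ennreal (\<bar>det (matrix (\<tau>' s))\<bar> * f (\<tau> s)) * indicator U' s = ennreal (norm (cross3 (dirderiv X (axis 1 1) s) (dirderiv X (axis 2 1) s))) * indicator (B \<inter> D) (X s) * indicator U s"
    proof (cases "s \<in> U'")
      case True
      then have "\<tau> s \<in> V" "X s \<in> D" "s \<in> U" using Y\<tau>[OF True] by (auto simp: V_def U'_def)
      then have "\<bar>det (matrix (\<tau>' s))\<bar> * f (\<tau> s) = norm (cross3 (dirderiv X (axis 1 1) s) (dirderiv X (axis 2 1) s)) * indicator B (X s)"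
        unfolding jac[OF True, symmetric] f_def Y\<tau>[OF True] by simp
      then show ?thesis using True \<open>X s \<in> D\<close> \<open>s \<in> U\<close> by (simp add: ennreal_mult' indicator_def)
    next
      case False
      then show ?thesis by (auto simp: U'_def indicator_def)
    qed
  qed
  finally show ?thesis .
qed

end

section \<open>Existence, uniqueness and finiteness of the surface measure\<close>

context C2_domain begin

abbreviation S where "S \<equiv> frontier \<Omega>"

lemma S_borel [measurable]: "S \<in> sets borel"
  by (simp add: borel_closed)

text \<open>Compactness of the boundary. The charts are numbered by an initial segment of the
  naturals because disjoint pieces of the surface are cut out by removing the balls of smaller
  index.\<close>

lemma ex_atlas:
  "\<exists>(N::nat) c r R h. (\<forall>i<N. boundary_chart_at \<Omega> (c i) (r i) (R i) (h i)) \<and> S \<subseteq> (\<Union>i<N. ball (c i) (r i))"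
proof -
  have "\<forall>x\<in>S. \<exists>k. boundary_chart_at \<Omega> x (fst k) (fst (snd k)) (snd (snd k))"
  proof
    fix x assume "x \<in> S"
    then obtain r R h where "boundary_chart_at \<Omega> x r R h" by (rule ex_chart)
    then show "\<exists>k. boundary_chart_at \<Omega> x (fst k) (fst (snd k)) (snd (snd k))"
      by (intro exI[of _ "(r, R, h)"]) simp
  qed
  from bchoice[OF this] obtain k where k: "\<And>x. x \<in> S \<Longrightarrow> boundary_chart_at \<Omega> x (fst (k x)) (fst (snd (k x))) (snd (snd (k x)))"
    by blast
  have "S \<subseteq> (\<Union>x\<in>S. ball x (fst (k x)))" using boundary_chart_at.r_pos[OF k] by force
  then obtain C where C: "C \<subseteq> S" "finite C" "S \<subseteq> (\<Union>x\<in>C. ball x (fst (k x)))"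
    by (rule compactE_image[OF compact_frontier, of S "\<lambda>x. ball x (fst (k x))", OF open_ball]) blast
  obtain c where c: "bij_betw c {..<card C} C" using ex_bij_betw_nat_finite[OF C(2)] unfolding atLeast0LessThan by blast
  have cC: "c ` {..<card C} = C" using c by (simp add: bij_betw_def)
  have 1: "boundary_chart_at \<Omega> (c i) (fst (k (c i))) (fst (snd (k (c i)))) (snd (snd (k (c i))))" if "i < card C" for i
  proof -
    have "c i \<in> C" using bij_betw_apply[OF c] that by simp
    then show ?thesis using k C(1) by blast
  qed
  have 2: "S \<subseteq> (\<Union>i<card C. ball (c i) (fst (k (c i))))"
  proof
    fix x assume "x \<in> S"
    then obtain y where "y \<in> C" "x \<in> ball y (fst (k y))" using C(3) by blast
    moreover from this obtain i where "i < card C" "y = c i" using c unfolding bij_betw_def by blast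
    ultimately show "x \<in> (\<Union>i<card C. ball (c i) (fst (k (c i))))" by blast
  qed
  show ?thesis
    by (rule exI[of _ "card C"], rule exI[of _ c], rule exI[of _ "\<lambda>i. fst (k (c i))"],
        rule exI[of _ "\<lambda>i. fst (snd (k (c i)))"], rule exI[of _ "\<lambda>i. snd (snd (k (c i)))"])
       (intro conjI allI impI 1 2)
qed

text \<open>Existence and uniqueness come from one formula \<open>m\<close>, the sum of the chart
  measures over the disjoint pieces \<open>A i\<close>. It defines a surface measure since each
  chart measure has the right value on every patch inside its ball, and it is forced since the graph
  map \<open>Y\<close> of each chart is itself a patch. Finiteness is read off the same formula,
  hence the joint statement.\<close>

lemma ex1_surface_measure: "\<exists>!\<sigma>. is_surface_measure S \<sigma>" and surface_measure_finite': "is_surface_measure S \<sigma> \<Longrightarrow> emeasure \<sigma> UNIV < \<infinity>"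
proof -
  obtain N :: nat and c r R h where ch: "\<And>i. i < N \<Longrightarrow> boundary_chart_at \<Omega> (c i) (r i) (R i) (h i)" and cov: "S \<subseteq> (\<Union>i<N. ball (c i) (r i))"
    using ex_atlas by blast
  define A where "A i = ball (c i) (r i) - (\<Union>j<i. ball (c j) (r j))" for i
  define \<mu> where "\<mu> i = boundary_chart_at.chart_measure (c i) (r i) (R i) (h i)" for i
  have A [measurable]: "A i \<in> sets borel" for i unfolding A_def by auto
  \<comment> \<open>A boundary point lies in exactly one piece, that of the ball of least index
    containing it.\<close>
  have A1: "(\<Sum>i<N. indicator (A i) x :: ennreal) = 1" if "x \<in> S" for x
  proof -
    define i where "i = (LEAST i. x \<in> ball (c i) (r i))"
    obtain i0 where i0: "i0 < N" "x \<in> ball (c i0) (r i0)" using cov \<open>x \<in> S\<close> by blast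
    then have i: "x \<in> ball (c i) (r i)" "i \<le> i0" unfolding i_def by (auto intro: LeastI Least_le)
    have "x \<in> A j \<longleftrightarrow> j = i" for j
    proof
      assume "x \<in> A j"
      then have "x \<in> ball (c j) (r j)" "\<not> i < j" using i(1) by (auto simp: A_def)
      then show "j = i" using Least_le[of "\<lambda>i. x \<in> ball (c i) (r i)" j] by (simp add: i_def)
    next
      assume "j = i"
      moreover have "x \<notin> ball (c l) (r l)" if "l < i" for l
        using not_less_Least[of l "\<lambda>i. x \<in> ball (c i) (r i)"] that by (simp add: i_def)
      ultimately show "x \<in> A j" using i(1) by (auto simp: A_def)
    qed
    then have "(\<Sum>i<N. indicator (A i) x :: ennreal) = (\<Sum>j<N. if j = i then 1 else 0)"
      by (intro sum.cong) (auto simp: indicator_def)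
    then show ?thesis using i i0 by simp
  qed
  have AD: "A i \<subseteq> ball (c i) (r i)" for i by (auto simp: A_def)
  have disj: "A i \<inter> A j = {}" if "i \<noteq> j" for i j
    using that by (auto simp: A_def elim: linorder_neqE_nat)
  have s\<mu>: "sets (\<mu> i) = sets borel" if "i < N" for i
    unfolding \<mu>_def by (rule boundary_chart_at.sets_chart_measure[OF ch[OF that]])
  define m where "m B = (\<Sum>i<N. emeasure (\<mu> i) (B \<inter> A i))" for B
  define \<sigma>0 where "\<sigma>0 = measure_of UNIV (sets borel) m"
  have ca: "countably_additive (sets borel) m"
    unfolding countably_additive_def
  proof (intro allI impI)
    fix B :: "nat \<Rightarrow> (real^3) set" assume B: "range B \<subseteq> sets borel" "disjoint_family B"
    have "(\<Sum>n. m (B n)) = (\<Sum>i<N. \<Sum>n. emeasure (\<mu> i) (B n \<inter> A i))"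
      unfolding m_def by (rule suminf_sum) auto
    also have "\<dots> = (\<Sum>i<N. emeasure (\<mu> i) (\<Union>n. B n \<inter> A i))"
    proof (intro sum.cong refl suminf_emeasure)
      fix i assume "i \<in> {..<N}"
      then show "range (\<lambda>n. B n \<inter> A i) \<subseteq> sets (\<mu> i)" using s\<mu>[of i] B(1) A by auto
      show "disjoint_family (\<lambda>n. B n \<inter> A i)" using B(2) by (auto simp: disjoint_family_on_def)
    qed
    also have "\<dots> = m (\<Union> (range B))" unfolding m_def by (intro sum.cong refl arg_cong2[of _ _ _ _ emeasure]) auto
    finally show "(\<Sum>n. m (B n)) = m (\<Union> (range B))" .
  qed
  have em0: "emeasure \<sigma>0 B = m B" if "B \<in> sets borel" for B
    unfolding \<sigma>0_def
    by (rule emeasure_measure_of_sigma[OF _ _ ca that])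
       (use sets.sigma_algebra_axioms[of "borel :: (real^3) measure"] in \<open>auto simp: positive_def m_def\<close>)
  have s0: "sets \<sigma>0 = sets borel" unfolding \<sigma>0_def using sets.space_closed[of borel]
    by (subst sets_measure_of) (auto simp: sets.sigma_sets_eq[of borel, simplified])
  have ex: "is_surface_measure S \<sigma>0"
    unfolding is_surface_measure_def
  proof (intro conjI allI impI s0)
    have "emeasure (\<mu> i) (- S \<inter> A i) = 0" if i: "i < N" for i
    proof -
      interpret boundary_chart_at \<Omega> "c i" "r i" "R i" "h i" by (rule ch[OF i])
      have [measurable]: "- S \<inter> A i \<in> sets borel" by measurable
      have "Y s \<in> S" if "s \<in> V" for s using Y_image that by blast
      then show ?thesis unfolding \<mu>_def by (subst emeasure_chart_measure) (auto simp: nn_integral_0_iff_AE indicator_def)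
    qed
    then show "emeasure \<sigma>0 (- S) = 0" by (simp add: em0 m_def)
    fix U X and B :: "(real^3) set" assume X: "surface_patch S U X" and B: "B \<in> sets borel"
    let ?n = "\<lambda>s. ennreal (norm (cross3 (dirderiv X (axis 1 1) s) (dirderiv X (axis 2 1) s)))"
    have XU: "X ` U \<in> sets borel" using X patch_continuous[OF X]
      by (intro open_image_sets_borel) (auto simp: surface_patch_def)
    have XS: "X s \<in> S" if "s \<in> U" for s using X that by (auto simp: surface_patch_def)
    have "emeasure \<sigma>0 (B \<inter> X ` U) = (\<Sum>i<N. emeasure (\<mu> i) ((B \<inter> A i) \<inter> X ` U))"
      using B XU by (subst em0) (auto simp: m_def Int_ac)
    also have "\<dots> = (\<Sum>i<N. (\<integral>\<^sup>+ s. ?n s * indicator (B \<inter> A i) (X s) * indicator U s \<partial>lborel))"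
    proof (intro sum.cong refl)
      fix i assume "i \<in> {..<N}"
      then interpret boundary_chart_at \<Omega> "c i" "r i" "R i" "h i" using ch by simp
      have "B \<inter> A i \<inter> ball (c i) (r i) = B \<inter> A i" using AD[of i] by blast
      then show "emeasure (\<mu> i) ((B \<inter> A i) \<inter> X ` U) = (\<integral>\<^sup>+ s. ?n s * indicator (B \<inter> A i) (X s) * indicator U s \<partial>lborel)"
        unfolding \<mu>_def using B chart_measure_patch[OF X, of "B \<inter> A i"] by simp
    qed
    also have "\<dots> = (\<integral>\<^sup>+ s. (\<Sum>i<N. ?n s * indicator (B \<inter> A i) (X s) * indicator U s) \<partial>lborel)"
      by (rule nn_integral_sum[symmetric]) (use patch_measurable[OF X] B in auto)
    also have "\<dots> = (\<integral>\<^sup>+ s. ?n s * indicator B (X s) * indicator U s \<partial>lborel)"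
    proof (intro nn_integral_cong)
      fix s
      have "(\<Sum>i<N. ?n s * indicator (B \<inter> A i) (X s) * indicator U s) = (?n s * indicator B (X s) * indicator U s) * (\<Sum>i<N. indicator (A i) (X s))"
        unfolding sum_distrib_left by (intro sum.cong) (auto simp: indicator_def)
      then show "(\<Sum>i<N. ?n s * indicator (B \<inter> A i) (X s) * indicator U s) = ?n s * indicator B (X s) * indicator U s"
        using A1[OF XS] by (cases "s \<in> U") auto
    qed
    finally show "emeasure \<sigma>0 (B \<inter> X ` U) = (\<integral>\<^sup>+ s. ?n s * indicator B (X s) * indicator U s \<partial>lborel)" .
  qed
  \<comment> \<open>An arbitrary surface measure is evaluated piece by piece: the part of
    \<open>B\<close> off the surface is null, and on \<open>A i\<close> the defining property for
    the patch \<open>Y\<close> leaves no freedom.\<close>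
  have form: "emeasure \<sigma> B = m B" if sm: "is_surface_measure S \<sigma>" and B: "B \<in> sets borel" for \<sigma> B
  proof -
    have s: "sets \<sigma> = sets borel" "emeasure \<sigma> (- S) = 0" using sm by (auto simp: is_surface_measure_def)
    have "emeasure \<sigma> B = emeasure \<sigma> (B \<inter> S) + emeasure \<sigma> (B \<inter> - S)"
      using B s(1) by (subst plus_emeasure) (auto intro!: arg_cong[of _ _ "emeasure \<sigma>"])
    also have "emeasure \<sigma> (B \<inter> - S) = 0"
      using emeasure_mono[of "B \<inter> - S" "- S" \<sigma>] s by auto
    also have "B \<inter> S = (\<Union>i<N. B \<inter> S \<inter> A i)"
    proof -
      have "\<exists>i<N. x \<in> A i" if "x \<in> S" for x
      proof (rule ccontr)
        assume "\<not> (\<exists>i<N. x \<in> A i)"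
        then have "(\<Sum>i<N. indicator (A i) x :: ennreal) = 0" by (auto intro!: sum.neutral)
        then show False using A1[OF that] by simp
      qed
      then show ?thesis by blast
    qed
    also have "emeasure \<sigma> \<dots> = (\<Sum>i<N. emeasure \<sigma> (B \<inter> S \<inter> A i))"
      by (rule sum_emeasure[symmetric]) (use B s(1) disj in \<open>auto simp: disjoint_family_on_def\<close>)
    also have "\<dots> = m B"
      unfolding m_def
    proof (intro sum.cong refl)
      fix i assume "i \<in> {..<N}"
      then interpret boundary_chart_at \<Omega> "c i" "r i" "R i" "h i" using ch by simp
      have eq: "B \<inter> S \<inter> A i = (B \<inter> A i) \<inter> Y ` V" using Y_image AD[of i] by blast
      have "emeasure \<sigma> (B \<inter> S \<inter> A i) = (\<integral>\<^sup>+ s. ennreal (norm (cross3 (dirderiv Y (axis 1 1) s) (dirderiv Y (axis 2 1) s))) * indicator (B \<inter> A i) (Y s) * indicator V s \<partial>lborel)"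
      proof -
        have "B \<inter> A i \<in> sets borel" using B A by simp
        then show ?thesis using sm patch_Y unfolding eq is_surface_measure_def by blast
      qed
      also have "\<dots> = emeasure (\<mu> i) (B \<inter> A i)"
        unfolding \<mu>_def using B by (subst emeasure_chart_measure) (auto intro!: nn_integral_cong simp: norm_cross_Y indicator_def)
      finally show "emeasure \<sigma> (B \<inter> S \<inter> A i) = emeasure (\<mu> i) (B \<inter> A i)" .
    qed
    finally show ?thesis by simp
  qed
  show "\<exists>!\<sigma>. is_surface_measure S \<sigma>"
  proof (rule ex1I[of _ \<sigma>0], rule ex)
    fix \<sigma> assume s: "is_surface_measure S \<sigma>"
    show "\<sigma> = \<sigma>0"
      by (rule measure_eqI) (use s s0 form[OF s] form[OF ex] in \<open>auto simp: is_surface_measure_def\<close>)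
  qed
  show "emeasure \<sigma> UNIV < \<infinity>" if s: "is_surface_measure S \<sigma>" for \<sigma>
  proof -
    have "emeasure (\<mu> i) (UNIV \<inter> A i) < \<infinity>" if "i < N" for i
    proof -
      interpret boundary_chart_at \<Omega> "c i" "r i" "R i" "h i" by (rule ch[OF that])
      have "emeasure (\<mu> i) (UNIV \<inter> A i) \<le> emeasure (\<mu> i) UNIV"
        by (rule emeasure_mono) (auto simp: \<mu>_def chart_measure_def)
      also have "\<dots> < \<infinity>" unfolding \<mu>_def by (rule chart_measure_finite)
      finally show ?thesis .
    qed
    then show ?thesis using form[OF s, of UNIV] by (simp add: m_def ennreal_sum_less_top)
  qed
qed

abbreviation \<sigma> where "\<sigma> \<equiv> surface_measure S"

lemma is_surface_measure_\<sigma>: "is_surface_measure S \<sigma>"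
  unfolding surface_measure_def by (rule theI'[OF ex1_surface_measure])

lemma sets_\<sigma> [simp, measurable_cong]: "sets \<sigma> = sets borel"
  using is_surface_measure_\<sigma> by (simp add: is_surface_measure_def)

lemma space_\<sigma> [simp]: "space \<sigma> = UNIV"
  using sets_eq_imp_space_eq[OF sets_\<sigma>] by simp

lemma measurable_\<sigma> [simp]: "measurable \<sigma> N = measurable borel N"
  by (rule measurable_cong_sets) auto

lemma finite_measure_\<sigma>: "finite_measure \<sigma>"
  using surface_measure_finite'[OF is_surface_measure_\<sigma>] by (intro finite_measureI) auto

lemma AE_\<sigma>_S: "AE x in \<sigma>. x \<in> S"
proof (rule AE_I[of _ _ "- S"])
  show "emeasure \<sigma> (- S) = 0" using is_surface_measure_\<sigma> by (simp add: is_surface_measure_def)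
qed auto

end

locale C2_domain_chart = C2_domain + boundary_chart_at
begin

lemma D_borel [measurable]: "D \<in> sets borel"
  by simp

text \<open>This is the defining property of the surface measure for the patch \<open>Y\<close>,
  whose image is the part of the boundary in \<open>D\<close>.\<close>

lemma density_\<sigma>_eq: "density \<sigma> (indicator D) = chart_measure"
proof (rule measure_eqI)
  fix B assume "B \<in> sets (density \<sigma> (indicator D))"
  then have B: "B \<in> sets borel" by simp
  have eq: "(B \<inter> D) \<inter> Y ` V = B \<inter> D \<inter> S" using Y_image by blast
  have "emeasure (density \<sigma> (indicator D)) B = (\<integral>\<^sup>+x. indicator D x * indicator B x \<partial>\<sigma>)"
    by (rule emeasure_density) (use D_borel B in \<open>auto intro: borel_measurable_indicator\<close>)
  also have "\<dots> = (\<integral>\<^sup>+x. indicator (B \<inter> D) x \<partial>\<sigma>)"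
    by (intro nn_integral_cong) (auto simp: indicator_def)
  also have "\<dots> = emeasure \<sigma> (B \<inter> D)" using B by (intro nn_integral_indicator) auto
  also have "\<dots> = emeasure \<sigma> (B \<inter> D \<inter> S)"
    by (rule emeasure_eq_AE) (use AE_\<sigma>_S B in \<open>auto elim!: eventually_mono\<close>)
  also have "\<dots> = (\<integral>\<^sup>+ s. ennreal (norm (cross3 (dirderiv Y (axis 1 1) s) (dirderiv Y (axis 2 1) s))) * indicator (B \<inter> D) (Y s) * indicator V s \<partial>lborel)"
  proof -
    have "B \<inter> D \<in> sets borel" using B D_borel by simp
    then show ?thesis
      using is_surface_measure_\<sigma> patch_Y unfolding is_surface_measure_def eq[symmetric] by blast
  qed
  also have "\<dots> = emeasure chart_measure B"
    unfolding emeasure_chart_measure[OF B] by (intro nn_integral_cong) (auto simp: norm_cross_Y indicator_def V_def)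
  finally show "emeasure (density \<sigma> (indicator D)) B = emeasure chart_measure B" .
qed simp

lemma surface_integral_chart:
  fixes F :: "real^3 \<Rightarrow> real"
  assumes F [measurable]: "F \<in> borel_measurable borel" and 0: "\<And>y. y \<notin> D \<Longrightarrow> F y = 0"
  shows "integral\<^sup>L \<sigma> F = integral\<^sup>L lborel (\<lambda>s. J s * indicator V s * F (Y s))"
proof -
  have J0: "0 \<le> J t" for t using area_density_ge_1[of h t] by linarith
  have d1: "density \<sigma> (indicator D) = density \<sigma> (\<lambda>x. ennreal (indicator D x))"
    by (intro arg_cong[of _ _ "density \<sigma>"]) (auto simp: indicator_def)
  have "integral\<^sup>L \<sigma> F = integral\<^sup>L \<sigma> (\<lambda>x. indicator D x *\<^sub>R F x)"
    using 0 by (intro Bochner_Integration.integral_cong) (auto simp: indicator_def)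
  also have "\<dots> = integral\<^sup>L (density \<sigma> (indicator D)) F"
    unfolding d1 using D_borel by (intro integral_density[symmetric]) (auto intro: borel_measurable_indicator)
  also have "\<dots> = integral\<^sup>L (density lborel (\<lambda>s. ennreal (J s) * indicator V s)) (\<lambda>s. F (Y s))"
    unfolding density_\<sigma>_eq chart_measure_def by (rule integral_distr) auto
  also have "density lborel (\<lambda>s. ennreal (J s) * indicator V s) = density lborel (\<lambda>s. ennreal (J s * indicator V s))"
    using J0 by (intro arg_cong[of _ _ "density lborel"]) (auto simp: indicator_def)
  also have "integral\<^sup>L \<dots> (\<lambda>s. F (Y s)) = integral\<^sup>L lborel (\<lambda>s. (J s * indicator V s) *\<^sub>R F (Y s))"
    by (rule integral_density) (use J0 in auto)
  finally show ?thesis by simp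
qed

end

section \<open>The divergence theorem and the trace inequality\<close>

lemma prod_Basis_vec:
  fixes f :: "real^'n \<Rightarrow> 'a::comm_monoid_mult"
  shows "(\<Prod>b\<in>Basis. f b) = (\<Prod>i\<in>UNIV. f (axis i (1::real)))"
proof -
  have B: "(Basis :: (real^'n) set) = range (\<lambda>i. axis i 1)" by (auto simp: Basis_vec_def)
  have "inj (\<lambda>i::'n. axis i (1::real))" by (auto simp: inj_on_def axis_eq_axis)
  from prod.reindex[OF this, of f] show ?thesis unfolding B by (simp add: comp_def)
qed

text \<open>Lebesgue measure is characterised by its values on boxes, and the preimage of a box in
  space is a box in the plane times an interval.\<close>

lemma distr_lift: "distr lborel borel (\<lambda>(s, t). lift s t) = lborel"
proof (rule lborel_eqI[symmetric])
  fix l u :: "real^3" assume le: "\<And>b. b \<in> Basis \<Longrightarrow> l \<bullet> b \<le> u \<bullet> b"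
  have le': "l$i \<le> u$i" for i using le[of "axis i 1"] by (simp add: axis_in_Basis_iff inner_axis)
  have m: "(\<lambda>(s, t). lift s t) \<in> borel_measurable lborel"
    using linear_continuous_on[OF bounded_linear_lift, of UNIV] by (simp add: borel_measurable_continuous_onI)
  let ?l = "vector [l$1, l$2] :: real^2" and ?u = "vector [u$1, u$2] :: real^2"
  have pre: "(\<lambda>(s, t). lift s t) -` box l u = box ?l ?u \<times> box (l$3) (u$3)"
    by (auto simp: mem_box_cart forall_3 forall_2 vector_2)
  have "emeasure (distr lborel borel (\<lambda>(s, t). lift s t)) (box l u) = emeasure (lborel \<Otimes>\<^sub>M lborel) (box ?l ?u \<times> box (l$3) (u$3))"
    using m by (subst emeasure_distr) (auto simp: pre lborel_prod)
  also have "\<dots> = emeasure lborel (box ?l ?u) * emeasure lborel (box (l$3) (u$3))"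
    by (rule sigma_finite_measure.emeasure_pair_measure_Times[OF sigma_finite_lborel]) auto
  also have "emeasure lborel (box ?l ?u) = ennreal (\<Prod>b\<in>Basis. (?u - ?l) \<bullet> b)"
    using le' by (intro emeasure_lborel_box) (auto simp: Basis_vec_def inner_axis vector_2 forall_2 UNIV_2)
  also have "(\<Prod>b\<in>Basis. (?u - ?l) \<bullet> b) = (u$1 - l$1) * (u$2 - l$2)"
    by (simp add: prod_Basis_vec UNIV_2 inner_axis vector_2)
  also have "emeasure lborel (box (l$3) (u$3)) = ennreal (u$3 - l$3)"
    using le' by (subst emeasure_lborel_box) auto
  also have "ennreal ((u$1 - l$1) * (u$2 - l$2)) * ennreal (u$3 - l$3) = ennreal ((u$1 - l$1) * (u$2 - l$2) * (u$3 - l$3))"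
    using le' by (intro ennreal_mult[symmetric]) auto
  also have "(u$1 - l$1) * (u$2 - l$2) * (u$3 - l$3) = (\<Prod>b\<in>Basis. (u - l) \<bullet> b)"
  proof -
    have "(1::3) \<noteq> 2" "(1::3) \<noteq> 3" "(2::3) \<noteq> 3" by simp_all
    then show ?thesis unfolding prod_Basis_vec UNIV_3 by (simp only: prod.insert finite.intros insert_iff empty_iff prod.empty inner_axis vector_minus_component) simp
  qed
  finally show "emeasure (distr lborel borel (\<lambda>(s, t). lift s t)) (box l u) = (\<Prod>b\<in>Basis. (u - l) \<bullet> b)" .
qed simp

lemma distr_orthogonal_transformation:
  fixes R :: "(real, 'n::{finite,wellorder}) vec \<Rightarrow> (real, 'n) vec"
  assumes "orthogonal_transformation R"
  shows "distr lborel borel R = lborel"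
proof (rule lborel_eqI[symmetric])
  fix l u :: "(real, 'n) vec" assume le: "\<And>b. b \<in> Basis \<Longrightarrow> l \<bullet> b \<le> u \<bullet> b"
  have oi: "orthogonal_transformation (inv R)" by (rule orthogonal_transformation_inv[OF assms])
  have bij: "bij R" by (rule orthogonal_transformation_bij[OF assms])
  have m: "R \<in> borel_measurable borel"
    using orthogonal_transformation_linear[OF assms] linear_conv_bounded_linear[of R] linear_continuous_on[of R UNIV]
    by (simp add: borel_measurable_continuous_onI)
  have pre: "R -` box l u = inv R ` box l u" using bij by (simp add: bij_vimage_eq_inv_image)
  have "emeasure (distr lborel borel R) (box l u) = emeasure lborel (inv R ` box l u)"
    using m by (subst emeasure_distr) (auto simp: pre)
  also have "\<dots> = emeasure lebesgue (inv R ` box l u)"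
    using measurable_sets_borel[OF m, of "box l u"] by (simp add: pre)
  also have "\<dots> = ennreal (measure lebesgue (inv R ` box l u))"
    using measurable_orthogonal_image[OF oi, of "box l u"] by (intro emeasure_eq_measure2) auto
  also have "measure lebesgue (inv R ` box l u) = measure lebesgue (box l u)"
    by (rule measure_orthogonal_image[OF oi]) auto
  also have "\<dots> = (\<Prod>b\<in>Basis. (u - l) \<bullet> b)" using le by (simp add: measure_lborel_box_eq)
  finally show "emeasure (distr lborel borel R) (box l u) = (\<Prod>b\<in>Basis. (u - l) \<bullet> b)" .
qed simp

text \<open>The polynomial \<open>monom 1 2\<close> is what \<open>exp_recip_has_derivative\<close>
  yields for the constant polynomial 1 that defines \<open>step\<close>.\<close>

definition step_deriv :: "real \<Rightarrow> real" where "step_deriv = exp_recip (monom 1 2)"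

lemma step_has_derivative: "(step has_real_derivative step_deriv t) (at t)"
  using exp_recip_has_derivative[of 1 t] by (simp add: step_def step_deriv_def)

lemma step_deriv_nonneg: "0 \<le> step_deriv t"
  by (simp add: step_deriv_def exp_recip_def poly_monom)

lemma step_deriv_measurable [measurable]: "step_deriv \<in> borel_measurable borel"
  unfolding step_deriv_def
  by (intro borel_measurable_continuous_onI DERIV_continuous_on) (rule exp_recip_has_derivative)

text \<open>\<open>step\<close> rises from 0 to 1, so its derivative is a probability density.
  Rescaled, it is the approximate identity in the height that produces the boundary term of the
  divergence theorem.\<close>

lemma step_deriv_integral: "has_bochner_integral lborel step_deriv 1"
proof -
  have "(step \<longlongrightarrow> 1) at_top"
  proof (rule Lim_transform_eventually)
    have "((\<lambda>t::real. exp (- inverse t)) \<longlongrightarrow> exp (- 0)) at_top"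
      by (intro tendsto_intros tendsto_inverse_0_at_top filterlim_ident)
    then show "((\<lambda>t::real. exp (- inverse t)) \<longlongrightarrow> 1) at_top" by simp
    show "eventually (\<lambda>t. exp (- inverse t) = step t) at_top"
      using eventually_gt_at_top[of 0] by eventually_elim (simp add: step_eq inverse_eq_divide)
  qed
  then have "(\<integral>\<^sup>+x. ennreal (step_deriv x) * indicator {0..} x \<partial>lborel) = ennreal (1 - step 0)"
    by (intro nn_integral_FTC_atLeast step_has_derivative step_deriv_nonneg) auto
  also have "(\<lambda>x. ennreal (step_deriv x) * indicator {0..} x) = (\<lambda>x. ennreal (step_deriv x))"
    by (auto simp: indicator_def step_deriv_def exp_recip_def)
  finally have "(\<integral>\<^sup>+x. ennreal (step_deriv x) \<partial>lborel) = ennreal 1" by (simp add: step_eq)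
  then show ?thesis
    by (intro has_bochner_integral_nn_integral) (auto simp: step_deriv_nonneg)
qed

context C2_domain begin

text \<open>\<open>outward_normal\<close> is an arbitrary value off the boundary; \<open>nu\<close> is a Borel function on all of \<open>\<real>\<^sup>3\<close>.\<close>

definition nu :: "real^3 \<Rightarrow> real^3" where
  "nu y = (if y \<in> S then outward_normal \<Omega> y else 0)"

lemma nu_measurable [measurable]: "nu \<in> borel_measurable borel"
  unfolding nu_def[abs_def] using S_borel outward_normal_continuous
  by (intro borel_measurable_continuous_on_if continuous_on_const)

lemma norm_nu: "norm (nu y) \<le> 1"
  using norm_outward_normal by (simp add: nu_def)

lemma continuous_L2_\<sigma>:
  assumes "continuous_on UNIV v" shows "v \<in> L2 \<sigma>"
proof -
  have "compact (v ` S)"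
    using assms compact_frontier by (intro compact_continuous_image) (auto intro: continuous_on_subset)
  then obtain B where B: "\<forall>y\<in>v ` S. \<bar>y\<bar> \<le> B" using compact_imp_bounded bounded_real by metis
  show ?thesis
  proof (rule L2_bounded[OF finite_measure_\<sigma>])
    show "v \<in> borel_measurable \<sigma>" using borel_measurable_continuous_onI[OF assms] by simp
    show "AE x in \<sigma>. \<bar>v x\<bar> \<le> B" using AE_\<sigma>_S by eventually_elim (use B in auto)
  qed
qed

end

context C2_domain_chart begin

lemma Ck_H: "Ck 1 H" and dirderiv_H: "dirderiv H w y = - (J (P y) * (normal y \<bullet> w))"
proof -
  have c: "continuous_on UNIV (\<lambda>y. f (P y))" if "continuous_on UNIV f" for f :: "_ \<Rightarrow> real"
    by (rule continuous_on_compose2[OF that linear_continuous_on[OF P_lin]]) auto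
  show "Ck 1 H"
    unfolding One_nat_def Ck_Suc_iff
    by (rule exI[of _ "\<lambda>y w. R w $ 3 - (R w $ 1 * p (P y) + R w $ 2 * q (P y))"])
       (auto intro!: H_deriv continuous_intros c pq_cont)
  show "dirderiv H w y = - (J (P y) * (normal y \<bullet> w))"
    using dirderiv_eqI[OF H_deriv, of w y] unfolding J_normal_inner by (simp add: mult.commute)
qed

lemma nu_eq: "y \<in> D \<Longrightarrow> y \<in> S \<Longrightarrow> nu y = normal y"
  using outward_normal_eq by (simp add: nu_def)

text \<open>The rotation preserves volume, and so does the vertical shift by \<open>h s\<close>. The
  additional scaling of the height by \<open>c\<close> blows up the boundary layer of thickness
  about \<open>1 / c\<close> to a fixed profile.\<close>

lemma integral_graph_coordinates:
  fixes g :: "real^3 \<Rightarrow> real"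
  assumes "integrable lborel g" and c: "c > 0"
  shows "integral\<^sup>L lborel g = (LINT s|lborel. LINT t|lborel. g (inv R (lift s (h s + t / c))) / c)"
proof -
  have gm[measurable]: "g \<in> borel_measurable borel" using assms by auto
  have invm[measurable]: "inv R \<in> borel_measurable borel"
    using linear_continuous_on[OF inv_lin(1), of UNIV] by (rule borel_measurable_continuous_onI)
  have lm: "(\<lambda>(s, t). lift s t) \<in> borel_measurable borel"
    using linear_continuous_on[OF bounded_linear_lift, of UNIV] by (rule borel_measurable_continuous_onI)
  have i1: "integrable lborel (\<lambda>y. g (inv R y))" "integral\<^sup>L lborel (\<lambda>y. g (inv R y)) = integral\<^sup>L lborel g"
    using assms(1) integrable_distr_eq[of "inv R" lborel borel g] integral_distr[of "inv R" lborel borel g]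
    unfolding distr_orthogonal_transformation[OF inv_orth] by auto
  let ?f = "\<lambda>z. g (inv R (case z of (s, t) \<Rightarrow> lift s t))"
  have gi: "(\<lambda>y. g (inv R y)) \<in> borel_measurable borel" by measurable
  have i2: "integrable lborel ?f" "integral\<^sup>L lborel ?f = integral\<^sup>L lborel g"
    using i1 integrable_distr_eq[of "\<lambda>(s, t). lift s t" lborel borel, OF _ gi] integral_distr[of "\<lambda>(s, t). lift s t" lborel borel, OF _ gi] lm
    unfolding distr_lift by auto
  have i3: "integrable (lborel \<Otimes>\<^sub>M lborel) ?f" using i2(1) by (simp add: lborel_prod)
  have "integral\<^sup>L lborel g = (LINT s|lborel. LINT t|lborel. ?f (s, t))"
    unfolding lborel_pair.integral_fst'[OF i3] using i2(2) by (simp add: lborel_prod)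
  also have "\<dots> = (LINT s|lborel. LINT t|lborel. g (inv R (lift s (h s + t / c))) / c)"
  proof (rule Bochner_Integration.integral_cong[OF refl])
    fix s
    show "(LINT t|lborel. ?f (s, t)) = (LINT t|lborel. g (inv R (lift s (h s + t / c))) / c)"
      using c lborel_integral_real_affine[of "1/c" "\<lambda>t. g (inv R (lift s t))" "h s"] by (simp add: field_simps)
  qed
  finally show ?thesis .
qed

text \<open>The integral of \<open>\<partial>\<^sub>w (F \<cdot> step (c H))\<close> over the whole space vanishes. As \<open>c \<rightarrow> \<infinity>\<close> the cutoff
  \<open>step (c H)\<close> tends to the indicator of \<open>\<Omega>\<close>, while \<open>c step' (c t) dt\<close> is an approximate identity
  in the height \<open>t\<close> over the graph and produces the boundary term.\<close>

lemma divergence_theorem_local: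
  assumes F: "Ck 1 F" and K: "compact K" "K \<subseteq> D" and F0: "\<And>y. y \<notin> K \<Longrightarrow> F y = 0"
  shows "(LINT y|LM. dirderiv F w y) = (LINT y|\<sigma>. F y * (nu y \<bullet> w))"
proof -
  have F': "Ck (Suc 0) F" using F by simp
  have cF: "continuous_on UNIV F" "continuous_on UNIV (dirderiv F w)"
    using Ck_continuous[OF F] Ck_Suc_continuous_dirderiv[OF F'] by auto
  have DF0: "dirderiv F w y = 0" if "y \<notin> K" for y
    by (rule dirderiv_eq_0_outside[OF compact_imp_closed[OF K(1)] F0 that])
  have bK: "bounded K" using K compact_imp_bounded by blast
  have iDF: "integrable lborel (dirderiv F w)" by (rule integrable_bounded_support[OF cF(2) bK DF0])
  define c where "c m = real (Suc m)" for m
  have c: "c m > 0" for m by (simp add: c_def)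
  \<comment> \<open>Up to sign, \<open>J (P y) * (normal y \<bullet> w)\<close> is the derivative of
    \<open>H\<close> in direction \<open>w\<close>; the factor \<open>J\<close> turns into the area
    element on the boundary.\<close>
  define G where "G y = F y * (J (P y) * (normal y \<bullet> w))" for y
  have cJP: "continuous_on UNIV (\<lambda>y. J (P y))"
    by (rule continuous_on_compose2[OF J_cont linear_continuous_on[OF P_lin]]) auto
  have cG: "continuous_on UNIV G" unfolding G_def
    by (intro continuous_intros cF cJP normal_cont)
  have G0: "G y = 0" if "y \<notin> K" for y using F0[OF that] by (simp add: G_def)
  obtain B where B: "B \<ge> 0" "\<And>y. \<bar>G y\<bar> \<le> B" using bounded_support_bound[OF cG bK G0] by metis
  define ch where "ch m y = step (c m * H y)" for m y
  have chC: "Ck 1 (ch m)" for m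
    unfolding ch_def[abs_def] by (intro Ck_step Ck_mult Ck_const Ck_H)
  have Dch: "dirderiv (ch m) w y = - (c m * step_deriv (c m * H y) * (J (P y) * (normal y \<bullet> w)))" for m y
  proof -
    have "(H has_derivative (\<lambda>h. dirderiv H h y)) (at y)" using Ck_Suc_has_derivative[of 0 H] Ck_H by simp
    then have "((\<lambda>y. c m * H y) has_derivative (\<lambda>h. c m * dirderiv H h y)) (at y)" by (rule has_derivative_mult_right)
    from has_derivative_compose[OF this step_has_derivative[unfolded has_field_derivative_def]]
    have "(ch m has_derivative (\<lambda>h. step_deriv (c m * H y) * (c m * dirderiv H h y))) (at y)" by (simp add: ch_def[abs_def])
    from dirderiv_eqI[OF this, of w] show ?thesis by (simp add: dirderiv_H)
  qed
  have ch1: "0 \<le> ch m y" "ch m y \<le> 1" for m y unfolding ch_def by (auto intro: step_nonneg step_le_1)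
  have cch: "continuous_on UNIV (ch m)" "continuous_on UNIV (dirderiv (ch m) w)" for m
    using Ck_continuous[OF chC] Ck_Suc_continuous_dirderiv[of 0 "ch m"] chC by auto
  \<comment> \<open>The derivative of \<open>F\<close> times the cutoff \<open>ch m\<close> has
    integral zero; the product rule splits this into a volume part and a boundary layer
    part.\<close>
  have eq: "(LINT y|lborel. dirderiv F w y * ch m y) = (LINT y|lborel. G y * (c m * step_deriv (c m * H y)))"
    and ig: "integrable lborel (\<lambda>y. G y * (c m * step_deriv (c m * H y)))" for m
  proof -
    have "dirderiv (\<lambda>y. F y * ch m y) w = (\<lambda>y. dirderiv F w y * ch m y - G y * (c m * step_deriv (c m * H y)))"
      using dirderiv_mult[OF F', of 0 "ch m" w] chC by (auto simp: Dch G_def algebra_simps)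
    moreover have "integral\<^sup>L lborel (dirderiv (\<lambda>y. F y * ch m y) w) = 0"
      by (rule integral_dirderiv_eq_0[OF Ck_mult[OF F chC] bK]) (simp add: F0)
    moreover have i1: "integrable lborel (\<lambda>y. dirderiv F w y * ch m y)"
      by (rule integrable_bounded_support[OF _ bK]) (auto intro!: continuous_intros cF cch simp: DF0)
    moreover show i2: "integrable lborel (\<lambda>y. G y * (c m * step_deriv (c m * H y)))"
    proof (rule integrable_bounded_support[OF _ bK])
      have "(\<lambda>y. G y * (c m * step_deriv (c m * H y))) = (\<lambda>y. - (F y * dirderiv (ch m) w y))"
        by (auto simp: Dch G_def algebra_simps)
      then show "continuous_on UNIV (\<lambda>y. G y * (c m * step_deriv (c m * H y)))"
        by (simp only:) (intro continuous_intros cF cch)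
    qed (simp add: G0)
    ultimately show "(LINT y|lborel. dirderiv F w y * ch m y) = (LINT y|lborel. G y * (c m * step_deriv (c m * H y)))"
      by simp
  qed
  have lim1: "(\<lambda>m. LINT y|lborel. dirderiv F w y * ch m y) \<longlonglongrightarrow> (LINT y|LM. dirderiv F w y)"
  proof -
    have "(LINT y|LM. dirderiv F w y) = (LINT y|lborel. dirderiv F w y * (if H y > 0 then 1 else 0))"
      unfolding integral_LM(1)[OF borel_measurable_continuous_onI[OF cF(2)]]
    proof (intro Bochner_Integration.integral_cong refl)
      fix y show "indicator \<Omega> y * dirderiv F w y = dirderiv F w y * (if H y > 0 then 1 else 0)"
        using DF0[of y] dom[of y] K(2) by (cases "y \<in> K") (auto simp: indicator_def)
    qed
    moreover have "(\<lambda>m. LINT y|lborel. dirderiv F w y * ch m y) \<longlonglongrightarrow> (LINT y|lborel. dirderiv F w y * (if H y > 0 then 1 else 0))"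
    proof (rule integral_dominated_convergence[where w="\<lambda>y. \<bar>dirderiv F w y\<bar>"])
      have [measurable]: "dirderiv F w \<in> borel_measurable borel" "H \<in> borel_measurable borel" "ch m \<in> borel_measurable borel" for m
        by (intro borel_measurable_continuous_onI cF H_cont cch)+
      show "(\<lambda>y. dirderiv F w y * (if H y > 0 then 1 else 0)) \<in> borel_measurable lborel" by measurable
      show "(\<lambda>y. dirderiv F w y * ch m y) \<in> borel_measurable lborel" for m by measurable
      show "AE y in lborel. (\<lambda>m. dirderiv F w y * ch m y) \<longlonglongrightarrow> dirderiv F w y * (if H y > 0 then 1 else 0)"
        unfolding ch_def c_def by (intro AE_I2 tendsto_intros step_scaled_tendsto)
      show "AE y in lborel. norm (dirderiv F w y * ch m y) \<le> \<bar>dirderiv F w y\<bar>" for m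
        using ch1 by (intro AE_I2) (simp add: abs_mult mult_left_le)
    qed (use iDF in simp)
    ultimately show ?thesis by simp
  qed
  \<comment> \<open>In graph coordinates scaled by \<open>c m\<close> one has
    \<open>c m * H = t\<close>, and the prefactor \<open>c m\<close> cancels. The weight
    \<open>step_deriv t\<close> then no longer depends on \<open>m\<close>; only the argument of
    \<open>G\<close> does.\<close>
  define a where "a m s = (LINT t|lborel. G (inv R (lift s (h s + t / c m))) * step_deriv t)" for m s
  have am: "(LINT y|lborel. G y * (c m * step_deriv (c m * H y))) = integral\<^sup>L lborel (a m)" for m
    unfolding integral_graph_coordinates[OF ig c[of m]] a_def
    using c[of m] by (simp add: chart_height_def)
  note sint = step_deriv_integral[THEN has_bochner_integral_integral_eq] step_deriv_integral[THEN has_bochner_integral_iff[THEN iffD1], THEN conjunct1]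
  have Gm[measurable]: "G \<in> borel_measurable borel" using cG by (rule borel_measurable_continuous_onI)
  have \<Phi>m: "(\<lambda>(s, t). inv R (lift s (h s + t / c m))) \<in> borel_measurable (borel \<Otimes>\<^sub>M borel)" for m
  proof -
    have "continuous_on UNIV (\<lambda>z. (fst z, h (fst z) + snd z / c m))"
      using c[of m] by (intro continuous_intros continuous_on_compose2[OF h_cont]) auto
    from continuous_on_compose2[OF linear_continuous_on[OF bounded_linear_compose[OF inv_lin(1) bounded_linear_lift], of UNIV] this]
    have "continuous_on UNIV (\<lambda>(s, t). inv R (lift s (h s + t / c m)))" by (simp add: case_prod_beta')
    then show ?thesis unfolding borel_prod by (rule borel_measurable_continuous_onI)
  qed
  have inner: "(\<lambda>m. a m s) \<longlonglongrightarrow> G (Y s)" and ab: "\<bar>a m s\<bar> \<le> B" for m s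
  proof -
    have m1: "(\<lambda>t. G (inv R (lift s (h s + t / c m)))) \<in> borel_measurable borel" for m
    proof -
      have [measurable]: "(\<lambda>t. inv R (lift s (h s + t / c m))) \<in> borel_measurable borel"
        using measurable_compose[OF measurable_Pair1'[of s borel borel] \<Phi>m[of m]] by simp
      show ?thesis by measurable
    qed
    have "(\<lambda>m. a m s) \<longlonglongrightarrow> (LINT t|lborel. G (Y s) * step_deriv t)"
      unfolding a_def
    proof (rule integral_dominated_convergence[where w="\<lambda>t. B * step_deriv t"])
      show "integrable lborel (\<lambda>t. B * step_deriv t)" using sint by simp
      show "AE t in lborel. (\<lambda>m. G (inv R (lift s (h s + t / c m))) * step_deriv t) \<longlonglongrightarrow> G (Y s) * step_deriv t"
      proof (intro AE_I2 tendsto_mult_right)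
        fix t
        have "(\<lambda>m. t / c m) \<longlonglongrightarrow> 0" unfolding c_def by (rule LIMSEQ_Suc[OF lim_const_over_n])
        then have "(\<lambda>m. (s, h s + t / c m)) \<longlonglongrightarrow> (s, h s + 0)" by (intro tendsto_intros)
        from bounded_linear.tendsto[OF bounded_linear_compose[OF inv_lin(1) bounded_linear_lift] this]
        have "(\<lambda>m. inv R (lift s (h s + t / c m))) \<longlonglongrightarrow> Y s" by (simp add: chart_point_def)
        then show "(\<lambda>m. G (inv R (lift s (h s + t / c m)))) \<longlonglongrightarrow> G (Y s)"
          using cG by (intro continuous_on_tendsto_compose[OF cG]) auto
      qed
      show "AE t in lborel. norm (G (inv R (lift s (h s + t / c m))) * step_deriv t) \<le> B * step_deriv t" for m
        using B by (intro AE_I2) (simp add: abs_mult step_deriv_nonneg mult_right_mono)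
    qed (use m1 in simp_all)
    then show "(\<lambda>m. a m s) \<longlonglongrightarrow> G (Y s)" using sint by simp
    have "\<bar>LINT t|lborel. step_deriv t * G (inv R (lift s (h s + t / c m)))\<bar> \<le> B * (LINT t|lborel. \<bar>step_deriv t\<bar>)"
      using m1[of m] B by (intro integral_mult_bounded_le sint) auto
    then show "\<bar>a m s\<bar> \<le> B" using sint by (simp add: a_def mult.commute step_deriv_nonneg)
  qed
  \<comment> \<open>Vertical lines over base points outside the projection of \<open>K\<close> do
    not meet \<open>K\<close>; this yields an integrable bound for \<open>a m\<close> uniform in
    \<open>m\<close>.\<close>
  have a0: "a m s = 0" if "s \<notin> P ` K" for m s
  proof -
    have "inv R (lift s t) \<notin> K" for t using that P_inv by (metis image_eqI)
    then show ?thesis by (simp add: a_def G0)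
  qed
  have cPK: "compact (P ` K)" by (intro compact_continuous_image linear_continuous_on[OF P_lin] K)
  have lim2: "(\<lambda>m. integral\<^sup>L lborel (a m)) \<longlonglongrightarrow> (LINT s|lborel. G (Y s))"
  proof (rule integral_dominated_convergence[where w="\<lambda>s. B * indicator (P ` K) s"])
    show "(\<lambda>s. G (Y s)) \<in> borel_measurable lborel" by simp
    show "a m \<in> borel_measurable lborel" for m
    proof -
      have "(\<lambda>(s, t). G (inv R (lift s (h s + t / c m))) * step_deriv t) \<in> borel_measurable (borel \<Otimes>\<^sub>M lborel)"
        using \<Phi>m[of m] by (auto simp: split_beta' cong: measurable_cong_sets sets_pair_measure_cong)
      then show ?thesis unfolding a_def[abs_def] by (auto intro!: lborel.borel_measurable_lebesgue_integral)
    qed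
    show "integrable lborel (\<lambda>s. B * indicator (P ` K) s)"
      using cPK emeasure_bounded_finite[OF compact_imp_bounded[OF cPK]]
      by (intro integrable_mult_right integrable_real_indicator) (auto intro: borel_closed compact_imp_closed)
    show "AE s in lborel. (\<lambda>m. a m s) \<longlonglongrightarrow> G (Y s)" by (intro AE_I2 inner)
    show "AE s in lborel. norm (a m s) \<le> B * indicator (P ` K) s" for m
      using ab a0 by (intro AE_I2) (auto simp: indicator_def)
  qed
  have "(LINT y|LM. dirderiv F w y) = (LINT s|lborel. G (Y s))"
    using lim1 lim2 unfolding eq am by (rule LIMSEQ_unique)
  also have "\<dots> = (LINT s|lborel. J s * indicator V s * (F (Y s) * (normal (Y s) \<bullet> w)))"
  proof (intro Bochner_Integration.integral_cong refl)
    fix s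
    show "G (Y s) = J s * indicator V s * (F (Y s) * (normal (Y s) \<bullet> w))"
    proof (cases "Y s \<in> K")
      case True
      then have "s \<in> V" using K(2) by (auto simp: V_def)
      then show ?thesis by (simp add: G_def)
    qed (simp add: G_def F0)
  qed
  also have "\<dots> = (LINT y|\<sigma>. F y * (normal y \<bullet> w))"
  proof (rule surface_integral_chart[symmetric])
    show "(\<lambda>y. F y * (normal y \<bullet> w)) \<in> borel_measurable borel"
      by (intro borel_measurable_continuous_onI continuous_intros cF normal_cont)
    show "F y * (normal y \<bullet> w) = 0" if "y \<notin> D" for y
    proof -
      have "y \<notin> K" using K(2) that by blast
      then show ?thesis by (simp add: F0)
    qed
  qed
  also have "\<dots> = (LINT y|\<sigma>. F y * (nu y \<bullet> w))"
  proof (rule integral_cong_AE)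
    have [measurable]: "F \<in> borel_measurable borel" "normal \<in> borel_measurable borel"
      by (intro borel_measurable_continuous_onI cF normal_cont)+
    show "(\<lambda>y. F y * (normal y \<bullet> w)) \<in> borel_measurable \<sigma>" "(\<lambda>y. F y * (nu y \<bullet> w)) \<in> borel_measurable \<sigma>"
      unfolding measurable_\<sigma> by measurable
    show "AE y in \<sigma>. F y * (normal y \<bullet> w) = F y * (nu y \<bullet> w)"
      using AE_\<sigma>_S
    proof eventually_elim
      case (elim y)
      show ?case
      proof (cases "y \<in> K")
        case True
        then show ?thesis using nu_eq[OF _ elim] K(2) by auto
      qed (simp add: F0)
    qed
  qed
  finally show ?thesis .
qed

end

lemma L2_norm_sum_le:
  assumes "finite I" "\<And>i. i \<in> I \<Longrightarrow> f i \<in> L2 M"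
  shows "L2_norm M (\<lambda>x. \<Sum>i\<in>I. f i x) \<le> (\<Sum>i\<in>I. L2_norm M (f i))"
  using assms
proof (induction I rule: finite_induct)
  case empty then show ?case by (simp add: L2_norm_def)
next
  case (insert i I)
  have "L2_norm M (\<lambda>x. f i x + (\<Sum>i\<in>I. f i x)) \<le> L2_norm M (f i) + L2_norm M (\<lambda>x. \<Sum>i\<in>I. f i x)"
    using insert by (intro L2_norm_triangle L2_sum) auto
  then show ?case using insert by simp
qed

section \<open>Estimates for the H1 norm\<close>

context bounded_open begin

lemma WP_norm_le:
  assumes "WP j f g" "f \<in> H1 \<Omega>" shows "L2_norm LM g \<le> H1_norm \<Omega> f"
proof -
  have "L2_norm LM g = L2_norm LM (weak_partial \<Omega> j f)"
    using weak_partial_eq[OF assms(1)] L2_D(1)[OF WP_L2(2)[OF assms(1)]] L2_D(1)[OF weak_partial_L2[OF assms(2)]]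
    by (intro L2_norm_cong_AE) auto
  then show ?thesis using L2_le_H1_norm(2)[of j f] by simp
qed

lemma Ck_H1: "Ck 1 v \<Longrightarrow> v \<in> H1 \<Omega>"
  by (rule H1_I[OF WP_Ck])

lemma H1_add: "f \<in> H1 \<Omega> \<Longrightarrow> f' \<in> H1 \<Omega> \<Longrightarrow> (\<lambda>x. f x + f' x) \<in> H1 \<Omega>"
  by (rule H1_I[OF WP_add[OF weak_partial_WP weak_partial_WP]])

lemma H1_scale: "f \<in> H1 \<Omega> \<Longrightarrow> (\<lambda>x. c * f x) \<in> H1 \<Omega>"
  by (rule H1_I[OF WP_scale[OF weak_partial_WP]])

lemma H1_diff: "f \<in> H1 \<Omega> \<Longrightarrow> f' \<in> H1 \<Omega> \<Longrightarrow> (\<lambda>x. f x - f' x) \<in> H1 \<Omega>"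
  by (rule H1_I[OF WP_diff[OF weak_partial_WP weak_partial_WP]])

lemma H1_L2: "f \<in> H1 \<Omega> \<Longrightarrow> f \<in> L2 LM"
  by (simp add: H1_def)

lemma H1_norm_nonneg: "0 \<le> H1_norm \<Omega> f"
  using L2_le_H1_norm(1)[of f] L2_norm_nonneg[of LM f] by linarith

lemma H1_norm_le_4:
  assumes "\<And>j. WP j f (g j)" "L2_norm LM f \<le> e" "\<And>j. L2_norm LM (g j) \<le> e"
  shows "H1_norm \<Omega> f \<le> 4 * e"
proof -
  have "(\<Sum>j\<in>UNIV. L2_norm LM (g j)) \<le> (\<Sum>j\<in>(UNIV::3 set). e)" by (intro sum_mono assms)
  then show ?thesis using H1_norm_le[OF assms(1)] assms(2) by simp
qed

text \<open>The factor 4 is the price of estimating \<open>H1_norm\<close> by the sum of four L2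
  norms, of the function and of its three derivatives; all later uses tolerate a constant.\<close>

lemma H1_norm_add_le:
  assumes f: "f \<in> H1 \<Omega>" and f': "f' \<in> H1 \<Omega>"
  shows "H1_norm \<Omega> (\<lambda>x. f x + f' x) \<le> 4 * (H1_norm \<Omega> f + H1_norm \<Omega> f')"
proof (rule H1_norm_le_4[OF WP_add[OF weak_partial_WP[OF f] weak_partial_WP[OF f']]])
  show "L2_norm LM (\<lambda>x. f x + f' x) \<le> H1_norm \<Omega> f + H1_norm \<Omega> f'"
    by (rule order_trans[OF L2_norm_triangle[OF H1_L2[OF f] H1_L2[OF f']]]) (intro add_mono L2_le_H1_norm)
  show "L2_norm LM (\<lambda>x. weak_partial \<Omega> j f x + weak_partial \<Omega> j f' x) \<le> H1_norm \<Omega> f + H1_norm \<Omega> f'" for j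
    by (rule order_trans[OF L2_norm_triangle[OF weak_partial_L2[OF f] weak_partial_L2[OF f']]]) (intro add_mono L2_le_H1_norm)
qed

lemma H1_norm_scale:
  assumes f: "f \<in> H1 \<Omega>" shows "H1_norm \<Omega> (\<lambda>x. c * f x) = \<bar>c\<bar> * H1_norm \<Omega> f"
proof -
  have "H1_norm \<Omega> (\<lambda>x. c * f x) = sqrt ((L2_norm LM (\<lambda>x. c * f x))\<^sup>2 + (\<Sum>j\<in>UNIV. (L2_norm LM (\<lambda>x. c * weak_partial \<Omega> j f x))\<^sup>2))"
    by (rule H1_norm_eq[OF WP_scale[OF weak_partial_WP[OF f]]])
  also have "\<dots> = sqrt (c\<^sup>2 * ((L2_norm LM f)\<^sup>2 + (\<Sum>j\<in>UNIV. (L2_norm LM (weak_partial \<Omega> j f))\<^sup>2)))"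
    by (simp add: L2_norm_scale power_mult_distrib sum_distrib_left distrib_left)
  finally show ?thesis by (simp add: real_sqrt_mult H1_norm_def)
qed

lemma H1_norm_diff_le:
  assumes f: "f \<in> H1 \<Omega>" and f': "f' \<in> H1 \<Omega>"
  shows "H1_norm \<Omega> (\<lambda>x. f x - f' x) \<le> 4 * (H1_norm \<Omega> f + H1_norm \<Omega> f')"
  using H1_norm_add_le[OF f H1_scale[OF f', of "-1"]] H1_norm_scale[OF f', of "-1"] by simp

lemma dirderiv_L2_norm_le:
  assumes v: "Ck 1 v"
  shows "L2_norm LM (dirderiv v w) \<le> 3 * norm w * H1_norm \<Omega> v"
proof -
  have v': "Ck (Suc 0) v" using v by simp
  have eq: "dirderiv v w = (\<lambda>x. \<Sum>i\<in>UNIV. w$i * dirderiv v (axis i 1) x)"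
    using dirderiv_sum_axis[OF v', of w] by auto
  have "L2_norm LM (dirderiv v w) \<le> (\<Sum>i\<in>UNIV. L2_norm LM (\<lambda>x. w$i * dirderiv v (axis i 1) x))"
    unfolding eq by (intro L2_norm_sum_le L2_scale WP_L2(2)[OF WP_Ck[OF v]]) auto
  also have "\<dots> \<le> (\<Sum>i\<in>(UNIV::3 set). norm w * H1_norm \<Omega> v)"
    unfolding L2_norm_scale
    by (intro sum_mono mult_mono component_le_norm_cart WP_norm_le[OF WP_Ck[OF v] Ck_H1[OF v]] L2_norm_nonneg norm_ge_zero)
  finally show ?thesis by simp
qed

end

section \<open>The trace inequality for continuously differentiable functions\<close>

context C2_domain begin

text \<open>Apply the divergence theorem to \<open>\<zeta> v\<^sup>2\<close> in the upward direction of a chart, which is uniformly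
  transversal to the boundary near \<open>x\<close>.\<close>

lemma trace_inequality_local:
  assumes x: "x \<in> S"
  shows "\<exists>\<rho> C. \<rho> > 0 \<and> C \<ge> 0 \<and> (\<forall>v. Ck 1 v \<longrightarrow> (LINT y|\<sigma>. indicator (ball x \<rho>) y * (v y)\<^sup>2) \<le> C * (H1_norm \<Omega> v)\<^sup>2)"
proof -
  obtain r R h where "boundary_chart_at \<Omega> x r R h" using ex_chart[OF x] .
  then interpret boundary_chart_at \<Omega> x r R h .
  interpret C2_domain_chart \<Omega> x r R h ..
  have xD: "x \<in> D" using r_pos by simp
  obtain a b where ab: "cbox a b \<subseteq> D" "x \<in> box a b" using open_contains_cbox[OF open_ball xD] by metis
  define \<zeta> where "\<zeta> = box_bump 1 a b"
  have \<zeta>C: "Ck m \<zeta>" for m unfolding \<zeta>_def by (rule Ck_box_bump)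
  have \<zeta>0: "\<zeta> y = 0" if "y \<notin> cbox a b" for y
    unfolding \<zeta>_def using that box_subset_cbox by (intro box_bump_eq_0) auto
  have \<zeta>1: "0 \<le> \<zeta> y" "\<zeta> y \<le> 1" for y unfolding \<zeta>_def by (rule box_bump_nonneg box_bump_le_1)+
  have c\<zeta>: "continuous_on UNIV \<zeta>" "continuous_on UNIV (dirderiv \<zeta> up)"
    using Ck_continuous[OF \<zeta>C[of 1]] Ck_Suc_continuous_dirderiv[OF \<zeta>C[of "Suc 0"]] by auto
  obtain B1 where B1: "B1 \<ge> 0" "AE y in LM. \<bar>dirderiv \<zeta> up y\<bar> \<le> B1"
    using continuous_bounded_on_dom[OF c\<zeta>(2)] by metis
  have J0: "J s > 0" for s using area_density_ge_1[of h s] by linarith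
  \<comment> \<open>On the boundary inside the chart the product of the normal with
    \<open>up\<close> is \<open>- 1 / J\<close>, so \<open>- q0\<close> is the weight of the squared
    function in the boundary integral. Being continuous and positive at \<open>x\<close>,
    \<open>q0\<close> is bounded below near \<open>x\<close>.\<close>
  define q0 where "q0 y = \<zeta> y / J (P y)" for y
  have cJP: "continuous_on UNIV (\<lambda>y. J (P y))"
    by (rule continuous_on_compose2[OF J_cont linear_continuous_on[OF P_lin]]) auto
  have cq: "continuous_on UNIV q0"
    unfolding q0_def using J0 by (intro continuous_intros c\<zeta> cJP) (auto simp: less_imp_neq[THEN not_sym])
  have "\<zeta> x > 0" unfolding \<zeta>_def using box_bump_pos_iff[of 1 a b x] ab by simp
  then have qx: "q0 x > 0" using J0 by (simp add: q0_def)
  have q0: "q0 y \<ge> 0" for y using \<zeta>1 J0 by (simp add: q0_def less_imp_le)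
  obtain \<rho> where \<rho>: "\<rho> > 0" "\<And>y. dist y x < \<rho> \<Longrightarrow> dist (q0 y) (q0 x) < q0 x / 2"
    using cq qx unfolding continuous_on_iff by (metis UNIV_I half_gt_zero)
  \<comment> \<open>\<open>B1\<close> bounds the derivative of \<open>\<zeta>\<close>;
    \<open>6 = 2 * 3\<close> combines the derivative of a square with the constant 3 of
    \<open>dirderiv_L2_norm_le\<close> for the unit vector \<open>up\<close>;
    \<open>2 / q0 x\<close> undoes the weight, which is at least \<open>q0 x / 2\<close> on the
    ball.\<close>
  define C where "C = 2 / q0 x * (B1 + 6)"
  have "(LINT y|\<sigma>. indicator (ball x \<rho>) y * (v y)\<^sup>2) \<le> C * (H1_norm \<Omega> v)\<^sup>2" if v: "Ck 1 v" for v
  proof -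
    define N where "N = H1_norm \<Omega> v"
    have N: "N \<ge> 0" "L2_norm LM v \<le> N" "L2_norm LM (dirderiv v up) \<le> 3 * N"
      using H1_norm_nonneg L2_le_H1_norm(1) dirderiv_L2_norm_le[OF v, of up] by (auto simp: N_def)
    have v': "Ck (Suc 0) v" using v by simp
    note cv = Ck_continuous[OF v] Ck_Suc_continuous_dirderiv[OF v', of up]
    note vL = continuous_L2[OF cv(1)] continuous_L2[OF cv(2)]
    define F where "F y = \<zeta> y * (v y * v y)" for y
    have F: "Ck 1 F" unfolding F_def[abs_def] by (intro Ck_mult \<zeta>C v)
    have DF: "dirderiv F up y = (dirderiv \<zeta> up y * v y) * v y + (2 * \<zeta> y * v y) * dirderiv v up y" for y
      unfolding F_def[abs_def] dirderiv_mult[OF \<zeta>C[of "Suc 0"] Ck_mult[OF v' v']] dirderiv_mult[OF v' v']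
      by (simp add: algebra_simps)
    have L1: "(\<lambda>y. dirderiv \<zeta> up y * v y) \<in> L2 LM" "L2_norm LM (\<lambda>y. dirderiv \<zeta> up y * v y) \<le> B1 * N"
    proof -
      show "(\<lambda>y. dirderiv \<zeta> up y * v y) \<in> L2 LM" by (rule continuous_mult_L2[OF c\<zeta>(2) vL(1)])
      show "L2_norm LM (\<lambda>y. dirderiv \<zeta> up y * v y) \<le> B1 * N"
        using L2_norm_bounded_mult[OF vL(1) continuous_measurable[OF c\<zeta>(2)] B1(2,1)] mult_left_mono[OF N(2) B1(1)]
        by linarith
    qed
    have c2\<zeta>: "continuous_on UNIV (\<lambda>y. 2 * \<zeta> y)" by (intro continuous_intros c\<zeta>)
    have L2': "(\<lambda>y. 2 * \<zeta> y * v y) \<in> L2 LM" "L2_norm LM (\<lambda>y. 2 * \<zeta> y * v y) \<le> 2 * N"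
    proof -
      show "(\<lambda>y. 2 * \<zeta> y * v y) \<in> L2 LM" by (rule continuous_mult_L2[OF c2\<zeta> vL(1)])
      have "L2_norm LM (\<lambda>y. 2 * \<zeta> y * v y) \<le> 2 * L2_norm LM v"
        using \<zeta>1 by (intro L2_norm_bounded_mult[OF vL(1) continuous_measurable[OF c2\<zeta>]]) auto
      then show "L2_norm LM (\<lambda>y. 2 * \<zeta> y * v y) \<le> 2 * N" using N(2) by simp
    qed
    have "\<bar>LINT y|LM. dirderiv F up y\<bar> = \<bar>(LINT y|LM. (dirderiv \<zeta> up y * v y) * v y) + (LINT y|LM. (2 * \<zeta> y * v y) * dirderiv v up y)\<bar>"
      unfolding DF using L2_mult_integrable[OF L1(1) vL(1)] L2_mult_integrable[OF L2'(1) vL(2)] by simp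
    also have "\<dots> \<le> (B1 * N) * N + (2 * N) * (3 * N)"
      using order_trans[OF L2_Cauchy_Schwarz[OF L1(1) vL(1)] mult_mono[OF L1(2) N(2)]]
        order_trans[OF L2_Cauchy_Schwarz[OF L2'(1) vL(2)] mult_mono[OF L2'(2) N(3)]] B1(1) N(1)
      by (simp add: L2_norm_nonneg)
    also have "\<dots> = (B1 + 6) * N\<^sup>2" by (simp add: power2_eq_square algebra_simps)
    finally have le: "\<bar>LINT y|LM. dirderiv F up y\<bar> \<le> (B1 + 6) * N\<^sup>2" .
    have g: "(LINT y|LM. dirderiv F up y) = (LINT y|\<sigma>. F y * (nu y \<bullet> up))"
      by (rule divergence_theorem_local[OF F compact_cbox ab(1)]) (simp add: F_def \<zeta>0)
    have "(LINT y|\<sigma>. F y * (nu y \<bullet> up)) = (LINT y|\<sigma>. - (q0 y * (v y)\<^sup>2))"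
    proof (rule integral_cong_AE)
      have [measurable]: "F \<in> borel_measurable borel" "q0 \<in> borel_measurable borel" "v \<in> borel_measurable borel"
        by (intro borel_measurable_continuous_onI Ck_continuous[OF F] cq cv)+
      show "(\<lambda>y. F y * (nu y \<bullet> up)) \<in> borel_measurable \<sigma>" "(\<lambda>y. - (q0 y * (v y)\<^sup>2)) \<in> borel_measurable \<sigma>"
        unfolding measurable_\<sigma> by measurable
      show "AE y in \<sigma>. F y * (nu y \<bullet> up) = - (q0 y * (v y)\<^sup>2)"
        using AE_\<sigma>_S
      proof eventually_elim
        case (elim y)
        show ?case
        proof (cases "y \<in> cbox a b")
          case True
          then have "nu y \<bullet> up = - (1 / J (P y))" using nu_eq[OF _ elim] ab(1)
            by (auto simp: normal_inner axis_def)
          then show ?thesis by (simp add: F_def q0_def power2_eq_square)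
        next
          case False then show ?thesis by (simp add: F_def q0_def \<zeta>0)
        qed
      qed
    qed
    then have qle: "(LINT y|\<sigma>. q0 y * (v y)\<^sup>2) \<le> (B1 + 6) * N\<^sup>2" using le g by simp
    have "q0 x / 2 * (LINT y|\<sigma>. indicator (ball x \<rho>) y * (v y)\<^sup>2) = (LINT y|\<sigma>. q0 x / 2 * (indicator (ball x \<rho>) y * (v y)\<^sup>2))"
      by simp
    also have "\<dots> \<le> (LINT y|\<sigma>. q0 y * (v y)\<^sup>2)"
    proof (rule integral_mono)
      have i: "integrable \<sigma> (\<lambda>y. (v y)\<^sup>2)" using L2_D(2)[OF continuous_L2_\<sigma>[OF cv(1)]] .
      have "integrable \<sigma> (\<lambda>y. indicator (ball x \<rho>) y *\<^sub>R (v y)\<^sup>2)" by (rule integrable_mult_indicator[OF _ i]) simp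
      then show "integrable \<sigma> (\<lambda>y. q0 x / 2 * (indicator (ball x \<rho>) y * (v y)\<^sup>2))" by simp
      have "(\<lambda>y. q0 y * v y) \<in> L2 \<sigma>" by (rule continuous_L2_\<sigma>) (intro continuous_intros cq cv)
      from L2_mult_integrable[OF this continuous_L2_\<sigma>[OF cv(1)]]
      show "integrable \<sigma> (\<lambda>y. q0 y * (v y)\<^sup>2)" by (simp add: power2_eq_square mult.assoc)
      show "q0 x / 2 * (indicator (ball x \<rho>) y * (v y)\<^sup>2) \<le> q0 y * (v y)\<^sup>2" for y
      proof (cases "y \<in> ball x \<rho>")
        case True
        then have "q0 x / 2 \<le> q0 y" using \<rho>(2)[of y] by (simp add: dist_commute dist_real_def) (simp add: abs_if split: if_splits)
        then have "q0 x / 2 * (v y)\<^sup>2 \<le> q0 y * (v y)\<^sup>2" by (rule mult_right_mono) simp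
        then show ?thesis using True by simp
      qed (use q0 in simp)
    qed
    also note qle
    finally show ?thesis using qx by (simp add: C_def N_def field_simps)
  qed
  moreover have "C \<ge> 0" using qx B1 by (simp add: C_def)
  ultimately show ?thesis using \<rho>(1) by blast
qed

text \<open>By compactness finitely many of the local balls cover the boundary, where the sum of
  their indicators is then at least 1. The summand 1 added to \<open>sqrt C0\<close> makes the
  constant positive.\<close>

lemma trace_inequality:
  obtains C where "C > 0" "\<And>v. Ck 1 v \<Longrightarrow> L2_norm \<sigma> v \<le> C * H1_norm \<Omega> v"
proof -
  obtain \<rho> C where \<rho>C: "\<And>x. x \<in> S \<Longrightarrow> \<rho> x > 0 \<and> C x \<ge> 0 \<and> (\<forall>v. Ck 1 v \<longrightarrow> (LINT y|\<sigma>. indicator (ball x (\<rho> x)) y * (v y)\<^sup>2) \<le> C x * (H1_norm \<Omega> v)\<^sup>2)"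
  proof -
    have "\<forall>x\<in>S. \<exists>k. fst k > 0 \<and> snd k \<ge> 0 \<and> (\<forall>v. Ck 1 v \<longrightarrow> (LINT y|\<sigma>. indicator (ball x (fst k)) y * (v y)\<^sup>2) \<le> snd k * (H1_norm \<Omega> v)\<^sup>2)"
      using trace_inequality_local by auto
    from bchoice[OF this] obtain k where "\<forall>x\<in>S. fst (k x) > 0 \<and> snd (k x) \<ge> 0 \<and> (\<forall>v. Ck 1 v \<longrightarrow> (LINT y|\<sigma>. indicator (ball x (fst (k x))) y * (v y)\<^sup>2) \<le> snd (k x) * (H1_norm \<Omega> v)\<^sup>2)"
      by blast
    then show ?thesis by (intro that[of "\<lambda>x. fst (k x)" "\<lambda>x. snd (k x)"]) blast
  qed
  have "S \<subseteq> (\<Union>x\<in>S. ball x (\<rho> x))"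
  proof
    fix x assume "x \<in> S"
    then show "x \<in> (\<Union>x\<in>S. ball x (\<rho> x))" using \<rho>C[of x] by (intro UN_I[of x]) auto
  qed
  then obtain T where T: "T \<subseteq> S" "finite T" "S \<subseteq> (\<Union>x\<in>T. ball x (\<rho> x))"
    by (rule compactE_image[OF compact_frontier, of S "\<lambda>x. ball x (\<rho> x)", OF open_ball]) blast
  define C0 where "C0 = (\<Sum>x\<in>T. C x)"
  have C0: "C0 \<ge> 0" unfolding C0_def using T(1) \<rho>C by (intro sum_nonneg) blast
  have "L2_norm \<sigma> v \<le> (sqrt C0 + 1) * H1_norm \<Omega> v" if v: "Ck 1 v" for v
  proof -
    have i: "integrable \<sigma> (\<lambda>y. (v y)\<^sup>2)" using L2_D(2)[OF continuous_L2_\<sigma>[OF Ck_continuous[OF v]]] .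
    have ii: "integrable \<sigma> (\<lambda>y. indicator (ball x (\<rho> x)) y * (v y)\<^sup>2)" for x
      using integrable_mult_indicator[OF _ i, of "ball x (\<rho> x)"] by simp
    have "(L2_norm \<sigma> v)\<^sup>2 = (LINT y|\<sigma>. (v y)\<^sup>2)" by (rule L2_norm_sq)
    also have "\<dots> \<le> (LINT y|\<sigma>. (\<Sum>x\<in>T. indicator (ball x (\<rho> x)) y * (v y)\<^sup>2))"
    proof (rule integral_mono_AE[OF i])
      show "integrable \<sigma> (\<lambda>y. \<Sum>x\<in>T. indicator (ball x (\<rho> x)) y * (v y)\<^sup>2)"
        using ii by (intro Bochner_Integration.integrable_sum)
      show "AE y in \<sigma>. (v y)\<^sup>2 \<le> (\<Sum>x\<in>T. indicator (ball x (\<rho> x)) y * (v y)\<^sup>2)"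
        using AE_\<sigma>_S
      proof eventually_elim
        case (elim y)
        then obtain x where x: "x \<in> T" "y \<in> ball x (\<rho> x)" using T(3) by blast
        then have "(v y)\<^sup>2 = indicator (ball x (\<rho> x)) y * (v y)\<^sup>2" by simp
        also have "\<dots> \<le> (\<Sum>x\<in>T. indicator (ball x (\<rho> x)) y * (v y)\<^sup>2)"
          by (rule member_le_sum[OF x(1) _ T(2)]) simp
        finally show ?case .
      qed
    qed
    also have "\<dots> = (\<Sum>x\<in>T. LINT y|\<sigma>. indicator (ball x (\<rho> x)) y * (v y)\<^sup>2)"
      by (rule Bochner_Integration.integral_sum) (rule ii)
    also have "\<dots> \<le> (\<Sum>x\<in>T. C x * (H1_norm \<Omega> v)\<^sup>2)"
      using T(1) \<rho>C v by (intro sum_mono) blast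
    also have "\<dots> = C0 * (H1_norm \<Omega> v)\<^sup>2" by (simp add: C0_def sum_distrib_right)
    finally have "L2_norm \<sigma> v \<le> sqrt (C0 * (H1_norm \<Omega> v)\<^sup>2)" by (rule real_le_rsqrt)
    also have "\<dots> = sqrt C0 * H1_norm \<Omega> v" using H1_norm_nonneg by (simp add: real_sqrt_mult)
    also have "\<dots> \<le> (sqrt C0 + 1) * H1_norm \<Omega> v" using H1_norm_nonneg by (simp add: distrib_right)
    finally show ?thesis .
  qed
  moreover have "sqrt C0 + 1 > 0" using C0 by (simp add: add_nonneg_pos)
  ultimately show ?thesis by (rule that[rotated])
qed

section \<open>Density of smooth functions\<close>

text \<open>Around an interior point any kernel box, scaled down, stays in \<open>\<Omega>\<close>.
  At a boundary point \<open>h\<close> has a Lipschitz constant \<open>L\<close> on the chart, so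
  directions whose height exceeds \<open>L\<close> times their horizontal length lead from
  \<open>\<Omega>\<close> into \<open>\<Omega>\<close>; the kernel box from \<open>a\<close> to
  \<open>b\<close> is placed around \<open>up\<close> inside this cone. The box from
  \<open>c\<close> to \<open>d\<close> confines everything to the chart.\<close>

lemma cone_property:
  assumes "x \<in> closure \<Omega>"
  shows "\<exists>c d a b e0. x \<in> box c d \<and> box a b \<noteq> {} \<and> e0 > 0 \<and>
     (\<forall>e y. 0 < e \<longrightarrow> e < e0 \<longrightarrow> y \<in> \<Omega> \<longrightarrow> (\<exists>z\<in>cbox a b. y + e *\<^sub>R z \<in> cbox c d) \<longrightarrow> (\<forall>z\<in>cbox a b. y + e *\<^sub>R z \<in> \<Omega>))"
proof -
  \<comment> \<open>If a shifted kernel box meets \<open>cbox c d\<close>, its points and its base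
    point lie within \<open>2 * e * B\<close> of the meeting point, hence in \<open>U\<close> once
    this is below the margin \<open>\<delta>\<close> of \<open>cbox c d\<close> in
    \<open>U\<close>.\<close>
  have near: "\<exists>e0>0. \<forall>e y. 0 < e \<longrightarrow> e < e0 \<longrightarrow> (\<exists>z\<in>cbox a b. y + e *\<^sub>R z \<in> cbox c d) \<longrightarrow> y \<in> U \<and> (\<forall>z\<in>cbox a b. y + e *\<^sub>R z \<in> U)"
    if U: "open U" "cbox c d \<subseteq> U" for a b c d :: "real^3" and U
  proof -
    obtain \<delta> where \<delta>: "\<delta> > 0" "(\<Union>x\<in>cbox c d. ball x \<delta>) \<subseteq> U"
      using compact_subset_open_imp_ball_epsilon_subset[OF compact_cbox U] by blast
    obtain B where B: "B > 0" "\<And>z. z \<in> cbox a b \<Longrightarrow> norm z \<le> B"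
      using bounded_cbox[of a b] unfolding bounded_pos by metis
    show ?thesis
    proof (intro exI[of _ "\<delta> / (2 * B)"] conjI allI impI)
      show "\<delta> / (2 * B) > 0" using \<delta> B by simp
      fix e y assume e: "0 < e" "e < \<delta> / (2 * B)" and "\<exists>z\<in>cbox a b. y + e *\<^sub>R z \<in> cbox c d"
      then obtain z where z: "z \<in> cbox a b" "y + e *\<^sub>R z \<in> cbox c d" by blast
      have eB: "2 * (e * B) < \<delta>" using e B by (simp add: field_simps)
      have ne: "norm (e *\<^sub>R z') \<le> e * B" if "z' \<in> cbox a b" for z' using e B(2)[OF that] by simp
      have "dist (y + e *\<^sub>R z) y < \<delta>" using ne[OF z(1)] eB mult_pos_pos[OF e(1) B(1)] by (simp add: dist_norm)
      then have "y \<in> (\<Union>x\<in>cbox c d. ball x \<delta>)" using z(2) by (intro UN_I[of "y + e *\<^sub>R z"]) auto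
      then show "y \<in> U" using \<delta>(2) by blast
      show "\<forall>z'\<in>cbox a b. y + e *\<^sub>R z' \<in> U"
      proof
        fix z' assume z': "z' \<in> cbox a b"
        have "dist (y + e *\<^sub>R z) (y + e *\<^sub>R z') \<le> norm (e *\<^sub>R z) + norm (e *\<^sub>R z')"
          using norm_triangle_ineq4[of "e *\<^sub>R z" "e *\<^sub>R z'"] by (simp only: dist_norm add_diff_cancel_left)
        then have "dist (y + e *\<^sub>R z) (y + e *\<^sub>R z') < \<delta>" using ne[OF z(1)] ne[OF z'] eB by linarith
        then have "y + e *\<^sub>R z' \<in> (\<Union>x\<in>cbox c d. ball x \<delta>)" using z(2) by (intro UN_I[of "y + e *\<^sub>R z"]) auto
        then show "y + e *\<^sub>R z' \<in> U" using \<delta>(2) by blast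
      qed
    qed
  qed
  show ?thesis
  proof (cases "x \<in> \<Omega>")
    case True
    obtain c d where cd: "cbox c d \<subseteq> \<Omega>" "x \<in> box c d" using open_contains_cbox[OF open_dom True] by metis
    have ne: "box (0::real^3) One \<noteq> {}" by (simp add: box_ne_empty)
    obtain e0 where "e0 > 0" "\<And>e y. 0 < e \<Longrightarrow> e < e0 \<Longrightarrow> (\<exists>z\<in>cbox 0 One. y + e *\<^sub>R z \<in> cbox c d) \<Longrightarrow> (\<forall>z\<in>cbox 0 One. y + e *\<^sub>R z \<in> \<Omega>)"
      using near[OF open_dom cd(1), of 0 One] by blast
    then show ?thesis using cd ne by blast
  next
    case False
    then have xS: "x \<in> S" using assms open_dom by (simp add: frontier_def interior_open)
    obtain r R h where "boundary_chart_at \<Omega> x r R h" using ex_chart[OF xS] .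
    then interpret boundary_chart_at \<Omega> x r R h .
    have xD: "x \<in> D" using r_pos by simp
    obtain c d where cd: "cbox c d \<subseteq> D" "x \<in> box c d" using open_contains_cbox[OF open_ball xD] by metis
    \<comment> \<open>The gradient of \<open>h\<close> is bounded on the projection of the closed
      ball by compactness, and the projection of the ball is convex, so the mean value inequality
      provides a Lipschitz constant.\<close>
    obtain L where L: "L \<ge> 0" "\<And>s t. s \<in> P ` D \<Longrightarrow> t \<in> P ` D \<Longrightarrow> \<bar>h s - h t\<bar> \<le> L * norm (s - t)"
    proof -
      have "compact ((\<lambda>s. \<bar>p s\<bar> + \<bar>q s\<bar>) ` P ` cball x r)"
        by (intro compact_continuous_image continuous_intros linear_continuous_on[OF P_lin] continuous_on_subset[OF pq_cont]) auto
      from compact_imp_bounded[OF this]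
      obtain L where L: "\<forall>l\<in>(\<lambda>s. \<bar>p s\<bar> + \<bar>q s\<bar>) ` P ` cball x r. \<bar>l\<bar> \<le> L"
        unfolding bounded_real by blast
      have on: "onorm (\<lambda>k. dirderiv h k s) \<le> max L 0" if "s \<in> P ` D" for s
      proof (rule onorm_le)
        fix k
        have "s \<in> P ` cball x r" using that ball_subset_cball by blast
        then have "\<bar>\<bar>p s\<bar> + \<bar>q s\<bar>\<bar> \<le> L" using L by blast
        then have "\<bar>p s\<bar> + \<bar>q s\<bar> \<le> max L 0" by simp
        moreover have "\<bar>dirderiv h k s\<bar> \<le> norm k * \<bar>p s\<bar> + norm k * \<bar>q s\<bar>"
        proof -
          have "\<bar>dirderiv h k s\<bar> \<le> \<bar>k$1 * p s\<bar> + \<bar>k$2 * q s\<bar>" using dirderiv_h[of k s] by linarith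
          also have "\<dots> \<le> norm k * \<bar>p s\<bar> + norm k * \<bar>q s\<bar>"
            unfolding abs_mult by (intro add_mono mult_right_mono component_le_norm_cart) auto
          finally show ?thesis .
        qed
        ultimately have "\<bar>dirderiv h k s\<bar> \<le> norm k * max L 0"
          by (smt (verit) distrib_left mult_left_mono norm_ge_zero)
        then show "norm (dirderiv h k s) \<le> max L 0 * norm k" by (simp add: mult.commute)
      qed
      have cv: "convex (P ` D)" using convex_linear_image[OF bounded_linear.linear[OF P_lin] convex_ball] .
      show ?thesis
      proof (rule that[of "max L 0"])
        show "\<bar>h s - h t\<bar> \<le> max L 0 * norm (s - t)" if "s \<in> P ` D" "t \<in> P ` D" for s t
          using differentiable_bound[OF cv has_derivative_at_withinI[OF h_deriv] on that(2) that(1)] that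
          by (simp add: norm_minus_commute)
      qed simp
    qed
    let ?W = "{z. L * norm (P z) < R z $ 3}"
    have W1: "open ?W"
      by (intro open_Collect_less continuous_intros linear_continuous_on[OF P_lin] linear_continuous_on[OF R_lin(1)])
    have W2: "up \<in> ?W" by (simp add: axis_def)
    obtain a b where ab: "cbox a b \<subseteq> ?W" "up \<in> box a b" by (rule open_contains_cbox[OF W1 W2]) (rule that; assumption)
    obtain e0 where e0: "e0 > 0" "\<And>e y. 0 < e \<Longrightarrow> e < e0 \<Longrightarrow> (\<exists>z\<in>cbox a b. y + e *\<^sub>R z \<in> cbox c d) \<Longrightarrow> y \<in> D \<and> (\<forall>z\<in>cbox a b. y + e *\<^sub>R z \<in> D)"
      using near[OF open_ball cd(1), of a b] by blast
    have "y + e *\<^sub>R z \<in> \<Omega>" if e: "0 < e" "e < e0" and y: "y \<in> \<Omega>" and hit: "\<exists>z\<in>cbox a b. y + e *\<^sub>R z \<in> cbox c d" and z: "z \<in> cbox a b" for e y z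
    proof -
      have yD: "y \<in> D" "y + e *\<^sub>R z \<in> D" using e0(2)[OF e hit] z by auto
      have Hy: "H y > 0" using dom[OF yD(1)] y by simp
      have Pe: "P (y + e *\<^sub>R z) = P y + e *\<^sub>R P z"
        using linear_add[OF bounded_linear.linear[OF P_lin]] linear_scale[OF bounded_linear.linear[OF P_lin]] by metis
      have Re: "R (y + e *\<^sub>R z) $ 3 = R y $ 3 + e * R z $ 3"
        by (simp add: linear_add[OF R_lin(2)] linear_scale[OF R_lin(2)])
      \<comment> \<open>Moving by \<open>e\<close> times \<open>z\<close> gains more height than
        \<open>h\<close> can vary over the horizontal part of the move, so \<open>H\<close> stays
        positive.\<close>
      have "\<bar>h (P (y + e *\<^sub>R z)) - h (P y)\<bar> \<le> L * norm (P (y + e *\<^sub>R z) - P y)"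
        by (intro L(2) imageI yD)
      also have "\<dots> = e * (L * norm (P z))" using e by (simp add: Pe)
      also have "\<dots> < e * R z $ 3" using ab(1) z e by auto
      finally have "H (y + e *\<^sub>R z) > 0" using Hy Re by (simp add: chart_height_def)
      then show ?thesis using dom[OF yD(2)] by simp
    qed
    then show ?thesis using cd(2) ab(2) e0(1) by blast
  qed
qed

lemma smooth_partition:
  fixes K :: "(real^3) set"
  assumes I: "finite I" and K: "compact K" and cov: "K \<subseteq> (\<Union>i\<in>I. box (c i) (d i))"
  obtains \<theta> where "\<And>i m. i \<in> I \<Longrightarrow> Ck m (\<theta> i)" "\<And>i x. i \<in> I \<Longrightarrow> x \<notin> cbox (c i) (d i) \<Longrightarrow> \<theta> i x = 0" "\<And>x. x \<in> K \<Longrightarrow> (\<Sum>i\<in>I. \<theta> i x) = 1"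
proof -
  define B where "B x = (\<Sum>i\<in>I. box_bump 1 (c i) (d i) x)" for x
  have B0: "0 \<le> B x" for x unfolding B_def by (intro sum_nonneg box_bump_nonneg)
  have BC: "Ck m B" for m unfolding B_def[abs_def] by (intro Ck_sum I Ck_box_bump)
  have Bpos: "B x > 0" if xK: "x \<in> K" for x
  proof -
    obtain i where i: "i \<in> I" "x \<in> box (c i) (d i)" using cov xK by blast
    have "box_bump 1 (c i) (d i) x \<le> B x" unfolding B_def
      by (rule member_le_sum[OF i(1) _ I]) (rule box_bump_nonneg)
    then show ?thesis using box_bump_pos_iff[of 1 "c i" "d i" x] i(2) by simp
  qed
  obtain \<delta> where \<delta>: "\<delta> > 0" "\<And>x. x \<in> K \<Longrightarrow> \<delta> \<le> B x"
  proof (cases "K = {}")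
    case False
    obtain x where "x \<in> K" "\<And>y. y \<in> K \<Longrightarrow> B x \<le> B y"
      using continuous_attains_inf[OF K False continuous_on_subset[OF Ck_continuous[OF BC[of 0]]]] by blast
    then show ?thesis using that[of "B x"] Bpos by blast
  qed (use that[of 1] in auto)
  \<comment> \<open>the summand \<open>step (\<delta> - B x)\<close> vanishes on \<open>K\<close> and keeps the denominator positive elsewhere\<close>
  define W where "W x = B x + step (\<delta> - B x)" for x
  have WC: "Ck m W" for m unfolding W_def[abs_def] by (intro Ck_add Ck_step Ck_diff Ck_const BC)
  have Wpos: "W x > 0" for x
    using B0[of x] \<delta>(1) step_nonneg[of "\<delta> - B x"] step_pos_iff[of "\<delta> - B x"] by (cases "B x = 0") (auto simp: W_def)
  have WK: "W x = B x" if "x \<in> K" for x using \<delta>(2)[OF that] by (simp add: W_def step_eq)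
  show ?thesis
  proof (rule that[of "\<lambda>i x. box_bump 1 (c i) (d i) x * inverse (W x)"])
    show "Ck m (\<lambda>x. box_bump 1 (c i) (d i) x * inverse (W x))" for i m
      by (intro Ck_mult Ck_box_bump Ck_inverse WC Wpos)
    show "box_bump 1 (c i) (d i) x * inverse (W x) = 0" if "x \<notin> cbox (c i) (d i)" for i x
      using that box_subset_cbox box_bump_eq_0[of 1 x "c i" "d i"] by auto
    show "(\<Sum>i\<in>I. box_bump 1 (c i) (d i) x * inverse (W x)) = 1" if "x \<in> K" for x
      using WK[OF that] Bpos[OF that] by (simp add: sum_distrib_right[symmetric] B_def)
  qed
qed

lemma dirderiv_sum:
  assumes "finite I" "\<And>i. i \<in> I \<Longrightarrow> Ck (Suc m) (f i)"
  shows "dirderiv (\<lambda>x. \<Sum>i\<in>I. f i x) w x = (\<Sum>i\<in>I. dirderiv (f i) w x)"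
  by (rule dirderiv_eqI, rule has_derivative_sum) (rule Ck_Suc_has_derivative[OF assms(2)])

text \<open>Near different boundary points the kernel has to be displaced in different directions,
  so the mollification must be local. A partition of unity on the closure, subordinate to the boxes
  of \<open>cone_property\<close>, splits \<open>f\<close> into pieces, each mollified with a kernel
  adapted to its own box.\<close>

lemma smooth_dense_H1:
  assumes f: "f \<in> H1 \<Omega>" and \<eta>: "\<eta> > 0"
  obtains v where "Ck 1 v" "H1_norm \<Omega> (\<lambda>x. v x - f x) \<le> \<eta>"
proof -
  define g where "g j = weak_partial \<Omega> j f" for j
  have WPf: "WP j f (g j)" for j unfolding g_def by (rule weak_partial_WP[OF f])
  \<comment> \<open>The five parameters are packed into one tuple so that a single choice function
    provides them for all points.\<close>
  define Q where "Q k x \<longleftrightarrow> (case k of (c, d, a, b, e0) \<Rightarrow> x \<in> box c d \<and> box a b \<noteq> {} \<and> e0 > 0 \<and>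
     (\<forall>e y. 0 < e \<longrightarrow> e < e0 \<longrightarrow> y \<in> \<Omega> \<longrightarrow> (\<exists>z\<in>cbox a b. y + e *\<^sub>R z \<in> cbox c d) \<longrightarrow> (\<forall>z\<in>cbox a b. y + e *\<^sub>R z \<in> \<Omega>)))" for k x
  have "\<forall>x\<in>closure \<Omega>. \<exists>k. Q k x"
  proof
    fix x assume "x \<in> closure \<Omega>"
    from cone_property[OF this] have "\<exists>c d a b e0. Q (c, d, a, b, e0) x" unfolding Q_def by simp
    then show "\<exists>k. Q k x" by blast
  qed
  from bchoice[OF this] obtain k where k: "\<And>x. x \<in> closure \<Omega> \<Longrightarrow> Q (k x) x" by blast
  define c d where "c x = fst (k x)" and "d x = fst (snd (k x))" for x
  have "closure \<Omega> \<subseteq> (\<Union>x\<in>closure \<Omega>. box (c x) (d x))"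
    using k by (force simp: Q_def c_def d_def split: prod.splits)
  moreover have "compact (closure \<Omega>)" using bounded_dom by simp
  ultimately obtain I where I: "I \<subseteq> closure \<Omega>" "finite I" "closure \<Omega> \<subseteq> (\<Union>x\<in>I. box (c x) (d x))"
    by (rule_tac compactE_image[of "closure \<Omega>" "closure \<Omega>" "\<lambda>x. box (c x) (d x)", OF _ open_box]) blast+
  obtain \<theta> where \<theta>: "\<And>i m. i \<in> I \<Longrightarrow> Ck m (\<theta> i)" "\<And>i x. i \<in> I \<Longrightarrow> x \<notin> cbox (c i) (d i) \<Longrightarrow> \<theta> i x = 0" "\<And>x. x \<in> closure \<Omega> \<Longrightarrow> (\<Sum>i\<in>I. \<theta> i x) = 1"
    using smooth_partition[OF I(2) \<open>compact (closure \<Omega>)\<close> I(3)] by blast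
  define fi where "fi i x = \<theta> i x * f x" for i x
  define gi where "gi i j x = dirderiv (\<theta> i) (axis j 1) x * f x + \<theta> i x * g j x" for i j x
  have WPi: "WP j (fi i) (gi i j)" if "i \<in> I" for i j
    unfolding fi_def[abs_def] gi_def[abs_def] by (rule WP_mult_smooth[OF WPf \<theta>(1)[OF that]])
  \<comment> \<open>The errors \<open>e\<close> of \<open>card I\<close> pieces add up to at most
    \<open>\<eta> / 4\<close>, for the function and for each derivative; \<open>H1_norm_le_4\<close>
    then costs a factor 4.\<close>
  define e where "e = \<eta> / (4 * (real (card I) + 1))"
  have e: "e > 0" using \<eta> by (simp add: e_def)
  have "\<exists>v. Ck 1 v \<and> L2_norm LM (\<lambda>x. v x - fi i x) \<le> e \<and> (\<forall>j. L2_norm LM (\<lambda>x. dirderiv v (axis j 1) x - gi i j x) \<le> e)" if i: "i \<in> I" for i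
  proof -
    have "i \<in> closure \<Omega>" using I(1) i by blast
    obtain a b e0 where kk: "k i = (c i, d i, a, b, e0)" by (metis c_def d_def prod.collapse)
    have "Q (c i, d i, a, b, e0) i" using k[OF \<open>i \<in> closure \<Omega>\<close>] unfolding kk .
    then have ab: "box a b \<noteq> {}" "e0 > 0" and
      cone: "\<And>e y. 0 < e \<Longrightarrow> e < e0 \<Longrightarrow> y \<in> \<Omega> \<Longrightarrow> (\<exists>z\<in>cbox a b. y + e *\<^sub>R z \<in> cbox (c i) (d i)) \<Longrightarrow> (\<forall>z\<in>cbox a b. y + e *\<^sub>R z \<in> \<Omega>)"
      unfolding Q_def prod.case by blast+
    have z1: "fi i x = 0" if "x \<notin> cbox (c i) (d i)" for x using \<theta>(2)[OF i that] by (simp add: fi_def)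
    have z2: "gi i j x = 0" if "x \<notin> cbox (c i) (d i)" for j x
      using \<theta>(2)[OF i that] dirderiv_eq_0_outside[OF closed_cbox \<theta>(2)[OF i] that] by (simp add: gi_def)
    obtain v where "Ck 1 v" "L2_norm LM (\<lambda>x. v x - fi i x) \<le> e" "\<And>j. L2_norm LM (\<lambda>x. dirderiv v (axis j 1) x - gi i j x) \<le> e"
      using mollification_approximates_locally[OF WPi[OF i] closed_cbox z1 z2 ab cone e] by blast
    then show ?thesis by blast
  qed
  then have "\<forall>i\<in>I. \<exists>v. Ck 1 v \<and> L2_norm LM (\<lambda>x. v x - fi i x) \<le> e \<and> (\<forall>j. L2_norm LM (\<lambda>x. dirderiv v (axis j 1) x - gi i j x) \<le> e)" by blast
  from bchoice[OF this] obtain v where v: "\<And>i. i \<in> I \<Longrightarrow> Ck 1 (v i)" "\<And>i. i \<in> I \<Longrightarrow> L2_norm LM (\<lambda>x. v i x - fi i x) \<le> e"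
    "\<And>i j. i \<in> I \<Longrightarrow> L2_norm LM (\<lambda>x. dirderiv (v i) (axis j 1) x - gi i j x) \<le> e" by blast
  define u where "u x = (\<Sum>i\<in>I. v i x)" for x
  have u: "Ck 1 u" unfolding u_def[abs_def] by (intro Ck_sum I v)
  have Du: "dirderiv u w x = (\<Sum>i\<in>I. dirderiv (v i) w x)" for w x
    unfolding u_def[abs_def] using v(1) by (intro dirderiv_sum[OF I(2), of 0]) simp
  have WPs: "WP j (\<lambda>x. \<Sum>i\<in>I. fi i x) (\<lambda>x. \<Sum>i\<in>I. gi i j x)" for j
    by (intro WP_sum I WPi)
  have sf: "AE x in LM. (\<Sum>i\<in>I. fi i x) = f x"
    unfolding AE_LM using \<theta>(3) closure_subset[of \<Omega>] by (intro AE_I2) (auto simp: fi_def sum_distrib_right[symmetric])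
  have "WP j f (\<lambda>x. \<Sum>i\<in>I. gi i j x)" for j
    by (rule WP_AE_cong[OF WPs L2_D(1)[OF H1_L2[OF f]] L2_D(1)[OF WP_L2(2)[OF WPs]] sf]) simp
  then have WPuf: "WP j (\<lambda>x. u x - f x) (\<lambda>x. dirderiv u (axis j 1) x - (\<Sum>i\<in>I. gi i j x))" for j
    by (intro WP_diff WP_Ck u)
  have ce: "real (card I) * e \<le> \<eta> / 4" using \<eta> by (simp add: e_def field_simps)
  have "H1_norm \<Omega> (\<lambda>x. u x - f x) \<le> 4 * (\<eta> / 4)"
  proof (rule H1_norm_le_4[OF WPuf])
    have L: "(\<lambda>x. v i x - fi i x) \<in> L2 LM" "(\<lambda>x. dirderiv (v i) (axis j 1) x - gi i j x) \<in> L2 LM" if "i \<in> I" for i j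
      using WP_L2[OF WP_diff[OF WP_Ck[OF v(1)[OF that]] WPi[OF that]]] by auto
    have "L2_norm LM (\<lambda>x. u x - f x) = L2_norm LM (\<lambda>x. \<Sum>i\<in>I. v i x - fi i x)"
    proof (rule L2_norm_cong_AE)
      show "(\<lambda>x. u x - f x) \<in> borel_measurable LM" using L2_D(1)[OF WP_L2(1)[OF WPuf]] .
      show "(\<lambda>x. \<Sum>i\<in>I. v i x - fi i x) \<in> borel_measurable LM" using L by (intro L2_D(1) L2_sum I)
      show "AE x in LM. u x - f x = (\<Sum>i\<in>I. v i x - fi i x)"
        using sf by eventually_elim (simp add: u_def sum_subtractf)
    qed
    also have "\<dots> \<le> (\<Sum>i\<in>I. e)"
      by (rule order_trans[OF L2_norm_sum_le[OF I(2)] sum_mono]) (use L v in auto)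
    finally show "L2_norm LM (\<lambda>x. u x - f x) \<le> \<eta> / 4" using ce by simp
    fix j
    have "L2_norm LM (\<lambda>x. dirderiv u (axis j 1) x - (\<Sum>i\<in>I. gi i j x)) = L2_norm LM (\<lambda>x. \<Sum>i\<in>I. dirderiv (v i) (axis j 1) x - gi i j x)"
      by (simp add: Du sum_subtractf)
    also have "\<dots> \<le> (\<Sum>i\<in>I. e)"
      by (rule order_trans[OF L2_norm_sum_le[OF I(2)] sum_mono]) (use L v in auto)
    finally show "L2_norm LM (\<lambda>x. dirderiv u (axis j 1) x - (\<Sum>i\<in>I. gi i j x)) \<le> \<eta> / 4" using ce by simp
  qed
  then show ?thesis using that[OF u] by simp
qed

end

section \<open>Traces\<close>

text \<open>The geometric rate makes the increments summable in L1, the measure being finite. Hence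
  the sequence converges almost everywhere, and Fatou's lemma passes the rate on to the
  limit.\<close>

lemma L2_fast_Cauchy_converges:
  fixes v :: "nat \<Rightarrow> 'a \<Rightarrow> real"
  assumes fin: "finite_measure M" and v: "\<And>m. v m \<in> L2 M"
    and cauchy: "\<And>m k. m \<le> k \<Longrightarrow> L2_norm M (\<lambda>x. v m x - v k x) \<le> A * (1/2)^m"
  obtains g where "g \<in> L2 M" "\<And>m. L2_norm M (\<lambda>x. v m x - g x) \<le> A * (1/2)^m"
proof -
  interpret finite_measure M by fact
  have vm[measurable]: "v m \<in> borel_measurable M" for m using v by (rule L2_D)
  have A: "A \<ge> 0" using cauchy[of 0 0] L2_norm_nonneg[of M "\<lambda>x. v 0 x - v 0 x"] by simp
  define b where "b = L2_norm M (\<lambda>x. 1)"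
  have one: "(\<lambda>x. 1) \<in> L2 M" by (rule L2_bounded[OF fin, of _ 1]) auto
  let ?d = "\<lambda>m x. v m x - v (Suc m) x"
  have dL: "?d m \<in> L2 M" for m by (intro L2_diff v)
  \<comment> \<open>Cauchy-Schwarz against the constant function 1, whose norm is \<open>b\<close>,
    turns the L2 rate into an L1 rate.\<close>
  have nb: "(\<integral>\<^sup>+x. ennreal \<bar>?d m x\<bar> \<partial>M) \<le> ennreal (A * b * (1/2)^m)" for m
  proof -
    have abs: "(\<lambda>x. \<bar>?d m x\<bar>) \<in> L2 M" using dL[of m] by (auto simp: L2_def)
    have i: "integrable M (\<lambda>x. \<bar>?d m x\<bar>)" by (rule L2_integrable[OF fin abs])
    have "(LINT x|M. \<bar>?d m x\<bar>) \<le> L2_norm M (\<lambda>x. \<bar>?d m x\<bar>) * b"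
      using L2_Cauchy_Schwarz[OF abs one] by (simp add: b_def)
    also have "L2_norm M (\<lambda>x. \<bar>?d m x\<bar>) = L2_norm M (?d m)" by (simp add: L2_norm_def)
    also have "L2_norm M (?d m) * b \<le> (A * (1/2)^m) * b"
      by (intro mult_right_mono cauchy) (auto simp: b_def L2_norm_nonneg)
    finally show ?thesis using nn_integral_eq_integral[OF i] by (simp add: ennreal_leI mult_ac)
  qed
  have "(\<integral>\<^sup>+x. (\<Sum>m. ennreal \<bar>?d m x\<bar>) \<partial>M) = (\<Sum>m. \<integral>\<^sup>+x. ennreal \<bar>?d m x\<bar> \<partial>M)"
    by (rule nn_integral_suminf) measurable
  also have "\<dots> \<le> (\<Sum>m. ennreal (A * b * (1/2)^m))"
    by (intro suminf_le nb) auto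
  also have "\<dots> < \<infinity>"
  proof -
    have "summable (\<lambda>m. A * b * (1/2::real)^m)" by (intro summable_mult summable_geometric) simp
    then have "(\<Sum>m. ennreal (A * b * (1/2)^m)) \<noteq> top"
      using A by (intro ennreal_suminf_neq_top) (auto simp: b_def L2_norm_nonneg)
    then show ?thesis by (simp add: top.not_eq_extremum)
  qed
  finally have "AE x in M. (\<Sum>m. ennreal \<bar>?d m x\<bar>) \<noteq> \<infinity>"
    by (intro nn_integral_noteq_infinite) auto
  then have conv: "AE x in M. convergent (\<lambda>m. v m x)"
  proof eventually_elim
    case (elim x)
    then have "summable (\<lambda>m. \<bar>?d m x\<bar>)" by (intro summable_suminf_not_top) auto
    then have "summable (\<lambda>m. ?d m x)" by (rule summable_rabs_cancel)
    then have "(\<lambda>n. \<Sum>m<n. ?d m x) \<longlonglongrightarrow> suminf (\<lambda>m. ?d m x)" by (rule summable_LIMSEQ)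
    moreover have "(\<Sum>m<n. ?d m x) = v 0 x - v n x" for n by (induction n) auto
    ultimately have "(\<lambda>n. v 0 x - (v 0 x - v n x)) \<longlonglongrightarrow> v 0 x - suminf (\<lambda>m. ?d m x)"
      by (intro tendsto_diff tendsto_const) simp
    then show ?case by (auto simp: convergent_def)
  qed
  define g where "g x = lim (\<lambda>m. v m x)" for x
  have gm[measurable]: "g \<in> borel_measurable M" unfolding g_def[abs_def] by measurable
  have lim: "AE x in M. (\<lambda>m. v m x) \<longlonglongrightarrow> g x"
    using conv by eventually_elim (simp add: g_def convergent_LIMSEQ_iff)
  have le: "(\<integral>\<^sup>+x. ennreal ((v m x - g x)\<^sup>2) \<partial>M) \<le> ennreal ((A * (1/2)^m)\<^sup>2)" for m
  proof -
    have "(\<integral>\<^sup>+x. ennreal ((v m x - g x)\<^sup>2) \<partial>M) = (\<integral>\<^sup>+x. liminf (\<lambda>k. ennreal ((v m x - v k x)\<^sup>2)) \<partial>M)"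
    proof (rule nn_integral_cong_AE)
      show "AE x in M. ennreal ((v m x - g x)\<^sup>2) = liminf (\<lambda>k. ennreal ((v m x - v k x)\<^sup>2))"
        using lim
      proof eventually_elim
        case (elim x)
        have "(\<lambda>k. ennreal ((v m x - v k x)\<^sup>2)) \<longlonglongrightarrow> ennreal ((v m x - g x)\<^sup>2)"
          by (intro tendsto_ennrealI tendsto_intros elim)
        from lim_imp_Liminf[OF sequentially_bot this] show ?case by (rule sym)
      qed
    qed
    also have "\<dots> \<le> liminf (\<lambda>k. \<integral>\<^sup>+x. ennreal ((v m x - v k x)\<^sup>2) \<partial>M)"
      by (rule nn_integral_liminf) measurable
    also have "\<dots> \<le> ennreal ((A * (1/2)^m)\<^sup>2)"
    proof (rule Liminf_le)
      show "eventually (\<lambda>k. (\<integral>\<^sup>+x. ennreal ((v m x - v k x)\<^sup>2) \<partial>M) \<le> ennreal ((A * (1/2)^m)\<^sup>2)) sequentially"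
        using eventually_ge_at_top[of m]
      proof eventually_elim
        case (elim k)
        have i: "integrable M (\<lambda>x. (v m x - v k x)\<^sup>2)" by (intro L2_D(2) L2_diff v)
        have "(LINT x|M. (v m x - v k x)\<^sup>2) \<le> (A * (1/2)^m)\<^sup>2"
          unfolding L2_norm_sq[symmetric] by (intro power_mono cauchy elim L2_norm_nonneg)
        then show ?case using nn_integral_eq_integral[OF i] by (simp add: ennreal_leI)
      qed
    qed simp
    finally show ?thesis .
  qed
  have i: "integrable M (\<lambda>x. (v m x - g x)\<^sup>2)" for m
    using le[of m] by (intro integrableI_nonneg) (auto intro: le_less_trans)
  have dg: "(\<lambda>x. v m x - g x) \<in> L2 M" for m using i[of m] by (simp add: L2_def)
  show ?thesis
  proof (rule that[of g])
    show "g \<in> L2 M" using L2_diff[OF v[of 0] dg[of 0]] by simp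
    show "L2_norm M (\<lambda>x. v m x - g x) \<le> A * (1/2)^m" for m
    proof -
      have "ennreal (LINT x|M. (v m x - g x)\<^sup>2) \<le> ennreal ((A * (1/2)^m)\<^sup>2)"
        using le[of m] nn_integral_eq_integral[OF i[of m]] by simp
      then have "(LINT x|M. (v m x - g x)\<^sup>2) \<le> (A * (1/2)^m)\<^sup>2" by simp
      then show ?thesis unfolding L2_norm_def using A by (intro real_le_lsqrt) auto
    qed
  qed
qed

context C2_domain begin

lemma trace_exists:
  assumes f: "f \<in> H1 \<Omega>" shows "\<exists>g. has_trace \<Omega> f g"
proof -
  obtain C where C: "C > 0" "\<And>v. Ck 1 v \<Longrightarrow> L2_norm \<sigma> v \<le> C * H1_norm \<Omega> v" using trace_inequality by blast
  have "\<forall>m::nat. \<exists>v. Ck 1 v \<and> H1_norm \<Omega> (\<lambda>x. v x - f x) \<le> (1/2)^m"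
  proof
    fix m :: nat
    have "(1/2::real)^m > 0" by simp
    from smooth_dense_H1[OF f this] show "\<exists>v. Ck 1 v \<and> H1_norm \<Omega> (\<lambda>x. v x - f x) \<le> (1/2)^m" by blast
  qed
  from choice[OF this] obtain v where v: "\<And>m. Ck 1 (v m)" "\<And>m. H1_norm \<Omega> (\<lambda>x. v m x - f x) \<le> (1/2)^m" by blast
  have vL: "v m \<in> L2 \<sigma>" for m by (intro continuous_L2_\<sigma> Ck_continuous[OF v(1)])
  \<comment> \<open>\<open>H1_norm_diff_le\<close> contributes the factor 4, and both approximants
    are within \<open>(1/2)^m\<close> of \<open>f\<close>; together this gives 8.\<close>
  have cauchy: "L2_norm \<sigma> (\<lambda>x. v m x - v k x) \<le> (8 * C) * (1/2)^m" if "m \<le> k" for m k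
  proof -
    have vf: "(\<lambda>x. v i x - f x) \<in> H1 \<Omega>" for i by (intro H1_diff Ck_H1 v f)
    have "L2_norm \<sigma> (\<lambda>x. v m x - v k x) \<le> C * H1_norm \<Omega> (\<lambda>x. v m x - v k x)"
      by (intro C(2) Ck_diff v)
    also have "H1_norm \<Omega> (\<lambda>x. v m x - v k x) \<le> 4 * (H1_norm \<Omega> (\<lambda>x. v m x - f x) + H1_norm \<Omega> (\<lambda>x. v k x - f x))"
      using H1_norm_diff_le[OF vf[of m] vf[of k]] by simp
    also have "\<dots> \<le> 4 * ((1/2)^m + (1/2)^m)"
      using that by (intro mult_left_mono add_mono v(2) order_trans[OF v(2)] power_decreasing) auto
    finally show ?thesis using C(1) by (simp add: mult_left_mono)
  qed
  obtain g where g: "g \<in> L2 \<sigma>" "\<And>m. L2_norm \<sigma> (\<lambda>x. v m x - g x) \<le> (8 * C) * (1/2)^m"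
    using L2_fast_Cauchy_converges[OF finite_measure_\<sigma> vL cauchy] by blast
  have lim: "(\<lambda>m. K * (1/2::real)^m) \<longlonglongrightarrow> 0" for K
    using tendsto_mult_right[OF LIMSEQ_power_zero[of "1/2::real"], of K] tendsto_mult_left[OF LIMSEQ_power_zero[of "1/2::real"], of K] by simp
  have "(\<lambda>m. H1_norm \<Omega> (\<lambda>x. v m x - f x)) \<longlonglongrightarrow> 0"
    by (rule tendsto_sandwich[OF _ _ tendsto_const lim[of 1]]) (auto simp: H1_norm_nonneg v(2))
  moreover have "(\<lambda>m. L2_norm \<sigma> (\<lambda>x. v m x - g x)) \<longlonglongrightarrow> 0"
    by (rule tendsto_sandwich[OF _ _ tendsto_const lim[of "8 * C"]]) (auto simp: L2_norm_nonneg g(2))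
  ultimately show ?thesis unfolding has_trace_def using f g(1) v(1) by blast
qed

lemma trace_on_has_trace: "f \<in> H1 \<Omega> \<Longrightarrow> has_trace \<Omega> f (trace_on \<Omega> f)"
  unfolding trace_on_def by (rule someI_ex[OF trace_exists])

lemma trace_bound:
  obtains C where "C > 0" "\<And>f g. has_trace \<Omega> f g \<Longrightarrow> L2_norm \<sigma> g \<le> C * H1_norm \<Omega> f"
proof -
  obtain C where C: "C > 0" "\<And>v. Ck 1 v \<Longrightarrow> L2_norm \<sigma> v \<le> C * H1_norm \<Omega> v" using trace_inequality by blast
  have "L2_norm \<sigma> g \<le> (4 * C) * H1_norm \<Omega> f" if t: "has_trace \<Omega> f g" for f g
  proof -
    obtain v where f: "f \<in> H1 \<Omega>" and g: "g \<in> L2 \<sigma>" and v: "\<And>m. Ck 1 (v m)" "(\<lambda>m. H1_norm \<Omega> (\<lambda>x. v m x - f x)) \<longlonglongrightarrow> 0"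
        "(\<lambda>m. L2_norm \<sigma> (\<lambda>x. v m x - g x)) \<longlonglongrightarrow> 0"
      using t unfolding has_trace_def by blast
    have "(\<lambda>m. L2_norm \<sigma> (v m)) \<longlonglongrightarrow> L2_norm \<sigma> g"
      by (rule L2_limit_norm[OF continuous_L2_\<sigma>[OF Ck_continuous[OF v(1)]] g v(3)])
    moreover have "(\<lambda>m. C * (4 * (H1_norm \<Omega> (\<lambda>x. v m x - f x) + H1_norm \<Omega> f))) \<longlonglongrightarrow> C * (4 * (0 + H1_norm \<Omega> f))"
      by (intro tendsto_intros v)
    moreover have "L2_norm \<sigma> (v m) \<le> C * (4 * (H1_norm \<Omega> (\<lambda>x. v m x - f x) + H1_norm \<Omega> f))" for m
    proof -
      have "H1_norm \<Omega> (v m) \<le> 4 * (H1_norm \<Omega> (\<lambda>x. v m x - f x) + H1_norm \<Omega> f)"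
        using H1_norm_add_le[OF H1_diff[OF Ck_H1[OF v(1)[of m]] f] f] by simp
      then show ?thesis using C(1) order_trans[OF C(2)[OF v(1)[of m]]] by (simp add: mult_left_mono)
    qed
    ultimately have "L2_norm \<sigma> g \<le> C * (4 * (0 + H1_norm \<Omega> f))" by (intro LIMSEQ_le) auto
    then show ?thesis by simp
  qed
  then show ?thesis using that[of "4 * C"] C(1) by simp
qed

lemma has_trace_add:
  assumes "has_trace \<Omega> f g" "has_trace \<Omega> f' g'"
  shows "has_trace \<Omega> (\<lambda>x. f x + f' x) (\<lambda>x. g x + g' x)"
proof -
  obtain v where f: "f \<in> H1 \<Omega>" and g: "g \<in> L2 \<sigma>" and v: "\<And>m. Ck 1 (v m)" "(\<lambda>m. H1_norm \<Omega> (\<lambda>x. v m x - f x)) \<longlonglongrightarrow> 0"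
        "(\<lambda>m. L2_norm \<sigma> (\<lambda>x. v m x - g x)) \<longlonglongrightarrow> 0"
    using assms(1) unfolding has_trace_def by blast
  obtain v' where f': "f' \<in> H1 \<Omega>" and g': "g' \<in> L2 \<sigma>" and v': "\<And>m. Ck 1 (v' m)" "(\<lambda>m. H1_norm \<Omega> (\<lambda>x. v' m x - f' x)) \<longlonglongrightarrow> 0"
        "(\<lambda>m. L2_norm \<sigma> (\<lambda>x. v' m x - g' x)) \<longlonglongrightarrow> 0"
    using assms(2) unfolding has_trace_def by blast
  note vL = continuous_L2_\<sigma>[OF Ck_continuous[OF v(1)]] continuous_L2_\<sigma>[OF Ck_continuous[OF v'(1)]]
  have eq: "(\<lambda>x. v m x + v' m x - (k x + k' x)) = (\<lambda>x. (v m x - k x) + (v' m x - k' x))" for m and k k' :: "_ \<Rightarrow> real"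
    by auto
  have "(\<lambda>m. H1_norm \<Omega> (\<lambda>x. v m x + v' m x - (f x + f' x))) \<longlonglongrightarrow> 0"
  proof (rule tendsto_sandwich[OF _ _ tendsto_const])
    show "(\<lambda>m. 4 * (H1_norm \<Omega> (\<lambda>x. v m x - f x) + H1_norm \<Omega> (\<lambda>x. v' m x - f' x))) \<longlonglongrightarrow> 0"
      using tendsto_mult_left[OF tendsto_add[OF v(2) v'(2)], of 4] by simp
    show "eventually (\<lambda>m. H1_norm \<Omega> (\<lambda>x. v m x + v' m x - (f x + f' x)) \<le> 4 * (H1_norm \<Omega> (\<lambda>x. v m x - f x) + H1_norm \<Omega> (\<lambda>x. v' m x - f' x))) sequentially"
      unfolding eq by (intro always_eventually allI H1_norm_add_le H1_diff Ck_H1 v v' f f')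
  qed (simp add: H1_norm_nonneg)
  moreover have "(\<lambda>m. L2_norm \<sigma> (\<lambda>x. v m x + v' m x - (g x + g' x))) \<longlonglongrightarrow> 0"
  proof (rule tendsto_sandwich[OF _ _ tendsto_const])
    show "(\<lambda>m. L2_norm \<sigma> (\<lambda>x. v m x - g x) + L2_norm \<sigma> (\<lambda>x. v' m x - g' x)) \<longlonglongrightarrow> 0"
      using tendsto_add[OF v(3) v'(3)] by simp
    show "eventually (\<lambda>m. L2_norm \<sigma> (\<lambda>x. v m x + v' m x - (g x + g' x)) \<le> L2_norm \<sigma> (\<lambda>x. v m x - g x) + L2_norm \<sigma> (\<lambda>x. v' m x - g' x)) sequentially"
      unfolding eq by (intro always_eventually allI L2_norm_triangle L2_diff vL g g')
  qed (simp add: L2_norm_nonneg)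
  moreover have "\<forall>m. Ck 1 (\<lambda>x. v m x + v' m x)" by (intro allI Ck_add v v')
  ultimately show ?thesis
    unfolding has_trace_def using H1_add[OF f f'] L2_add[OF g g'] by (intro conjI exI[of _ "\<lambda>m x. v m x + v' m x"]) auto
qed

lemma has_trace_scale:
  assumes "has_trace \<Omega> f g"
  shows "has_trace \<Omega> (\<lambda>x. c * f x) (\<lambda>x. c * g x)"
proof -
  obtain v where f: "f \<in> H1 \<Omega>" and g: "g \<in> L2 \<sigma>" and v: "\<And>m. Ck 1 (v m)" "(\<lambda>m. H1_norm \<Omega> (\<lambda>x. v m x - f x)) \<longlonglongrightarrow> 0"
        "(\<lambda>m. L2_norm \<sigma> (\<lambda>x. v m x - g x)) \<longlonglongrightarrow> 0"
    using assms(1) unfolding has_trace_def by blast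
  have "H1_norm \<Omega> (\<lambda>x. c * v m x - c * f x) = \<bar>c\<bar> * H1_norm \<Omega> (\<lambda>x. v m x - f x)" for m
    using H1_norm_scale[OF H1_diff[OF Ck_H1[OF v(1)[of m]] f], of c] by (simp add: right_diff_distrib)
  then have "(\<lambda>m. H1_norm \<Omega> (\<lambda>x. c * v m x - c * f x)) \<longlonglongrightarrow> 0"
    using tendsto_mult_left[OF v(2), of "\<bar>c\<bar>"] by simp
  moreover have "L2_norm \<sigma> (\<lambda>x. c * v m x - c * g x) = \<bar>c\<bar> * L2_norm \<sigma> (\<lambda>x. v m x - g x)" for m
    using L2_norm_scale[of \<sigma> c "\<lambda>x. v m x - g x"] by (simp add: right_diff_distrib)
  then have "(\<lambda>m. L2_norm \<sigma> (\<lambda>x. c * v m x - c * g x)) \<longlonglongrightarrow> 0"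
    using tendsto_mult_left[OF v(3), of "\<bar>c\<bar>"] by simp
  moreover have "\<forall>m. Ck 1 (\<lambda>x. c * v m x)" by (intro allI Ck_mult Ck_const v)
  ultimately show ?thesis
    unfolding has_trace_def using H1_scale[OF f] L2_scale[OF g] by (intro conjI exI[of _ "\<lambda>m x. c * v m x"]) auto
qed

lemma has_trace_diff:
  assumes "has_trace \<Omega> f g" "has_trace \<Omega> f' g'"
  shows "has_trace \<Omega> (\<lambda>x. f x - f' x) (\<lambda>x. g x - g' x)"
  using has_trace_add[OF assms(1) has_trace_scale[OF assms(2), of "-1"]] by simp

lemma has_trace_L2: "has_trace \<Omega> f g \<Longrightarrow> g \<in> L2 \<sigma>"
  by (simp add: has_trace_def)

lemma has_trace_unique:
  assumes "has_trace \<Omega> f g" "has_trace \<Omega> f g'"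
  shows "AE x in \<sigma>. g x = g' x"
proof -
  obtain C where C: "C > 0" "\<And>f g. has_trace \<Omega> f g \<Longrightarrow> L2_norm \<sigma> g \<le> C * H1_norm \<Omega> f" using trace_bound by blast
  have t: "has_trace \<Omega> (\<lambda>x. 0) (\<lambda>x. g x - g' x)" using has_trace_diff[OF assms] by simp
  have "H1_norm \<Omega> (\<lambda>x. 0) = 0" using H1_norm_eq[OF WP_zero] by (simp add: L2_norm_def)
  then have "L2_norm \<sigma> (\<lambda>x. g x - g' x) \<le> 0" using C(2)[OF t] by simp
  then have "L2_norm \<sigma> (\<lambda>x. g x - g' x) = 0" using L2_norm_nonneg[of \<sigma>] by (intro antisym)
  from L2_norm_eq_0_AE[OF has_trace_L2[OF t] this] show ?thesis by simp
qed

end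

section \<open>Green's formula for traces\<close>

context C2_domain_chart begin

text \<open>The divergence theorem is applied to the smooth approximants of \<open>f\<close> times
  \<open>\<psi>\<close>. Convergence in \<open>H1\<close> handles the volume terms and convergence
  of the boundary values the surface term, since \<open>\<psi>\<close> times a component of the
  normal is square integrable on the boundary.\<close>

lemma Green_local:
  assumes t: "has_trace \<Omega> f g" and w: "WP i f f'" and \<psi>: "Ck 1 \<psi>" and K: "compact K" "K \<subseteq> D" "\<And>y. y \<notin> K \<Longrightarrow> \<psi> y = 0"
  shows "(LINT y|LM. f' y * \<psi> y) + (LINT y|LM. f y * dirderiv \<psi> (axis i 1) y) = (LINT y|\<sigma>. g y * (\<psi> y * nu y $ i))"
proof -
  obtain v where f: "f \<in> H1 \<Omega>" and g: "g \<in> L2 \<sigma>" and v: "\<And>m. Ck 1 (v m)" "(\<lambda>m. H1_norm \<Omega> (\<lambda>x. v m x - f x)) \<longlonglongrightarrow> 0"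
        "(\<lambda>m. L2_norm \<sigma> (\<lambda>x. v m x - g x)) \<longlonglongrightarrow> 0"
    using t unfolding has_trace_def by blast
  let ?D = "\<lambda>h. dirderiv h (axis i 1)"
  have v': "Ck (Suc 0) (v m)" for m using v(1) by simp
  have \<psi>': "Ck (Suc 0) \<psi>" using \<psi> by simp
  have vf: "(\<lambda>x. v m x - f x) \<in> H1 \<Omega>" for m by (intro H1_diff Ck_H1 v f)
  have l1: "(\<lambda>m. L2_norm LM (\<lambda>x. v m x - f x)) \<longlonglongrightarrow> 0"
    by (rule tendsto_sandwich[OF _ _ tendsto_const v(2)]) (auto simp: L2_norm_nonneg L2_le_H1_norm)
  have l2: "(\<lambda>m. L2_norm LM (\<lambda>x. ?D (v m) x - f' x)) \<longlonglongrightarrow> 0"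
  proof (rule tendsto_sandwich[OF _ _ tendsto_const v(2)])
    show "eventually (\<lambda>m. L2_norm LM (\<lambda>x. ?D (v m) x - f' x) \<le> H1_norm \<Omega> (\<lambda>x. v m x - f x)) sequentially"
      by (intro always_eventually allI WP_norm_le[OF WP_diff[OF WP_Ck[OF v(1)] w] vf])
  qed (simp add: L2_norm_nonneg)
  have c\<psi>: "continuous_on UNIV \<psi>" "continuous_on UNIV (?D \<psi>)"
    using Ck_continuous[OF \<psi>] Ck_Suc_continuous_dirderiv[OF \<psi>'] by auto
  note \<psi>L = continuous_L2[OF c\<psi>(1)] continuous_L2[OF c\<psi>(2)]
  note vL = continuous_L2[OF Ck_continuous[OF v(1)]] continuous_L2[OF Ck_Suc_continuous_dirderiv[OF v']]
  have \<psi>n: "(\<lambda>y. \<psi> y * nu y $ i) \<in> L2 \<sigma>"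
  proof -
    have "(\<lambda>y. nu y $ i * \<psi> y) \<in> L2 \<sigma>"
    proof (rule L2_bounded_mult[OF continuous_L2_\<sigma>[OF c\<psi>(1)]])
      show "(\<lambda>y. nu y $ i) \<in> borel_measurable \<sigma>"
        using measurable_compose[OF nu_measurable borel_measurable_continuous_onI[OF linear_continuous_on[OF bounded_linear_vec_nth]]]
        by simp
      show "AE y in \<sigma>. \<bar>nu y $ i\<bar> \<le> 1" using order_trans[OF component_le_norm_cart norm_nu] by simp
    qed
    then show ?thesis by (simp add: mult.commute)
  qed
  have "(LINT y|LM. ?D (v m) y * \<psi> y) + (LINT y|LM. v m y * ?D \<psi> y) = (LINT y|\<sigma>. v m y * (\<psi> y * nu y $ i))" for m
  proof -
    have "(LINT y|LM. dirderiv (\<lambda>y. v m y * \<psi> y) (axis i 1) y) = (LINT y|\<sigma>. (v m y * \<psi> y) * (nu y \<bullet> axis i 1))"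
      by (rule divergence_theorem_local[OF Ck_mult[OF v(1) \<psi>] K(1,2)]) (simp add: K(3))
    moreover have "(LINT y|LM. dirderiv (\<lambda>y. v m y * \<psi> y) (axis i 1) y) = (LINT y|LM. v m y * ?D \<psi> y) + (LINT y|LM. ?D (v m) y * \<psi> y)"
      unfolding dirderiv_mult[OF v' \<psi>']
      by (intro Bochner_Integration.integral_add L2_mult_integrable vL \<psi>L)
    ultimately show ?thesis by (simp add: inner_axis mult.assoc)
  qed
  moreover have "(\<lambda>m. (LINT y|LM. ?D (v m) y * \<psi> y) + (LINT y|LM. v m y * ?D \<psi> y)) \<longlonglongrightarrow> (LINT y|LM. f' y * \<psi> y) + (LINT y|LM. f y * ?D \<psi> y)"
    by (intro tendsto_add L2_limit_integral_mult vL \<psi>L WP_L2[OF w] l1 l2)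
  moreover have "(\<lambda>m. LINT y|\<sigma>. v m y * (\<psi> y * nu y $ i)) \<longlonglongrightarrow> (LINT y|\<sigma>. g y * (\<psi> y * nu y $ i))"
    by (intro L2_limit_integral_mult continuous_L2_\<sigma> Ck_continuous[OF v(1)] g \<psi>n v(3))
  ultimately show ?thesis using LIMSEQ_unique by simp
qed

end

section \<open>Traces of gradients of functions vanishing on the boundary\<close>

context C2_domain begin

lemma H2_D: "f \<in> H2 \<Omega> \<Longrightarrow> f \<in> H1 \<Omega>" "f \<in> H2 \<Omega> \<Longrightarrow> weak_partial \<Omega> j f \<in> H1 \<Omega>"
  by (auto simp: H2_def)

text \<open>For a test function in place of \<open>f\<close>, one more integration by parts leaves a
  mixed second derivative of the bump on each side, and these agree. Only first derivatives of
  \<open>f\<close> occur, so convergence in \<open>H1\<close>, which is all that \<open>H10\<close>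
  offers, suffices for the limit.\<close>

lemma H10_cross_integral:
  fixes a b :: "real^3" and m :: real
  assumes f: "f \<in> H10 \<Omega>"
  defines "\<psi> \<equiv> box_bump m a b"
  shows "(LINT y|LM. weak_partial \<Omega> j f y * dirderiv \<psi> (axis l 1) y) = (LINT y|LM. weak_partial \<Omega> l f y * dirderiv \<psi> (axis j 1) y)"
proof -
  obtain \<eta> where f1: "f \<in> H1 \<Omega>" and t: "\<And>k. test_function \<Omega> (\<eta> k)" and lim: "(\<lambda>k. H1_norm \<Omega> (\<lambda>x. \<eta> k x - f x)) \<longlonglongrightarrow> 0"
    using f unfolding H10_def by blast
  have \<eta>C: "Ck 1 (\<eta> k)" for k using t[of k] unfolding test_function_def by blast
  have \<psi>C: "Ck k \<psi>" for k unfolding \<psi>_def by (rule Ck_box_bump)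
  have D\<psi>: "Ck 1 (dirderiv \<psi> (axis i 1))" for i
    using \<psi>C[of "Suc 1"] by (simp add: axis_in_Basis_iff)
  have c: "dirderiv \<psi> (axis i 1) \<in> L2 LM" for i by (intro continuous_L2 Ck_continuous[OF D\<psi>])
  have l: "(\<lambda>k. L2_norm LM (\<lambda>x. dirderiv (\<eta> k) (axis i 1) x - weak_partial \<Omega> i f x)) \<longlonglongrightarrow> 0" for i
    using lim H1_conv_iff[of \<eta>, OF \<eta>C weak_partial_WP[OF f1]] by blast
  have L: "(\<lambda>k. LINT y|LM. dirderiv (\<eta> k) (axis i 1) y * dirderiv \<psi> (axis i' 1) y) \<longlonglongrightarrow> (LINT y|LM. weak_partial \<Omega> i f y * dirderiv \<psi> (axis i' 1) y)" for i i'
    by (intro L2_limit_integral_mult test_function_L2 t weak_partial_L2 f1 c l)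
  have ibp: "(LINT y|LM. dirderiv (\<eta> k) (axis i 1) y * dirderiv \<psi> (axis i' 1) y) = - (LINT y|LM. dirderiv (dirderiv \<psi> (axis i' 1)) (axis i 1) y * \<eta> k y)" for k i i'
    using integration_by_parts[OF D\<psi>[of i'] t[of k], of "axis i 1"] by (simp add: mult.commute)
  have "(LINT y|LM. dirderiv (\<eta> k) (axis j 1) y * dirderiv \<psi> (axis l 1) y) = (LINT y|LM. dirderiv (\<eta> k) (axis l 1) y * dirderiv \<psi> (axis j 1) y)" for k
    unfolding ibp unfolding \<psi>_def box_bump_mixed_partials[of m a b l j] ..
  then show ?thesis using LIMSEQ_unique[OF L[of j l]] L[of l j] by simp
qed

lemma nu_nth_measurable [measurable]: "(\<lambda>y. nu y $ i) \<in> borel_measurable borel"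
  using measurable_compose[OF nu_measurable borel_measurable_continuous_onI[OF linear_continuous_on[OF bounded_linear_vec_nth]]]
  by simp

lemma abs_nu_nth_le: "\<bar>nu y $ i\<bar> \<le> 1"
  using order_trans[OF component_le_norm_cart norm_nu] by blast

text \<open>Green's formula turns \<open>\<integral> (\<partial>\<^sub>jf n\<^sub>l - \<partial>\<^sub>lf n\<^sub>j) \<psi>\<close> over the boundary into an integral over \<open>\<Omega>\<close> of
  \<open>\<partial>\<^sub>jf \<partial>\<^sub>l\<psi> - \<partial>\<^sub>lf \<partial>\<^sub>j\<psi>\<close>, which vanishes for test functions \<open>f\<close> and hence on \<open>H\<^sup>1\<^sub>0\<close>.\<close>

lemma tangential_trace_eq_0:
  assumes f2: "f \<in> H2 \<Omega>" and f0: "f \<in> H10 \<Omega>"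
  shows "AE x in \<sigma>. trace_on \<Omega> (weak_partial \<Omega> j f) x * nu x $ l = trace_on \<Omega> (weak_partial \<Omega> l f) x * nu x $ j"
proof -
  define g where "g j = trace_on \<Omega> (weak_partial \<Omega> j f)" for j
  have tr: "has_trace \<Omega> (weak_partial \<Omega> j f) (g j)" for j
    unfolding g_def by (rule trace_on_has_trace[OF H2_D(2)[OF f2]])
  have gL: "g j \<in> L2 \<sigma>" for j by (rule has_trace_L2[OF tr])
  have gm: "g j \<in> borel_measurable borel" for j using L2_D(1)[OF gL] by simp
  define k where "k x = g j x * nu x $ l - g l x * nu x $ j" for x
  have km[measurable]: "k \<in> borel_measurable borel" unfolding k_def[abs_def] using gm by measurable
  have gi: "integrable \<sigma> (\<lambda>x. g i x * nu x $ i')" for i i'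
    by (rule integrable_mult_bounded[OF L2_integrable[OF finite_measure_\<sigma> gL], of _ 1]) (simp_all add: abs_nu_nth_le)
  have ki: "integrable \<sigma> k" unfolding k_def[abs_def] by (intro Bochner_Integration.integrable_diff gi)
  have "AE x in \<sigma>. x \<in> ball c r \<longrightarrow> k x = 0" if ch: "boundary_chart_at \<Omega> c r R h" for c r R h
  proof -
    interpret boundary_chart_at \<Omega> c r R h by (rule ch)
    interpret C2_domain_chart \<Omega> c r R h ..
    \<comment> \<open>Green's formula is used for both orders of the indices. In the difference the
      second derivatives of \<open>f\<close> cancel by \<open>mixed\<close>, the products of first
      derivatives by \<open>H10_cross_integral\<close>, and only the boundary terms remain.\<close>
    have bump: "(LINT x|\<sigma>. box_bump m a b x * k x) = 0" if m: "m > 0" and ab: "cbox a b \<subseteq> D" for m a b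
    proof -
      let ?\<psi> = "box_bump m a b"
      have \<psi>0: "?\<psi> y = 0" if "y \<notin> cbox a b" for y using that box_subset_cbox by (intro box_bump_eq_0 m) auto
      have G: "(LINT y|LM. weak_partial \<Omega> i' (weak_partial \<Omega> i f) y * ?\<psi> y) + (LINT y|LM. weak_partial \<Omega> i f y * dirderiv ?\<psi> (axis i' 1) y) = (LINT y|\<sigma>. g i y * (?\<psi> y * nu y $ i'))" for i i'
        by (rule Green_local[OF tr weak_partial_WP[OF H2_D(2)[OF f2]] Ck_box_bump compact_cbox ab \<psi>0])
      have mixed: "AE x in LM. weak_partial \<Omega> l (weak_partial \<Omega> j f) x = weak_partial \<Omega> j (weak_partial \<Omega> l f) x"
        by (rule WP_mixed_partials[OF weak_partial_WP[OF H2_D(1)[OF f2]] weak_partial_WP[OF H2_D(1)[OF f2]] weak_partial_WP[OF H2_D(2)[OF f2]] weak_partial_WP[OF H2_D(2)[OF f2]]])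
      have "(LINT y|LM. weak_partial \<Omega> l (weak_partial \<Omega> j f) y * ?\<psi> y) = (LINT y|LM. weak_partial \<Omega> j (weak_partial \<Omega> l f) y * ?\<psi> y)"
        using mixed L2_D(1)[OF weak_partial_L2[OF H2_D(2)[OF f2]]] continuous_measurable[OF Ck_continuous[OF Ck_box_bump]]
        by (intro integral_cong_AE) auto
      then have "(LINT y|\<sigma>. g j y * (?\<psi> y * nu y $ l)) = (LINT y|\<sigma>. g l y * (?\<psi> y * nu y $ j))"
        using G[of l j] G[of j l] H10_cross_integral[OF f0, of j m a b l] by simp
      moreover have "integrable \<sigma> (\<lambda>y. g i y * (?\<psi> y * nu y $ i'))" for i i'
      proof (rule integrable_mult_bounded[OF L2_integrable[OF finite_measure_\<sigma> gL], of _ 1])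
        have [measurable]: "?\<psi> \<in> borel_measurable borel" by (intro borel_measurable_continuous_onI Ck_continuous[OF Ck_box_bump])
        show "(\<lambda>y. ?\<psi> y * nu y $ i') \<in> borel_measurable \<sigma>" unfolding measurable_\<sigma> by measurable
        show "\<bar>?\<psi> y * nu y $ i'\<bar> \<le> 1" for y
          unfolding abs_mult using box_bump_nonneg[of m a b y] box_bump_le_1[of m a b y] abs_nu_nth_le[of y i']
          by (intro mult_le_one) auto
      qed
      ultimately have "(LINT y|\<sigma>. g j y * (?\<psi> y * nu y $ l) - g l y * (?\<psi> y * nu y $ j)) = 0" by simp
      then show ?thesis by (simp add: k_def algebra_simps)
    qed
    show ?thesis
    proof (rule AE_eq_0_if_box_integrals_eq_0[OF _ sets_\<sigma> ki open_ball])
      show "sigma_finite_measure \<sigma>" using finite_measure_\<sigma> by (simp add: finite_measure_def)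
      fix a b assume ab: "cbox a b \<subseteq> D"
      have "(\<lambda>m. LINT x|\<sigma>. box_bump (real (Suc m)) a b x * k x) \<longlonglongrightarrow> (LINT x|\<sigma>. indicator (box a b) x * k x)"
      proof (rule integral_dominated_convergence[where w="\<lambda>x. \<bar>k x\<bar>"])
        have [measurable]: "box_bump m a b \<in> borel_measurable borel" for m
          by (intro borel_measurable_continuous_onI Ck_continuous[OF Ck_box_bump])
        show "(\<lambda>x. indicator (box a b) x * k x) \<in> borel_measurable \<sigma>" "(\<lambda>x. box_bump (real (Suc m)) a b x * k x) \<in> borel_measurable \<sigma>" for m
          unfolding measurable_\<sigma> by measurable
        show "integrable \<sigma> (\<lambda>x. \<bar>k x\<bar>)" using ki by simp
        show "AE x in \<sigma>. (\<lambda>m. box_bump (real (Suc m)) a b x * k x) \<longlonglongrightarrow> indicator (box a b) x * k x"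
          by (intro AE_I2 tendsto_intros box_bump_tendsto)
        show "AE x in \<sigma>. norm (box_bump (real (Suc m)) a b x * k x) \<le> \<bar>k x\<bar>" for m
          using box_bump_nonneg[of "real (Suc m)" a b] box_bump_le_1[of "real (Suc m)" a b]
          by (intro AE_I2) (simp add: abs_mult mult_left_le_one_le del: of_nat_Suc)
      qed
      moreover have "(LINT x|\<sigma>. box_bump (real (Suc m)) a b x * k x) = 0" for m by (rule bump[OF _ ab]) simp
      ultimately have "(\<lambda>m. 0) \<longlonglongrightarrow> (LINT x|\<sigma>. indicator (box a b) x * k x)" by simp
      then show "(LINT x|\<sigma>. indicator (box a b) x * k x) = 0" using LIMSEQ_unique tendsto_const by blast
    qed
  qed
  note local = this
  \<comment> \<open>Finitely many chart balls cover the boundary, which carries the whole measure,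
    so the local null sets can be united.\<close>
  obtain N :: nat and c r R h where ch: "\<And>i. i < N \<Longrightarrow> boundary_chart_at \<Omega> (c i) (r i) (R i) (h i)" and cov: "S \<subseteq> (\<Union>i<N. ball (c i) (r i))"
    using ex_atlas by blast
  have "AE x in \<sigma>. \<forall>i\<in>{..<N}. x \<in> ball (c i) (r i) \<longrightarrow> k x = 0"
    using local[OF ch] by (intro AE_finite_allI) auto
  then have "AE x in \<sigma>. k x = 0" using AE_\<sigma>_S by eventually_elim (use cov in blast)
  then show ?thesis by (simp add: k_def g_def)
qed

section \<open>The bilinear form\<close>

text \<open>The derivatives of one first derivative form a slice of the Hessian, and
  \<open>H2_norm\<close> contains the whole of it.\<close>

lemma H1_norm_weak_partial_le:
  assumes u: "u \<in> H2_vec \<Omega>"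
  shows "H1_norm \<Omega> (weak_partial \<Omega> j (\<lambda>x. u x $ i)) \<le> H2_vec_norm \<Omega> u"
proof -
  let ?f = "\<lambda>x. u x $ i"
  have "(H1_norm \<Omega> (weak_partial \<Omega> j ?f))\<^sup>2 = (L2_norm LM (weak_partial \<Omega> j ?f))\<^sup>2 + (\<Sum>l\<in>UNIV. (L2_norm LM (weak_partial \<Omega> l (weak_partial \<Omega> j ?f)))\<^sup>2)"
    unfolding H1_norm_def by (intro real_sqrt_pow2 add_nonneg_nonneg sum_nonneg) auto
  also have "\<dots> \<le> (\<Sum>j\<in>UNIV. (L2_norm LM (weak_partial \<Omega> j ?f))\<^sup>2) + (\<Sum>j\<in>UNIV. \<Sum>l\<in>UNIV. (L2_norm LM (weak_partial \<Omega> l (weak_partial \<Omega> j ?f)))\<^sup>2)"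
    by (intro add_mono member_le_sum[of j UNIV "\<lambda>j. (L2_norm LM (weak_partial \<Omega> j ?f))\<^sup>2"]
        member_le_sum[of j UNIV "\<lambda>j. \<Sum>l\<in>UNIV. (L2_norm LM (weak_partial \<Omega> l (weak_partial \<Omega> j ?f)))\<^sup>2"] sum_nonneg) auto
  also have "\<dots> \<le> (H2_norm \<Omega> ?f)\<^sup>2"
  proof -
    have "(H2_norm \<Omega> ?f)\<^sup>2 = (L2_norm LM ?f)\<^sup>2 + (\<Sum>j\<in>UNIV. (L2_norm LM (weak_partial \<Omega> j ?f))\<^sup>2) + (\<Sum>i\<in>UNIV. \<Sum>j\<in>UNIV. (L2_norm LM (weak_partial \<Omega> i (weak_partial \<Omega> j ?f)))\<^sup>2)"
      unfolding H2_norm_def by (intro real_sqrt_pow2 add_nonneg_nonneg sum_nonneg) auto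
    then show ?thesis
      using sum.swap[of "\<lambda>i j. (L2_norm LM (weak_partial \<Omega> i (weak_partial \<Omega> j ?f)))\<^sup>2" UNIV UNIV] by simp
  qed
  also have "\<dots> \<le> (\<Sum>i\<in>UNIV. (H2_norm \<Omega> (\<lambda>x. u x $ i))\<^sup>2)"
    by (intro member_le_sum[of i UNIV "\<lambda>i. (H2_norm \<Omega> (\<lambda>x. u x $ i))\<^sup>2"]) auto
  finally show ?thesis unfolding H2_vec_norm_def by (rule real_le_rsqrt)
qed

lemma H2_vec_norm_nonneg: "0 \<le> H2_vec_norm \<Omega> u"
  unfolding H2_vec_norm_def by (intro real_sqrt_ge_zero sum_nonneg) auto

lemma wgrad_nth: "wgrad \<Omega> u x $ i $ j = weak_partial \<Omega> j (\<lambda>y. u y $ i) x"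
  by (simp add: wgrad_def)

lemma wgrad_H1: "u \<in> H2_vec \<Omega> \<Longrightarrow> weak_partial \<Omega> j (\<lambda>x. u x $ i) \<in> H1 \<Omega>"
  unfolding H2_vec_def using H2_D(2) by blast

lemma wcurl_nth:
  "(\<lambda>x. wcurl \<Omega> u x $ 1) = (\<lambda>x. weak_partial \<Omega> 2 (\<lambda>y. u y $ 3) x - weak_partial \<Omega> 3 (\<lambda>y. u y $ 2) x)"
  "(\<lambda>x. wcurl \<Omega> u x $ 2) = (\<lambda>x. weak_partial \<Omega> 3 (\<lambda>y. u y $ 1) x - weak_partial \<Omega> 1 (\<lambda>y. u y $ 3) x)"
  "(\<lambda>x. wcurl \<Omega> u x $ 3) = (\<lambda>x. weak_partial \<Omega> 1 (\<lambda>y. u y $ 2) x - weak_partial \<Omega> 2 (\<lambda>y. u y $ 1) x)"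
  by (simp_all add: wcurl_def wgrad_def vector_3)

lemma wcurl_H1:
  assumes u: "u \<in> H2_vec \<Omega>"
  shows "(\<lambda>x. wcurl \<Omega> u x $ i) \<in> H1 \<Omega>" "H1_norm \<Omega> (\<lambda>x. wcurl \<Omega> u x $ i) \<le> 8 * H2_vec_norm \<Omega> u"
proof -
  \<comment> \<open>The factor 4 of \<open>H1_norm_diff_le\<close> applies to two gradient entries,
    each bounded by the norm of \<open>u\<close>; this is the 8.\<close>
  have b: "H1_norm \<Omega> (\<lambda>x. weak_partial \<Omega> k (\<lambda>y. u y $ l) x - weak_partial \<Omega> k' (\<lambda>y. u y $ l') x) \<le> 8 * H2_vec_norm \<Omega> u" for k l k' l'
    using H1_norm_diff_le[OF wgrad_H1[OF u, of k l] wgrad_H1[OF u, of k' l']] H1_norm_weak_partial_le[OF u, of k l] H1_norm_weak_partial_le[OF u, of k' l']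
    by simp
  have "i = 1 \<or> i = 2 \<or> i = 3" using exhaust_3 by blast
  then show "(\<lambda>x. wcurl \<Omega> u x $ i) \<in> H1 \<Omega>" "H1_norm \<Omega> (\<lambda>x. wcurl \<Omega> u x $ i) \<le> 8 * H2_vec_norm \<Omega> u"
    using b by (auto simp: wcurl_nth intro!: H1_diff wgrad_H1[OF u])
qed

definition gcurl :: "(real^3 \<Rightarrow> real^3) \<Rightarrow> 3 \<Rightarrow> 3 \<Rightarrow> real^3 \<Rightarrow> real" where
  "gcurl u i j = weak_partial \<Omega> j (\<lambda>x. wcurl \<Omega> u x $ i)"

lemma gcurl_L2:
  assumes u: "u \<in> H2_vec \<Omega>"
  shows "gcurl u i j \<in> L2 LM" "L2_norm LM (gcurl u i j) \<le> 8 * H2_vec_norm \<Omega> u"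
  unfolding gcurl_def
  using weak_partial_L2[OF wcurl_H1(1)[OF u]] order_trans[OF L2_le_H1_norm(2) wcurl_H1(2)[OF u]] by auto

text \<open>Written with \<open>nu\<close>, which vanishes off the boundary, so that the integral
  over the boundary becomes one over the whole measure space and measurability is a question about
  functions on all of space.\<close>

definition boundary_integrand :: "(real^3 \<Rightarrow> real^3) \<Rightarrow> (real^3 \<Rightarrow> real^3) \<Rightarrow> real^3 \<Rightarrow> real" where
  "boundary_integrand u \<phi> x = cross3 (nu x) (vec_trace \<Omega> (wcurl \<Omega> u) x) \<bullet>
     ((\<chi> i j. trace_on \<Omega> (weak_partial \<Omega> j (\<lambda>y. \<phi> y $ i)) x) *v nu x)"

lemma a_form_eq:
  "a_form \<Omega> \<gamma> k u \<phi> = (LINT x|LM. (\<Sum>i\<in>UNIV. \<Sum>j\<in>UNIV. (gcurl u i j x + \<gamma> * gcurl u j i x) * gcurl \<phi> i j x))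
     + k * (LINT x|\<sigma>. boundary_integrand u \<phi> x)"
proof -
  have "(LINT x:S|\<sigma>. cross3 (outward_normal \<Omega> x) (vec_trace \<Omega> (wcurl \<Omega> u) x) \<bullet> normal_deriv \<Omega> \<phi> x) = (LINT x|\<sigma>. boundary_integrand u \<phi> x)"
    unfolding set_lebesgue_integral_def
    by (intro Bochner_Integration.integral_cong refl)
       (simp add: indicator_def nu_def boundary_integrand_def normal_deriv_def wgrad_nth)
  moreover have "G_tensor \<Omega> \<gamma> u x \<bullet> wgrad \<Omega> (wcurl \<Omega> \<phi>) x = (\<Sum>i\<in>UNIV. \<Sum>j\<in>UNIV. (gcurl u i j x + \<gamma> * gcurl u j i x) * gcurl \<phi> i j x)" for x
    by (simp add: inner_vec_def G_tensor_def transpose_def wgrad_nth gcurl_def)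
  ultimately show ?thesis by (simp add: a_form_def)
qed

section \<open>Boundedness of the volume term and of the boundary term\<close>

lemma volume_term_bound:
  assumes u: "u \<in> H2_vec \<Omega>" and \<phi>: "\<phi> \<in> H2_vec \<Omega>" and \<gamma>: "\<bar>\<gamma>\<bar> \<le> 1"
  shows "\<bar>LINT x|LM. (\<Sum>i\<in>UNIV. \<Sum>j\<in>UNIV. (gcurl u i j x + \<gamma> * gcurl u j i x) * gcurl \<phi> i j x)\<bar> \<le> 1152 * H2_vec_norm \<Omega> u * H2_vec_norm \<Omega> \<phi>"
proof -
  have L: "(\<lambda>x. gcurl u i j x + \<gamma> * gcurl u j i x) \<in> L2 LM" for i j
    by (intro L2_add L2_scale gcurl_L2 u)
  have i: "integrable LM (\<lambda>x. (gcurl u i j x + \<gamma> * gcurl u j i x) * gcurl \<phi> i j x)" for i j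
    by (intro L2_mult_integrable L gcurl_L2 \<phi>)
  \<comment> \<open>As \<open>\<bar>\<gamma>\<bar> \<le> 1\<close>, the two summands of
    \<open>G\<close> contribute \<open>8 + 8\<close>; summing over the nine index pairs gives
    \<open>9 * 16 * 8 = 1152\<close>.\<close>
  have b: "\<bar>LINT x|LM. (gcurl u i j x + \<gamma> * gcurl u j i x) * gcurl \<phi> i j x\<bar> \<le> (16 * H2_vec_norm \<Omega> u) * (8 * H2_vec_norm \<Omega> \<phi>)" for i j
  proof -
    have "L2_norm LM (\<lambda>x. gcurl u i j x + \<gamma> * gcurl u j i x) \<le> L2_norm LM (gcurl u i j) + \<bar>\<gamma>\<bar> * L2_norm LM (gcurl u j i)"
      using L2_norm_triangle[OF gcurl_L2(1)[OF u] L2_scale[OF gcurl_L2(1)[OF u]], of i j \<gamma> j i] by (simp add: L2_norm_scale)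
    also have "\<dots> \<le> 8 * H2_vec_norm \<Omega> u + 1 * (8 * H2_vec_norm \<Omega> u)"
      by (intro add_mono mult_mono gcurl_L2 u \<gamma> L2_norm_nonneg) auto
    finally have "L2_norm LM (\<lambda>x. gcurl u i j x + \<gamma> * gcurl u j i x) \<le> 16 * H2_vec_norm \<Omega> u" by simp
    from mult_mono[OF this gcurl_L2(2)[OF \<phi>, of i j]] H2_vec_norm_nonneg[of u] L2_norm_nonneg[of LM "gcurl \<phi> i j"]
    show ?thesis by (intro order_trans[OF L2_Cauchy_Schwarz[OF L gcurl_L2(1)[OF \<phi>]]]) simp
  qed
  have "(LINT x|LM. (\<Sum>i\<in>UNIV. \<Sum>j\<in>UNIV. (gcurl u i j x + \<gamma> * gcurl u j i x) * gcurl \<phi> i j x)) = (\<Sum>i\<in>UNIV. \<Sum>j\<in>UNIV. (LINT x|LM. (gcurl u i j x + \<gamma> * gcurl u j i x) * gcurl \<phi> i j x))"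
    using i by (simp add: Bochner_Integration.integral_sum)
  also have "\<bar>\<dots>\<bar> \<le> (\<Sum>i\<in>(UNIV::3 set). \<Sum>j\<in>(UNIV::3 set). (16 * H2_vec_norm \<Omega> u) * (8 * H2_vec_norm \<Omega> \<phi>))"
    by (intro order_trans[OF sum_abs sum_mono] b)
  finally show ?thesis by simp
qed

lemma trace_measurable:
  assumes "f \<in> H1 \<Omega>" shows "trace_on \<Omega> f \<in> borel_measurable borel"
  using L2_D(1)[OF has_trace_L2[OF trace_on_has_trace[OF assms]]] by simp

lemma boundary_integrand_measurable:
  assumes u: "u \<in> H2_vec \<Omega>" and \<phi>: "\<phi> \<in> H2_vec \<Omega>"
  shows "boundary_integrand u \<phi> \<in> borel_measurable \<sigma>"
proof -
  let ?t = "\<lambda>i x. trace_on \<Omega> (\<lambda>y. wcurl \<Omega> u y $ i) x"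
    and ?m = "\<lambda>i x. \<Sum>j\<in>UNIV. trace_on \<Omega> (weak_partial \<Omega> j (\<lambda>y. \<phi> y $ i)) x * nu x $ j"
  have [measurable]: "?t i \<in> borel_measurable borel" for i
    by (intro trace_measurable wcurl_H1 u)
  have [measurable]: "?m i \<in> borel_measurable borel" for i
    by (intro borel_measurable_sum borel_measurable_times nu_nth_measurable trace_measurable wgrad_H1 \<phi>)
  \<comment> \<open>In components the integrand is a polynomial in traces and entries of the normal,
    all of them Borel functions.\<close>
  have "boundary_integrand u \<phi> = (\<lambda>x. (nu x $ 2 * ?t 3 x - nu x $ 3 * ?t 2 x) * ?m 1 x
      + (nu x $ 3 * ?t 1 x - nu x $ 1 * ?t 3 x) * ?m 2 x + (nu x $ 1 * ?t 2 x - nu x $ 2 * ?t 1 x) * ?m 3 x)"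
    by (rule ext) (simp add: boundary_integrand_def cross3_def inner_vec_def sum_3 vector_3 matrix_vector_mul_component vec_trace_def)
  then show ?thesis unfolding measurable_\<sigma> by (simp only:) measurable
qed

text \<open>\<open>nu\<close> has norm at most 1, so it drops out of the estimate and products of
  two traces remain, which Cauchy-Schwarz and the trace bound can handle.\<close>

lemma boundary_integrand_bound:
  "\<bar>boundary_integrand u \<phi> x\<bar> \<le> (\<Sum>i\<in>UNIV. \<Sum>k\<in>UNIV. \<Sum>j\<in>UNIV. \<bar>trace_on \<Omega> (\<lambda>y. wcurl \<Omega> u y $ i) x\<bar> * \<bar>trace_on \<Omega> (weak_partial \<Omega> j (\<lambda>y. \<phi> y $ k)) x\<bar>)"
proof -
  let ?t = "vec_trace \<Omega> (wcurl \<Omega> u) x" and ?T = "\<chi> i j. trace_on \<Omega> (weak_partial \<Omega> j (\<lambda>y. \<phi> y $ i)) x"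
  have c: "norm (cross3 (nu x) ?t) \<le> norm (nu x) * norm ?t"
  proof (rule power2_le_imp_le)
    show "(norm (cross3 (nu x) ?t))\<^sup>2 \<le> (norm (nu x) * norm ?t)\<^sup>2"
      using norm_cross_dot[of "nu x" ?t] zero_le_power2[of "nu x \<bullet> ?t"] by linarith
  qed simp
  have "\<bar>boundary_integrand u \<phi> x\<bar> \<le> norm (cross3 (nu x) ?t) * norm (?T *v nu x)"
    unfolding boundary_integrand_def by (rule Cauchy_Schwarz_ineq2)
  also have "\<dots> \<le> (\<Sum>i\<in>UNIV. \<bar>?t $ i\<bar>) * (\<Sum>k\<in>UNIV. \<Sum>j\<in>UNIV. \<bar>?T $ k $ j\<bar>)"
  proof (rule mult_mono)
    have "norm (nu x) * norm ?t \<le> 1 * norm ?t" by (intro mult_right_mono norm_nu) auto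
    then show "norm (cross3 (nu x) ?t) \<le> (\<Sum>i\<in>UNIV. \<bar>?t $ i\<bar>)" using c norm_le_l1_cart[of ?t] by linarith
    have "norm (?T *v nu x) \<le> (\<Sum>k\<in>UNIV. \<bar>(?T *v nu x) $ k\<bar>)" by (rule norm_le_l1_cart)
    also have "\<dots> \<le> (\<Sum>k\<in>UNIV. \<Sum>j\<in>UNIV. \<bar>?T $ k $ j\<bar>)"
    proof (rule sum_mono)
      fix k
      have "\<bar>(?T *v nu x) $ k\<bar> \<le> (\<Sum>j\<in>UNIV. \<bar>?T $ k $ j * nu x $ j\<bar>)"
        unfolding matrix_vector_mul_component inner_vec_def by (simp only: inner_real_def) (rule sum_abs)
      also have "\<dots> \<le> (\<Sum>j\<in>UNIV. \<bar>?T $ k $ j\<bar>)"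
        by (intro sum_mono) (simp add: abs_mult mult_left_le abs_nu_nth_le)
      finally show "\<bar>(?T *v nu x) $ k\<bar> \<le> (\<Sum>j\<in>UNIV. \<bar>?T $ k $ j\<bar>)" .
    qed
    finally show "norm (?T *v nu x) \<le> (\<Sum>k\<in>UNIV. \<Sum>j\<in>UNIV. \<bar>?T $ k $ j\<bar>)" .
  qed (auto intro!: sum_nonneg)
  also have "\<dots> = (\<Sum>i\<in>UNIV. \<Sum>k\<in>UNIV. \<Sum>j\<in>UNIV. \<bar>trace_on \<Omega> (\<lambda>y. wcurl \<Omega> u y $ i) x\<bar> * \<bar>trace_on \<Omega> (weak_partial \<Omega> j (\<lambda>y. \<phi> y $ k)) x\<bar>)"
    by (simp only: sum_distrib_right) (simp add: sum_distrib_left vec_trace_def)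
  finally show ?thesis .
qed

lemma boundary_term_bound:
  obtains C where "C > 0" "\<And>u \<phi>. u \<in> H2_vec \<Omega> \<Longrightarrow> \<phi> \<in> H2_vec \<Omega> \<Longrightarrow> \<bar>LINT x|\<sigma>. boundary_integrand u \<phi> x\<bar> \<le> C * H2_vec_norm \<Omega> u * H2_vec_norm \<Omega> \<phi>"
proof -
  obtain C where C: "C > 0" "\<And>f g. has_trace \<Omega> f g \<Longrightarrow> L2_norm \<sigma> g \<le> C * H1_norm \<Omega> f" using trace_bound by blast
  \<comment> \<open>\<open>216 = 27 * 8\<close>: there are 27 index triples, and the components of
    the curl carry the constant 8 of \<open>wcurl_H1\<close>. The trace bound enters twice, whence
    the square of \<open>C\<close>.\<close>
  have "\<bar>LINT x|\<sigma>. boundary_integrand u \<phi> x\<bar> \<le> (216 * C\<^sup>2) * H2_vec_norm \<Omega> u * H2_vec_norm \<Omega> \<phi>" if u: "u \<in> H2_vec \<Omega>" and \<phi>: "\<phi> \<in> H2_vec \<Omega>" for u \<phi>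
  proof -
    let ?t = "\<lambda>i x. \<bar>trace_on \<Omega> (\<lambda>y. wcurl \<Omega> u y $ i) x\<bar>" and ?T = "\<lambda>k j x. \<bar>trace_on \<Omega> (weak_partial \<Omega> j (\<lambda>y. \<phi> y $ k)) x\<bar>"
    have absL: "(\<lambda>x. \<bar>g x\<bar>) \<in> L2 \<sigma>" "L2_norm \<sigma> (\<lambda>x. \<bar>g x\<bar>) = L2_norm \<sigma> g" if "g \<in> L2 \<sigma>" for g
      using that by (auto simp: L2_def L2_norm_def)
    have tL: "?t i \<in> L2 \<sigma>" "L2_norm \<sigma> (?t i) \<le> C * (8 * H2_vec_norm \<Omega> u)" for i
    proof -
      note tr = trace_on_has_trace[OF wcurl_H1(1)[OF u, of i]]
      show "?t i \<in> L2 \<sigma>" by (rule absL(1)[OF has_trace_L2[OF tr]])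
      show "L2_norm \<sigma> (?t i) \<le> C * (8 * H2_vec_norm \<Omega> u)"
        unfolding absL(2)[OF has_trace_L2[OF tr]]
        by (rule order_trans[OF C(2)[OF tr]]) (use C(1) wcurl_H1(2)[OF u] in \<open>simp add: mult_left_mono\<close>)
    qed
    have TL: "?T k j \<in> L2 \<sigma>" "L2_norm \<sigma> (?T k j) \<le> C * H2_vec_norm \<Omega> \<phi>" for k j
    proof -
      note tr = trace_on_has_trace[OF wgrad_H1[OF \<phi>, of j k]]
      show "?T k j \<in> L2 \<sigma>" by (rule absL(1)[OF has_trace_L2[OF tr]])
      show "L2_norm \<sigma> (?T k j) \<le> C * H2_vec_norm \<Omega> \<phi>"
        unfolding absL(2)[OF has_trace_L2[OF tr]]
        by (rule order_trans[OF C(2)[OF tr]]) (use C(1) H1_norm_weak_partial_le[OF \<phi>] in \<open>simp add: mult_left_mono\<close>)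
    qed
    have it: "integrable \<sigma> (\<lambda>x. ?t i x * ?T k j x)" for i k j by (rule L2_mult_integrable[OF tL(1) TL(1)])
    have isum: "integrable \<sigma> (\<lambda>x. \<Sum>i\<in>UNIV. \<Sum>k\<in>UNIV. \<Sum>j\<in>UNIV. ?t i x * ?T k j x)"
      by (intro Bochner_Integration.integrable_sum it)
    have ib: "integrable \<sigma> (boundary_integrand u \<phi>)"
      by (rule Bochner_Integration.integrable_bound[OF isum boundary_integrand_measurable[OF u \<phi>]])
         (intro AE_I2, unfold real_norm_def, rule order_trans[OF boundary_integrand_bound abs_ge_self])
    have "\<bar>LINT x|\<sigma>. boundary_integrand u \<phi> x\<bar> \<le> (LINT x|\<sigma>. \<bar>boundary_integrand u \<phi> x\<bar>)" by (rule integral_abs_bound)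
    also have "\<dots> \<le> (LINT x|\<sigma>. (\<Sum>i\<in>UNIV. \<Sum>k\<in>UNIV. \<Sum>j\<in>UNIV. ?t i x * ?T k j x))"
      by (rule integral_mono[OF integrable_abs[OF ib] isum boundary_integrand_bound])
    also have "\<dots> = (\<Sum>i\<in>UNIV. \<Sum>k\<in>UNIV. \<Sum>j\<in>UNIV. (LINT x|\<sigma>. ?t i x * ?T k j x))"
      using it by (simp add: Bochner_Integration.integral_sum)
    also have "\<dots> \<le> (\<Sum>i\<in>(UNIV::3 set). \<Sum>k\<in>(UNIV::3 set). \<Sum>j\<in>(UNIV::3 set). (C * (8 * H2_vec_norm \<Omega> u)) * (C * H2_vec_norm \<Omega> \<phi>))"
    proof (intro sum_mono)
      fix i k j
      have "(LINT x|\<sigma>. ?t i x * ?T k j x) \<le> L2_norm \<sigma> (?t i) * L2_norm \<sigma> (?T k j)"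
        using L2_Cauchy_Schwarz[OF tL(1) TL(1), of i j k] by linarith
      also have "\<dots> \<le> (C * (8 * H2_vec_norm \<Omega> u)) * (C * H2_vec_norm \<Omega> \<phi>)"
        using C(1) H2_vec_norm_nonneg[of u] by (intro mult_mono tL TL L2_norm_nonneg) auto
      finally show "(LINT x|\<sigma>. ?t i x * ?T k j x) \<le> (C * (8 * H2_vec_norm \<Omega> u)) * (C * H2_vec_norm \<Omega> \<phi>)" .
    qed
    finally show ?thesis by (simp add: power2_eq_square mult_ac)
  qed
  then show ?thesis using that[of "216 * C\<^sup>2"] C(1) by simp
qed

text \<open>On the boundary the gradient traces have the form \<open>\<alpha> \<otimes> n\<close> with \<open>\<alpha> = \<partial>\<^sub>nu\<close>, so the integrand
  becomes \<open>(n \<times> (n \<times> \<alpha>)) \<bullet> \<beta> = (n \<bullet> \<alpha>)(n \<bullet> \<beta>) - \<alpha> \<bullet> \<beta>\<close>, which is symmetric.\<close>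

lemma boundary_integrand_eq:
  assumes u: "u \<in> H2_vec \<Omega>" "u \<in> H10_vec \<Omega>"
  defines "T \<equiv> \<lambda>u x. (\<chi> i j. trace_on \<Omega> (weak_partial \<Omega> j (\<lambda>y. u y $ i)) x) *v nu x"
  shows "AE x in \<sigma>. boundary_integrand u \<phi> x = (nu x \<bullet> T u x) * (nu x \<bullet> T \<phi> x) - T u x \<bullet> T \<phi> x"
proof -
  let ?g = "\<lambda>i j. trace_on \<Omega> (weak_partial \<Omega> j (\<lambda>y. u y $ i))"
  \<comment> \<open>\<open>trace_on\<close> is an arbitrary choice for each function, so it respects
    differences only almost everywhere, by uniqueness of traces.\<close>
  have curl: "AE x in \<sigma>. trace_on \<Omega> (\<lambda>x. weak_partial \<Omega> k (\<lambda>y. u y $ l) x - weak_partial \<Omega> k' (\<lambda>y. u y $ l') x) x = ?g l k x - ?g l' k' x" for k l k' l'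
    by (rule has_trace_unique[OF trace_on_has_trace has_trace_diff[OF trace_on_has_trace trace_on_has_trace]]) (intro H1_diff wgrad_H1 u)+
  have tang: "AE x in \<sigma>. \<forall>i\<in>UNIV. \<forall>j\<in>UNIV. \<forall>l\<in>UNIV. ?g i j x * nu x $ l = ?g i l x * nu x $ j"
  proof (intro AE_finite_allI finite)
    show "AE x in \<sigma>. ?g i j x * nu x $ l = ?g i l x * nu x $ j" for i j l
      by (rule tangential_trace_eq_0) (use u in \<open>auto simp: H2_vec_def H10_vec_def\<close>)
  qed
  show ?thesis
    using AE_\<sigma>_S tang curl[of 2 3 3 2] curl[of 3 1 1 3] curl[of 1 2 2 1]
  proof eventually_elim
    case (elim x)
    define n where "n = nu x"
    define \<alpha> where "\<alpha> = T u x"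
    have n1: "n \<bullet> n = 1" using norm_outward_normal[OF elim(1)] elim(1) by (simp add: n_def nu_def norm_eq_1)
    \<comment> \<open>Contracting the relation \<open>tang\<close> with the normal over
      \<open>l\<close> and using \<open>n \<bullet> n = 1\<close> shows that the gradient trace is
      the dyadic product of the normal derivative \<open>\<alpha>\<close> with
      \<open>n\<close>.\<close>
    have g: "?g i j x = \<alpha> $ i * n $ j" for i j
    proof -
      have "\<alpha> $ i * n $ j = (\<Sum>l\<in>UNIV. (?g i l x * n $ j) * n $ l)"
        by (simp add: \<alpha>_def T_def matrix_vector_mul_component inner_vec_def n_def sum_distrib_left mult_ac)
      also have "\<dots> = (\<Sum>l\<in>UNIV. (?g i j x * n $ l) * n $ l)"
        using elim(2) by (intro sum.cong) (auto simp: n_def)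
      also have "\<dots> = ?g i j x * (n \<bullet> n)" by (simp add: inner_vec_def sum_distrib_left mult.assoc)
      finally show ?thesis by (simp add: n1)
    qed
    have t: "vec_trace \<Omega> (wcurl \<Omega> u) x = cross3 n \<alpha>"
      using elim(3-5) by (simp add: vec_eq_iff forall_3 vec_trace_def wcurl_nth cross3_def vector_3 g mult.commute)
    have "boundary_integrand u \<phi> x = cross3 n (cross3 n \<alpha>) \<bullet> T \<phi> x"
      by (simp add: boundary_integrand_def t n_def T_def)
    also have "cross3 n (cross3 n \<alpha>) = (n \<bullet> \<alpha>) *\<^sub>R n - (n \<bullet> n) *\<^sub>R \<alpha>"
      by (simp add: cross3_simps forall_3)
    finally show ?case using n1 by (simp add: inner_diff_left n_def \<alpha>_def)
  qed
qed

lemma boundary_term_symmetric: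
  assumes u: "u \<in> H2_vec \<Omega>" "u \<in> H10_vec \<Omega>" and \<phi>: "\<phi> \<in> H2_vec \<Omega>" "\<phi> \<in> H10_vec \<Omega>"
  shows "(LINT x|\<sigma>. boundary_integrand u \<phi> x) = (LINT x|\<sigma>. boundary_integrand \<phi> u x)"
proof (rule integral_cong_AE)
  show "AE x in \<sigma>. boundary_integrand u \<phi> x = boundary_integrand \<phi> u x"
    using boundary_integrand_eq[OF u, of \<phi>] boundary_integrand_eq[OF \<phi>, of u]
    by eventually_elim (simp add: inner_commute mult.commute)
qed (intro boundary_integrand_measurable u \<phi>)+

end

theorem theorem2p4:
  fixes \<Omega> :: "(real^3) set" and \<beta> \<gamma> ell k :: real
  assumes "bounded_C2_domain \<Omega>"
    and "\<beta> > 0" and "\<bar>\<gamma>\<bar> \<le> 1" and "ell > 0" and "k = ell / \<beta>\<^sup>2"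
  shows "(\<exists>C>0. \<forall>u\<in>H2_vec \<Omega>. \<forall>\<phi>\<in>H2_vec \<Omega>.
            \<bar>a_form \<Omega> \<gamma> k u \<phi>\<bar> \<le> C * H2_vec_norm \<Omega> u * H2_vec_norm \<Omega> \<phi>)
       \<and> (\<forall>u \<in> H2_vec \<Omega> \<inter> H10_vec \<Omega>. \<forall>\<phi> \<in> H2_vec \<Omega> \<inter> H10_vec \<Omega>.
            a_form \<Omega> \<gamma> k u \<phi> = a_form \<Omega> \<gamma> k \<phi> u)"
proof -
  interpret C2_domain \<Omega> using assms(1) by unfold_locales
  obtain C where C: "C > 0" "\<And>u \<phi>. u \<in> H2_vec \<Omega> \<Longrightarrow> \<phi> \<in> H2_vec \<Omega> \<Longrightarrow>
      \<bar>LINT x|\<sigma>. boundary_integrand u \<phi> x\<bar> \<le> C * H2_vec_norm \<Omega> u * H2_vec_norm \<Omega> \<phi>"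
    using boundary_term_bound by blast
  show ?thesis
  \<comment> \<open>The constant adds the volume bound 1152 and \<open>\<bar>k\<bar>\<close> times
    the constant of the boundary term.\<close>
  proof (intro conjI exI[of _ "1152 + \<bar>k\<bar> * C"] ballI)
    show "1152 + \<bar>k\<bar> * C > 0" using C(1) by (simp add: add_pos_nonneg)
    fix u \<phi> assume u: "u \<in> H2_vec \<Omega>" and \<phi>: "\<phi> \<in> H2_vec \<Omega>"
    have "\<bar>a_form \<Omega> \<gamma> k u \<phi>\<bar> \<le> 1152 * H2_vec_norm \<Omega> u * H2_vec_norm \<Omega> \<phi> + \<bar>k\<bar> * (C * H2_vec_norm \<Omega> u * H2_vec_norm \<Omega> \<phi>)"
      unfolding a_form_eq
      by (rule order_trans[OF abs_triangle_ineq add_mono[OF volume_term_bound[OF u \<phi> assms(3)]]])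
         (simp only: abs_mult, rule mult_left_mono[OF C(2)[OF u \<phi>] abs_ge_zero])
    then show "\<bar>a_form \<Omega> \<gamma> k u \<phi>\<bar> \<le> (1152 + \<bar>k\<bar> * C) * H2_vec_norm \<Omega> u * H2_vec_norm \<Omega> \<phi>"
      by (simp add: algebra_simps)
  next
    fix u \<phi> assume u: "u \<in> H2_vec \<Omega> \<inter> H10_vec \<Omega>" and \<phi>: "\<phi> \<in> H2_vec \<Omega> \<inter> H10_vec \<Omega>"
    \<comment> \<open>The part without \<open>\<gamma>\<close> is symmetric at once; in the part
      with \<open>\<gamma>\<close>, exchanging the summation indices exchanges the roles of
      \<open>u\<close> and \<open>\<phi>\<close>.\<close>
    have "(\<Sum>i\<in>UNIV. \<Sum>j\<in>UNIV. (gcurl u i j x + \<gamma> * gcurl u j i x) * gcurl \<phi> i j x) =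
        (\<Sum>i\<in>UNIV. \<Sum>j\<in>UNIV. (gcurl \<phi> i j x + \<gamma> * gcurl \<phi> j i x) * gcurl u i j x)" for x
      by (simp add: sum_3 algebra_simps)
    then show "a_form \<Omega> \<gamma> k u \<phi> = a_form \<Omega> \<gamma> k \<phi> u"
      unfolding a_form_eq using boundary_term_symmetric[of u \<phi>] u \<phi> by simp
  qed
qed

end
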